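(* Let $\beta>0$ and $L>0$. Consider the model $f=R_\phi[u]+\varepsilon$ with unknown $\phi\in L^2_\rho$, and suppose that the forward operator and input assumption, the noise assumption (both (B1) with constant $\sigma$ and (B2)), and the fourth-moment condition described in the context hold. (i) If the eigenvalues of the normal operator decay polynomially, $a k^{-2r}\le\lambda_k\le b k^{-2r}$ for all $k\ge1$ with $r>\frac14$ and $b\ge a>0$, then $$\limsup_{M\to\infty}\ \inf_{\widehat\phi}\ \sup_{\phi_*\in H^\beta_\rho(L)}\mathbb E_{\phi_*}\Big[M^{\frac{2\beta r}{2\beta r+2r+1}}\|\widehat\phi-\phi_*\|_{L^2_\rho}^2\Big]\le 3\Big(\frac{2\sigma^2}{a}\Big)^{\frac{2\beta r}{2\beta r+2r+1}}(b^\beta L^2)^{\frac{2r+1}{2\beta r+2r+1}} .$$ (ii) If the eigenvalues of the normal operator decay exponentially, $a e^{-rk}\le\lambda_k\le b e^{-rk}$ for all $k\ge1$ with $r>0$ and $b\ge a>0$, then $$\limsup_{M\to\infty}\ \inf_{\widehat\phi}\ \sup_{\phi_*\in H^\beta_\rho(L)}\mathbb E_{\phi_*}\Big[M^{\frac{\beta}{\beta+1}}\|\widehat\phi-\phi_*\|_{L^2_\rho}^2\Big]\le 2\Big(\frac{4\sigma^2e^r}{a(e^r-1)}\Big)^{\frac{\beta}{\beta+1}}(b^\beta L^2)^{\frac1{\beta+1}} .$$ Here the infimum runs over all $L^2_\rho$-valued estimators $\widehat\phi$ based on the data $\{(u^m,f^m)\}_{m=1}^M$, and $\mathbb E_{\phi_*}$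 is the expectation when the data are generated from the model with kernel $\phi_*$.
   Context: Setting. $\mathcal S\subset\mathbb R^d$ is compact, $\rho$ is a Borel measure on $\mathcal S$, $L^2_\rho=L^2(\mathcal S,\mathcal B(\mathcal S),\rho)$; $\mathbb X$ is a Banach space, $\mathbb Y$ a (finite- or infinite-dimensional) separable real Hilbert space with inner product $\langle\cdot,\cdot\rangle_{\mathbb Y}$. For every $\phi\in L^2_\rho$, $R_\phi:\mathbb X\to\mathbb Y$ is a measurable, possibly nonlinear, map; $u$ is an $\mathbb X$-valued random variable on a complete probability space $(\Omega,\mathcal F,\mathbb P)$. Forward operator and input assumption. (1) $R_\phi[u]$ is linear in $\phi$ for each $u\in\mathbb X$. (2) The normal operator $\mathcal L:L^2_\rho\to L^2_\rho$ defined by $\langle\mathcal L\phi,\psi\rangle_{L^2_\rho}=\mathbb E[\langle R_\phi[u],R_\psi[u]\rangle_{\mathbb Y}]$ (these expectations being finite) is nonnegative, self-adjoint and compact, with positive eigenvalues $\lambda_1\ge\lambda_2\ge\cdots>0$ (infinitely many, counted with multiplicity) decaying either polynomially ($ak^{-2r}\le\lambda_k\le bk^{-2r}$, $r>1/4$) or exponentially ($ae^{-rk}\le\lambda_k\le be^{-rk}$, $r>0$), with $b\ge a>0$. Let $\{\psi_k\}_{k\ge1}$ be corresponding orthonormal eigenfunctions. Noise assumption. $\varepsilon:\mathbb Y\to L^2(\Omega)$, $y\mapsto\langle\varepsilon,y\rangle$, is a linear map, independent of $u$ (i.e. the family $(\langle\varepsilon,y\rangle)_{y\in\mathbb Y}$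 is independent of $u$), such that: (B1) $\mathbb E[\langle\varepsilon,y\rangle]=0$ and $\mathbb E[\langle\varepsilon,y\rangle^2]\le\sigma^2\|y\|_{\mathbb Y}^2$ for all $y\in\mathbb Y$, for some constant $\sigma>0$. (B2) For some orthonormal basis $\{y_i\}$ of $\mathbb Y$, for every $N$ (with $N\le\dim\mathbb Y$) the vector $(\langle\varepsilon,y_1\rangle,\dots,\langle\varepsilon,y_N\rangle)$ has a Lebesgue density $p_N$ on $\mathbb R^N$, and there is $\tau>0$, uniform in $N$ and $v$, with $\int_{\mathbb R^N}\log\big(\frac{p_N(x)}{p_N(x+v)}\big)p_N(x)\,dx\le\frac\tau2\|v\|^2$ for all $v\in\mathbb R^N$. Fourth-moment condition. There is $\kappa\ge1$ with $\mathbb E[\|R_\phi[u]\|_{\mathbb Y}^4]\le\kappa\,(\mathbb E[\|R_\phi[u]\|_{\mathbb Y}^2])^2$ for all $\phi\in H^\beta_\rho$. Spectral Sobolev spaces. $H^\beta_\rho=\{\phi=\sum_{k\ge1}\theta_k\psi_k:\ \|\phi\|_{H^\beta_\rho}^2=\sum_{k\ge1}\lambda_k^{-\beta}\theta_k^2<\infty\}$ and $H^\beta_\rho(L)=\{\phi\in H^\beta_\rho:\|\phi\|_{H^\beta_\rho}^2\le L^2\}$. Data. $\{(u^m,\varepsilon^m)\}_{m=1}^M$ are i.i.d. copies of $(u,\varepsilon)$ and $f^m=R_{\phi_*}[u^m]+\varepsilon^m$, understood weakly: $\langle f^m,y\rangle=\langle R_{\phi_*}[u^m],y\rangle_{\mathbb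 Y}+\langle\varepsilon^m,y\rangle$ for all $y\in\mathbb Y$. An estimator is a measurable function, with values in $L^2_\rho$, of the data $u^m$, $(\langle f^m,y_i\rangle)_i$, $m=1,\dots,M$; it does not depend on $\phi_*$ but may depend on the known quantities of the model (such as the law of $u$ and the normal operator). *)

theory Defs
  imports "HOL-Probability.Probability"
begin

section \<open>The space of square integrable functions\<close>

text \<open>Elements of the space are represented by functions rather than by classes of functions that
  agree almost everywhere, so the norm below is a seminorm on representatives.  Equations between
  elements are stated almost everywhere.\<close>

definition L2 :: "'s measure \<Rightarrow> ('s \<Rightarrow> real) set" where
  "L2 \<rho> = {\<phi> \<in> borel_measurable \<rho>. integrable \<rho> (\<lambda>x. (\<phi> x)\<^sup>2)}"

definition l2_inner :: "'s measure \<Rightarrow> ('s \<Rightarrow> real) \<Rightarrow> ('s \<Rightarrow> real) \<Rightarrow> real" where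
  "l2_inner \<rho> \<phi> \<psi> = (LINT x|\<rho>. \<phi> x * \<psi> x)"

definition l2_norm :: "'s measure \<Rightarrow> ('s \<Rightarrow> real) \<Rightarrow> real" where
  "l2_norm \<rho> \<phi> = sqrt (l2_inner \<rho> \<phi> \<phi>)"

definition l2_open :: "'s measure \<Rightarrow> ('s \<Rightarrow> real) set \<Rightarrow> bool" where
  "l2_open \<rho> A \<longleftrightarrow> A \<subseteq> L2 \<rho> \<and>
     (\<forall>\<phi>\<in>A. \<exists>e>0. \<forall>\<psi>\<in>L2 \<rho>. l2_norm \<rho> (\<lambda>x. \<psi> x - \<phi> x) < e \<longrightarrow> \<psi> \<in> A)"

text \<open>The Borel sigma-algebra of the norm topology.\<close>

definition l2_borel :: "'s measure \<Rightarrow> ('s \<Rightarrow> real) measure" where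
  "l2_borel \<rho> = sigma (L2 \<rho>) {A. l2_open \<rho> A}"

section \<open>Forward operator and normal operator\<close>

definition forward_map ::
  "'s measure \<Rightarrow> (('s \<Rightarrow> real) \<Rightarrow> 'x::banach \<Rightarrow> 'y::real_inner) \<Rightarrow> bool" where
  "forward_map \<rho> R \<longleftrightarrow>
     (\<forall>\<phi>\<in>L2 \<rho>. R \<phi> \<in> borel_measurable borel) \<and>
     (\<forall>\<phi>\<in>L2 \<rho>. \<forall>\<psi>\<in>L2 \<rho>. (AE x in \<rho>. \<phi> x = \<psi> x) \<longrightarrow> R \<phi> = R \<psi>) \<and>
     (\<forall>\<phi>\<in>L2 \<rho>. \<forall>\<psi>\<in>L2 \<rho>. \<forall>s t u.
        R (\<lambda>x. s * \<phi> x + t * \<psi> x) u = s *\<^sub>R R \<phi> u + t *\<^sub>R R \<psi> u)"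

definition normal_operator ::
  "'s measure \<Rightarrow> (('s \<Rightarrow> real) \<Rightarrow> 'x \<Rightarrow> 'y::real_inner) \<Rightarrow> 'w measure \<Rightarrow> ('w \<Rightarrow> 'x) \<Rightarrow>
    (('s \<Rightarrow> real) \<Rightarrow> ('s \<Rightarrow> real)) \<Rightarrow> bool" where
  "normal_operator \<rho> R P u N \<longleftrightarrow>
     (\<forall>\<phi>\<in>L2 \<rho>. N \<phi> \<in> L2 \<rho>) \<and>
     (\<forall>\<phi>\<in>L2 \<rho>. \<forall>\<psi>\<in>L2 \<rho>.
        integrable P (\<lambda>\<omega>. inner (R \<phi> (u \<omega>)) (R \<psi> (u \<omega>))) \<and>
        l2_inner \<rho> (N \<phi>) \<psi> = (LINT \<omega>|P. inner (R \<phi> (u \<omega>)) (R \<psi> (u \<omega>))))"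

definition nonnegative_op :: "'s measure \<Rightarrow> (('s \<Rightarrow> real) \<Rightarrow> ('s \<Rightarrow> real)) \<Rightarrow> bool" where
  "nonnegative_op \<rho> N \<longleftrightarrow> (\<forall>\<phi>\<in>L2 \<rho>. 0 \<le> l2_inner \<rho> (N \<phi>) \<phi>)"

definition self_adjoint_op :: "'s measure \<Rightarrow> (('s \<Rightarrow> real) \<Rightarrow> ('s \<Rightarrow> real)) \<Rightarrow> bool" where
  "self_adjoint_op \<rho> N \<longleftrightarrow>
     (\<forall>\<phi>\<in>L2 \<rho>. \<forall>\<psi>\<in>L2 \<rho>. l2_inner \<rho> (N \<phi>) \<psi> = l2_inner \<rho> \<phi> (N \<psi>))"

definition compact_op :: "'s measure \<Rightarrow> (('s \<Rightarrow> real) \<Rightarrow> ('s \<Rightarrow> real)) \<Rightarrow> bool" where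
  "compact_op \<rho> N \<longleftrightarrow>
     (\<forall>\<phi>::nat \<Rightarrow> 's \<Rightarrow> real. (\<forall>n. \<phi> n \<in> L2 \<rho>) \<and> (\<exists>B. \<forall>n. l2_norm \<rho> (\<phi> n) \<le> B) \<longrightarrow>
        (\<exists>g\<in>L2 \<rho>. \<exists>s::nat \<Rightarrow> nat. strict_mono s \<and>
           (\<lambda>n. l2_norm \<rho> (\<lambda>x. N (\<phi> (s n)) x - g x)) \<longlonglongrightarrow> 0))"

text \<open>Sequences indexed by the positive integers are functions on \<open>nat\<close> whose value at \<open>0\<close> is
  never used.  The last clause says that the list \<open>lam\<close> contains every positive eigenvalue
  as often as its multiplicity.\<close>

definition eigensystem ::
  "'s measure \<Rightarrow> (('s \<Rightarrow> real) \<Rightarrow> ('s \<Rightarrow> real)) \<Rightarrow> (nat \<Rightarrow> real) \<Rightarrow> (nat \<Rightarrow> 's \<Rightarrow> real) \<Rightarrow> bool" where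
  "eigensystem \<rho> N lam \<psi> \<longleftrightarrow>
     (\<forall>k\<ge>1. 0 < lam k \<and> lam (Suc k) \<le> lam k) \<and>
     (\<forall>k\<ge>1. \<psi> k \<in> L2 \<rho> \<and> (AE x in \<rho>. N (\<psi> k) x = lam k * \<psi> k x)) \<and>
     (\<forall>j\<ge>1. \<forall>k\<ge>1. l2_inner \<rho> (\<psi> j) (\<psi> k) = (if j = k then 1 else 0)) \<and>
     (\<forall>\<mu>>0. \<forall>\<phi>\<in>L2 \<rho>. (AE x in \<rho>. N \<phi> x = \<mu> * \<phi> x) \<longrightarrow>
        finite {k. 1 \<le> k \<and> lam k = \<mu>} \<and>
        (\<exists>c. AE x in \<rho>. \<phi> x = (\<Sum>k | 1 \<le> k \<and> lam k = \<mu>. c k * \<psi> k x)))"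

definition polynomial_decay :: "(nat \<Rightarrow> real) \<Rightarrow> real \<Rightarrow> real \<Rightarrow> real \<Rightarrow> bool" where
  "polynomial_decay lam a b r \<longleftrightarrow> 1/4 < r \<and> 0 < a \<and> a \<le> b \<and>
     (\<forall>k\<ge>1. a * real k powr (- 2 * r) \<le> lam k \<and> lam k \<le> b * real k powr (- 2 * r))"

definition exponential_decay :: "(nat \<Rightarrow> real) \<Rightarrow> real \<Rightarrow> real \<Rightarrow> real \<Rightarrow> bool" where
  "exponential_decay lam a b r \<longleftrightarrow> 0 < r \<and> 0 < a \<and> a \<le> b \<and>
     (\<forall>k\<ge>1. a * exp (- r * real k) \<le> lam k \<and> lam k \<le> b * exp (- r * real k))"

section \<open>Spectral Sobolev spaces\<close>

definition l2_expansion ::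
  "'s measure \<Rightarrow> (nat \<Rightarrow> 's \<Rightarrow> real) \<Rightarrow> (nat \<Rightarrow> real) \<Rightarrow> ('s \<Rightarrow> real) \<Rightarrow> bool" where
  "l2_expansion \<rho> \<psi> \<theta> \<phi> \<longleftrightarrow>
     (\<lambda>n. l2_norm \<rho> (\<lambda>x. \<phi> x - (\<Sum>k=1..n. \<theta> k * \<psi> k x))) \<longlonglongrightarrow> 0"

definition sobolev_space ::
  "'s measure \<Rightarrow> (nat \<Rightarrow> real) \<Rightarrow> (nat \<Rightarrow> 's \<Rightarrow> real) \<Rightarrow> real \<Rightarrow> ('s \<Rightarrow> real) set" where
  "sobolev_space \<rho> lam \<psi> \<beta> = {\<phi> \<in> L2 \<rho>. \<exists>\<theta>. l2_expansion \<rho> \<psi> \<theta> \<phi> \<and>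
     (\<lambda>k. lam k powr (- \<beta>) * (\<theta> k)\<^sup>2) summable_on {1..}}"

definition sobolev_ball ::
  "'s measure \<Rightarrow> (nat \<Rightarrow> real) \<Rightarrow> (nat \<Rightarrow> 's \<Rightarrow> real) \<Rightarrow> real \<Rightarrow> real \<Rightarrow> ('s \<Rightarrow> real) set" where
  "sobolev_ball \<rho> lam \<psi> \<beta> L = {\<phi> \<in> L2 \<rho>. \<exists>\<theta>. l2_expansion \<rho> \<psi> \<theta> \<phi> \<and>
     (\<lambda>k. lam k powr (- \<beta>) * (\<theta> k)\<^sup>2) summable_on {1..} \<and>
     (\<Sum>\<^sub>\<infinity>k\<in>{1..}. lam k powr (- \<beta>) * (\<theta> k)\<^sup>2) \<le> L\<^sup>2}"

definition fourth_moment_condition ::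
  "'w measure \<Rightarrow> ('w \<Rightarrow> 'x) \<Rightarrow> (('s \<Rightarrow> real) \<Rightarrow> 'x \<Rightarrow> 'y::real_normed_vector) \<Rightarrow>
    ('s \<Rightarrow> real) set \<Rightarrow> bool" where
  "fourth_moment_condition P u R H \<longleftrightarrow> (\<exists>\<kappa>\<ge>1. \<forall>\<phi>\<in>H.
     integrable P (\<lambda>\<omega>. norm (R \<phi> (u \<omega>)) ^ 4) \<and>
     (LINT \<omega>|P. norm (R \<phi> (u \<omega>)) ^ 4) \<le> \<kappa> * (LINT \<omega>|P. (norm (R \<phi> (u \<omega>)))\<^sup>2)\<^sup>2)"

section \<open>Noise\<close>

text \<open>The index set \<open>I\<close> is \<open>{1..dim}\<close> in finite dimension and \<open>{1..}\<close> otherwise, so that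
  \<open>N \<le> dim\<close> reads \<open>{1..N} \<subseteq> I\<close>.\<close>

definition onb :: "nat set \<Rightarrow> (nat \<Rightarrow> 'y::real_inner) \<Rightarrow> bool" where
  "onb I y \<longleftrightarrow> (I = {1..} \<or> (\<exists>n. I = {1..n})) \<and>
     (\<forall>i\<in>I. \<forall>j\<in>I. inner (y i) (y j) = (if i = j then 1 else 0)) \<and>
     closure (span (y ` I)) = UNIV"

text \<open>A linear map into the space of square integrable random variables: \<open>\<epsilon> y\<close> is a version of
  the pairing of the noise with \<open>y\<close>, hence additive and homogeneous only almost surely.\<close>

definition linear_noise :: "'w measure \<Rightarrow> ('y::real_vector \<Rightarrow> 'w \<Rightarrow> real) \<Rightarrow> bool" where
  "linear_noise P \<epsilon> \<longleftrightarrow>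
     (\<forall>y. \<epsilon> y \<in> L2 P) \<and>
     (\<forall>y z s t. AE \<omega> in P. \<epsilon> (s *\<^sub>R y + t *\<^sub>R z) \<omega> = s * \<epsilon> y \<omega> + t * \<epsilon> z \<omega>)"

text \<open>The library predicate \<open>indep_var\<close> requires both variables to have the same range type.\<close>

definition noise_independent ::
  "'w measure \<Rightarrow> ('w \<Rightarrow> 'x::topological_space) \<Rightarrow> ('y \<Rightarrow> 'w \<Rightarrow> real) \<Rightarrow> bool" where
  "noise_independent P u \<epsilon> \<longleftrightarrow>
     prob_space.indep_set P
       {u -` A \<inter> space P |A. A \<in> sets borel}
       {(\<lambda>\<omega> y. \<epsilon> y \<omega>) -` B \<inter> space P |B. B \<in> sets (\<Pi>\<^sub>M y\<in>UNIV. borel)}"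

definition noise_B1 :: "'w measure \<Rightarrow> ('y::real_normed_vector \<Rightarrow> 'w \<Rightarrow> real) \<Rightarrow> real \<Rightarrow> bool" where
  "noise_B1 P \<epsilon> \<sigma> \<longleftrightarrow> 0 < \<sigma> \<and>
     (\<forall>y. (LINT \<omega>|P. \<epsilon> y \<omega>) = 0 \<and> (LINT \<omega>|P. (\<epsilon> y \<omega>)\<^sup>2) \<le> \<sigma>\<^sup>2 * (norm y)\<^sup>2)"

text \<open>Where \<open>p x > 0 = p (x + v)\<close> the integrand is meant to be infinite, whereas \<open>ln (p x / 0) = 0\<close>
  here; finiteness of the integral is therefore spelled out by the clause preceding the
  integral together with integrability.  Where \<open>p x = 0\<close> the integrand is \<open>0\<close>.\<close>

definition noise_B2 ::
  "'w measure \<Rightarrow> nat set \<Rightarrow> (nat \<Rightarrow> 'y) \<Rightarrow> ('y \<Rightarrow> 'w \<Rightarrow> real) \<Rightarrow> bool" where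
  "noise_B2 P I y \<epsilon> \<longleftrightarrow> (\<exists>\<tau>>0. \<forall>N. {1..N} \<subseteq> I \<longrightarrow>
     (\<exists>p :: (nat \<Rightarrow> real) \<Rightarrow> real.
        (\<forall>x. 0 \<le> p x) \<and>
        p \<in> borel_measurable (\<Pi>\<^sub>M i\<in>{1..N}. lborel) \<and>
        distributed P (\<Pi>\<^sub>M i\<in>{1..N}. lborel) (\<lambda>\<omega>. \<lambda>i\<in>{1..N}. \<epsilon> (y i) \<omega>) (\<lambda>x. ennreal (p x)) \<and>
        (\<forall>v :: nat \<Rightarrow> real.
           let q = (\<lambda>x. p (\<lambda>i\<in>{1..N}. x i + v i)) in
             (AE x in (\<Pi>\<^sub>M i\<in>{1..N}. lborel). 0 < p x \<longrightarrow> 0 < q x) \<and>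
             integrable (\<Pi>\<^sub>M i\<in>{1..N}. lborel) (\<lambda>x. ln (p x / q x) * p x) \<and>
             (LINT x|(\<Pi>\<^sub>M i\<in>{1..N}. lborel). ln (p x / q x) * p x)
               \<le> \<tau> / 2 * (\<Sum>i=1..N. (v i)\<^sup>2))))"

section \<open>Data and estimators\<close>

text \<open>The noise is regarded as a random element of the product space of all its pairings.\<close>

abbreviation sample_space :: "('x::topological_space \<times> ('y \<Rightarrow> real)) measure" where
  "sample_space \<equiv> borel \<Otimes>\<^sub>M (\<Pi>\<^sub>M y\<in>UNIV. borel)"

definition iid_copies ::
  "'w measure \<Rightarrow> ('w \<Rightarrow> 'x::topological_space) \<Rightarrow> ('y \<Rightarrow> 'w \<Rightarrow> real) \<Rightarrow>
   'v measure \<Rightarrow> (nat \<Rightarrow> 'v \<Rightarrow> 'x) \<Rightarrow> (nat \<Rightarrow> 'y \<Rightarrow> 'v \<Rightarrow> real) \<Rightarrow> bool" where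
  "iid_copies P u \<epsilon> Q us es \<longleftrightarrow>
     prob_space.indep_vars Q (\<lambda>_. sample_space) (\<lambda>m \<omega>. (us m \<omega>, \<lambda>y. es m y \<omega>)) {1..} \<and>
     (\<forall>m\<ge>1. distr Q sample_space (\<lambda>\<omega>. (us m \<omega>, \<lambda>y. es m y \<omega>)) =
             distr P sample_space (\<lambda>\<omega>. (u \<omega>, \<lambda>y. \<epsilon> y \<omega>)))"

definition data_space ::
  "nat set \<Rightarrow> nat \<Rightarrow> (nat \<Rightarrow> 'x::topological_space \<times> (nat \<Rightarrow> real)) measure" where
  "data_space I M = (\<Pi>\<^sub>M m\<in>{1..M}. borel \<Otimes>\<^sub>M (\<Pi>\<^sub>M i\<in>I. borel))"

definition data ::
  "(('s \<Rightarrow> real) \<Rightarrow> 'x \<Rightarrow> 'y::real_inner) \<Rightarrow> nat set \<Rightarrow> (nat \<Rightarrow> 'y) \<Rightarrow>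
   (nat \<Rightarrow> 'v \<Rightarrow> 'x) \<Rightarrow> (nat \<Rightarrow> 'y \<Rightarrow> 'v \<Rightarrow> real) \<Rightarrow> ('s \<Rightarrow> real) \<Rightarrow> nat \<Rightarrow> 'v \<Rightarrow>
   nat \<Rightarrow> 'x \<times> (nat \<Rightarrow> real)" where
  "data R I y us es \<phi> M \<omega> =
     (\<lambda>m\<in>{1..M}. (us m \<omega>, \<lambda>i\<in>I. inner (R \<phi> (us m \<omega>)) (y i) + es m (y i) \<omega>))"

definition estimators ::
  "'s measure \<Rightarrow> nat set \<Rightarrow> nat \<Rightarrow>
   ((nat \<Rightarrow> 'x::topological_space \<times> (nat \<Rightarrow> real)) \<Rightarrow> 's \<Rightarrow> real) set" where
  "estimators \<rho> I M = measurable (data_space I M) (l2_borel \<rho>)"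

text \<open>The minimax risk over \<open>H\<close> from \<open>M\<close> samples, with the squared loss scaled by \<open>M powr \<gamma>\<close>.\<close>

definition scaled_minimax_risk ::
  "'s measure \<Rightarrow> (('s \<Rightarrow> real) \<Rightarrow> 'x::topological_space \<Rightarrow> 'y::real_inner) \<Rightarrow>
   nat set \<Rightarrow> (nat \<Rightarrow> 'y) \<Rightarrow> 'v measure \<Rightarrow> (nat \<Rightarrow> 'v \<Rightarrow> 'x) \<Rightarrow> (nat \<Rightarrow> 'y \<Rightarrow> 'v \<Rightarrow> real) \<Rightarrow>
   ('s \<Rightarrow> real) set \<Rightarrow> real \<Rightarrow> nat \<Rightarrow> ennreal" where
  "scaled_minimax_risk \<rho> R I y Q us es H \<gamma> M =
     (INF est\<in>estimators \<rho> I M. SUP \<phi>\<in>H.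
        \<integral>\<^sup>+\<omega>. ennreal (real M powr \<gamma> *
          (l2_norm \<rho> (\<lambda>x. est (data R I y us es \<phi> M \<omega>) x - \<phi> x))\<^sup>2) \<partial>Q)"

end

theory Submission
  imports Defs
begin

text \<open>Split the sample into two halves.  Since the normal operator is known,
  \<open>\<lambda>\<^sub>k\<^sup>-\<^sup>1\<close> times the average of \<open>\<langle>f, R\<^bsub>\<psi> k\<^esub>[u]\<rangle>\<close> estimates the coefficient \<open>\<theta>\<^sub>k\<close> without bias, but its
  variance, of order \<open>(\<sigma>\<^sup>2 + \<kappa> E\<parallel>R\<^bsub>\<phi>\<^esub>[u]\<parallel>\<^sup>2) / (M \<lambda>\<^sub>k)\<close>, contains the random design.  The first half therefore
  yields pilot estimates of the first \<open>n'\<close> coefficients, with \<open>n'\<close> fixed, and the second half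
  estimates all coefficients up to \<open>n\<close> from the residuals of the pilot fit.  The design then
  contributes only \<open>\<kappa> E\<parallel>R\<^bsub>t\<^esub>[u]\<parallel>\<^sup>2\<close> for the tail \<open>t\<close> of \<open>\<phi>\<close> beyond \<open>n'\<close>, which is small uniformly over the
  Sobolev ball for large \<open>n'\<close>, plus a term of order \<open>1/M\<close>.  For all large \<open>M\<close> and every \<open>n\<close> this
  bounds the risk by \<open>4 \<sigma>\<^sup>2/M \<Sum>\<^bsub>k\<le>n\<^esub> 1/\<lambda>\<^sub>k + \<lambda>\<^bsub>n+1\<^esub>\<^sup>\<beta> L\<^sup>2\<close>, and the choice of \<open>n\<close> that balances the two
  terms gives both constants.  The pairing of the noise with \<open>R\<^bsub>\<psi> k\<^esub>[u]\<close> is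
  undefined in infinite dimension, so \<open>R\<^bsub>\<psi> k\<^esub>[u]\<close> is projected onto the first \<open>J\<close> basis vectors, with \<open>J\<close>
  depending on \<open>M\<close> and \<open>n\<close>.\<close>

text \<open>Index ranges start at \<open>1\<close>; rewriting it to \<open>Suc 0\<close> would keep
  facts about \<open>{1..n}\<close> from matching.\<close>

declare One_nat_def [simp del]

section \<open>Square integrable functions\<close>

lemma L2_measurable: "f \<in> L2 M \<Longrightarrow> f \<in> borel_measurable M"
  by (simp add: L2_def)

lemma L2_mult_integrable:
  assumes "f \<in> L2 M" "g \<in> L2 M"
  shows "integrable M (\<lambda>x. f x * g x)"
proof (rule Bochner_Integration.integrable_bound)
  show "integrable M (\<lambda>x. (f x)\<^sup>2 + (g x)\<^sup>2)"
    using assms by (simp add: L2_def)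
  show "(\<lambda>x. f x * g x) \<in> borel_measurable M"
    using assms by (intro borel_measurable_times L2_measurable)
  have "\<bar>s * t\<bar> \<le> s\<^sup>2 + t\<^sup>2" for s t :: real
  proof -
    have "2 * (\<bar>s\<bar> * \<bar>t\<bar>) \<le> s\<^sup>2 + t\<^sup>2"
      using sum_squares_bound[of "\<bar>s\<bar>" "\<bar>t\<bar>"] by (simp add: mult.assoc)
    moreover have "0 \<le> \<bar>s\<bar> * \<bar>t\<bar>" by simp
    ultimately show ?thesis unfolding abs_mult by linarith
  qed
  then show "AE x in M. norm (f x * g x) \<le> norm ((f x)\<^sup>2 + (g x)\<^sup>2)"
    by simp
qed

lemma L2_zero: "(\<lambda>x. 0) \<in> L2 M"
  by (simp add: L2_def)

lemma L2_scale: "f \<in> L2 M \<Longrightarrow> (\<lambda>x. c * f x) \<in> L2 M"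
  by (auto simp: L2_def power_mult_distrib)

lemma L2_add:
  assumes "f \<in> L2 M" "g \<in> L2 M"
  shows "(\<lambda>x. f x + g x) \<in> L2 M"
proof -
  have "(\<lambda>x. (f x + g x)\<^sup>2) = (\<lambda>x. (f x)\<^sup>2 + (g x)\<^sup>2 + 2 * (f x * g x))"
    by (simp add: power2_eq_square algebra_simps)
  then show ?thesis
    using assms L2_mult_integrable[OF assms] by (auto simp: L2_def)
qed

lemma L2_diff: "f \<in> L2 M \<Longrightarrow> g \<in> L2 M \<Longrightarrow> (\<lambda>x. f x - g x) \<in> L2 M"
  using L2_add[of f M "\<lambda>x. - 1 * g x"] L2_scale[of g M "- 1"] by simp

lemma L2_sum:
  "finite A \<Longrightarrow> (\<And>k. k \<in> A \<Longrightarrow> f k \<in> L2 M) \<Longrightarrow> (\<lambda>x. \<Sum>k\<in>A. c k * f k x) \<in> L2 M"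
  by (induction A rule: finite_induct) (auto simp: L2_zero intro!: L2_add L2_scale)

lemma L2_bound:
  assumes "g \<in> L2 M" "f \<in> borel_measurable M" "\<And>x. \<bar>f x\<bar> \<le> \<bar>g x\<bar>"
  shows "f \<in> L2 M"
proof -
  have "integrable M (\<lambda>x. (f x)\<^sup>2)"
    by (rule Bochner_Integration.integrable_bound[where f="\<lambda>x. (g x)\<^sup>2"])
      (use assms in \<open>auto simp: L2_def abs_le_square_iff\<close>)
  then show ?thesis using assms by (simp add: L2_def)
qed

lemma l2_inner_commute: "l2_inner M f g = l2_inner M g f"
  by (simp add: l2_inner_def mult.commute)

lemma l2_inner_self: "l2_inner M f f = (LINT x|M. (f x)\<^sup>2)"
  by (simp add: l2_inner_def power2_eq_square)

lemma l2_inner_self_nonneg: "0 \<le> l2_inner M f f"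
  by (simp add: l2_inner_self)

lemma l2_norm_power2: "(l2_norm M f)\<^sup>2 = l2_inner M f f"
  by (simp add: l2_norm_def l2_inner_self_nonneg)

lemma l2_inner_diff_left:
  "f \<in> L2 M \<Longrightarrow> g \<in> L2 M \<Longrightarrow> h \<in> L2 M \<Longrightarrow>
    l2_inner M (\<lambda>x. f x - g x) h = l2_inner M f h - l2_inner M g h"
  by (simp add: l2_inner_def left_diff_distrib L2_mult_integrable)

lemma l2_inner_diff_right:
  "f \<in> L2 M \<Longrightarrow> g \<in> L2 M \<Longrightarrow> h \<in> L2 M \<Longrightarrow>
    l2_inner M h (\<lambda>x. f x - g x) = l2_inner M h f - l2_inner M h g"
  by (simp add: l2_inner_def right_diff_distrib L2_mult_integrable)

lemma l2_inner_sum_left: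
  assumes "finite A" "\<And>k. k \<in> A \<Longrightarrow> f k \<in> L2 M" "h \<in> L2 M"
  shows "l2_inner M (\<lambda>x. \<Sum>k\<in>A. c k * f k x) h = (\<Sum>k\<in>A. c k * l2_inner M (f k) h)"
proof -
  have "l2_inner M (\<lambda>x. \<Sum>k\<in>A. c k * f k x) h = (LINT x|M. (\<Sum>k\<in>A. c k * (f k x * h x)))"
    by (simp add: l2_inner_def sum_distrib_right mult.assoc)
  also have "\<dots> = (\<Sum>k\<in>A. (LINT x|M. c k * (f k x * h x)))"
    by (rule Bochner_Integration.integral_sum) (simp add: assms L2_mult_integrable)
  finally show ?thesis by (simp add: l2_inner_def)
qed

text \<open>The integral of the square of \<open>s * f - t * g\<close> is a nonnegative quadratic
  form in \<open>s\<close> and \<open>t\<close>. Since \<open>l2_norm\<close> is only a seminorm on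
  representatives, \<open>l2_inner M g g\<close> can vanish for a nonzero function and that case is
  treated apart.\<close>

lemma l2_Cauchy_Schwarz:
  assumes "f \<in> L2 M" "g \<in> L2 M"
  shows "(l2_inner M f g)\<^sup>2 \<le> l2_inner M f f * l2_inner M g g"
proof -
  have *: "0 \<le> s\<^sup>2 * l2_inner M f f - 2 * s * t * l2_inner M f g + t\<^sup>2 * l2_inner M g g" for s t
  proof -
    have "0 \<le> (LINT x|M. (s * f x - t * g x)\<^sup>2)" by simp
    also have "\<dots> = (LINT x|M. s\<^sup>2 * (f x * f x) - 2 * s * t * (f x * g x) + t\<^sup>2 * (g x * g x))"
      by (rule Bochner_Integration.integral_cong) (auto simp: power2_eq_square algebra_simps)
    also have "\<dots> = s\<^sup>2 * l2_inner M f f - 2 * s * t * l2_inner M f g + t\<^sup>2 * l2_inner M g g"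
      using assms by (simp add: l2_inner_def L2_mult_integrable)
    finally show ?thesis .
  qed
  show ?thesis
  proof (cases "l2_inner M g g = 0")
    case True
    let ?b = "l2_inner M f g" and ?a = "l2_inner M f f"
    \<comment> \<open>With the quadratic coefficient in \<open>t\<close> gone, this \<open>t\<close>
      would give the value \<open>- ?a - 2\<close>, which is negative.\<close>
    have "0 \<le> ?a - 2 * ((?a + 1) / ?b) * ?b" if "?b \<noteq> 0"
      using *[of 1 "(?a + 1) / ?b"] True by simp
    then have "?b = 0" using l2_inner_self_nonneg[of M f] by (cases "?b = 0") auto
    then show ?thesis using True by simp
  next
    case False
    then have pos: "0 < l2_inner M g g" using l2_inner_self_nonneg[of M g] by simp
    have "0 \<le> l2_inner M g g * (l2_inner M g g * l2_inner M f f - (l2_inner M f g)\<^sup>2)"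
      using *[of "l2_inner M g g" "l2_inner M f g"] by (simp add: power2_eq_square algebra_simps)
    then show ?thesis using pos by (simp add: zero_le_mult_iff mult.commute)
  qed
qed

lemma l2_inner_tendsto_right:
  assumes "h \<in> L2 M" "\<And>n. f n \<in> L2 M" "(\<lambda>n. l2_norm M (f n)) \<longlonglongrightarrow> 0"
  shows "(\<lambda>n. l2_inner M h (f n)) \<longlonglongrightarrow> 0"
proof (rule tendsto_rabs_zero_cancel, rule tendsto_sandwich[OF _ _ tendsto_const])
  show "\<forall>\<^sub>F n in sequentially. \<bar>l2_inner M h (f n)\<bar> \<le> l2_norm M h * l2_norm M (f n)"
  proof (rule always_eventually, rule allI)
    fix n
    show "\<bar>l2_inner M h (f n)\<bar> \<le> l2_norm M h * l2_norm M (f n)"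
      using real_sqrt_le_mono[OF l2_Cauchy_Schwarz[OF assms(1) assms(2)[of n]]]
      by (simp add: l2_norm_def real_sqrt_mult)
  qed
  show "(\<lambda>n. l2_norm M h * l2_norm M (f n)) \<longlonglongrightarrow> 0"
    using tendsto_mult_right_zero[OF assms(3)] .
qed auto

section \<open>Orthonormal systems and spectral Sobolev balls\<close>

locale orthonormal_system =
  fixes \<rho> :: "'s measure" and \<psi> :: "nat \<Rightarrow> 's \<Rightarrow> real"
  assumes psi_L2: "1 \<le> k \<Longrightarrow> \<psi> k \<in> L2 \<rho>"
    and psi_ortho: "1 \<le> j \<Longrightarrow> 1 \<le> k \<Longrightarrow> l2_inner \<rho> (\<psi> j) (\<psi> k) = (if j = k then 1 else 0)"
begin

lemma comb_L2: "(\<lambda>x. \<Sum>k=1..n. c k * \<psi> k x) \<in> L2 \<rho>"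
  by (rule L2_sum) (auto simp: psi_L2)

lemma inner_comb_psi:
  assumes "1 \<le> k"
  shows "l2_inner \<rho> (\<lambda>x. \<Sum>j=1..n. c j * \<psi> j x) (\<psi> k) = (if k \<le> n then c k else 0)"
proof -
  have "l2_inner \<rho> (\<lambda>x. \<Sum>j=1..n. c j * \<psi> j x) (\<psi> k) = (\<Sum>j=1..n. c j * l2_inner \<rho> (\<psi> j) (\<psi> k))"
    by (rule l2_inner_sum_left) (use assms in \<open>auto simp: psi_L2\<close>)
  also have "\<dots> = (\<Sum>j=1..n. if j = k then c k else 0)"
    using assms by (intro sum.cong) (auto simp: psi_ortho)
  finally show ?thesis using assms by simp
qed

lemma inner_comb_self:
  "l2_inner \<rho> (\<lambda>x. \<Sum>j=1..n. c j * \<psi> j x) (\<lambda>x. \<Sum>j=1..n. c j * \<psi> j x) = (\<Sum>j=1..n. (c j)\<^sup>2)"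
proof -
  have "l2_inner \<rho> (\<lambda>x. \<Sum>j=1..n. c j * \<psi> j x) (\<lambda>x. \<Sum>j=1..n. c j * \<psi> j x)
     = (\<Sum>k=1..n. c k * l2_inner \<rho> (\<psi> k) (\<lambda>x. \<Sum>j=1..n. c j * \<psi> j x))"
    by (rule l2_inner_sum_left) (auto simp: psi_L2 intro: L2_sum)
  also have "\<dots> = (\<Sum>k=1..n. (c k)\<^sup>2)"
    by (intro sum.cong) (auto simp: l2_inner_commute[of _ "\<psi> _"] inner_comb_psi power2_eq_square)
  finally show ?thesis .
qed

text \<open>Norm convergence of the partial sums passes to inner products with
  \<open>\<psi> k\<close>, and these are constant once \<open>k \<le> n\<close>. Hence any two
  coefficient sequences of the same function agree on positive indices.\<close>

lemma expansion_coeff: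
  assumes "\<phi> \<in> L2 \<rho>" "l2_expansion \<rho> \<psi> \<theta> \<phi>" "1 \<le> k"
  shows "l2_inner \<rho> \<phi> (\<psi> k) = \<theta> k"
proof -
  have "(\<lambda>n. l2_inner \<rho> (\<psi> k) (\<lambda>x. \<phi> x - (\<Sum>j=1..n. \<theta> j * \<psi> j x))) \<longlonglongrightarrow> 0"
    using assms by (intro l2_inner_tendsto_right) (auto simp: psi_L2 l2_expansion_def intro!: L2_diff L2_sum)
  moreover have "\<forall>\<^sub>F n in sequentially.
    l2_inner \<rho> (\<psi> k) (\<lambda>x. \<phi> x - (\<Sum>j=1..n. \<theta> j * \<psi> j x)) = l2_inner \<rho> \<phi> (\<psi> k) - \<theta> k"
  proof (rule eventually_sequentiallyI[of k])
    fix n assume "k \<le> n"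
    then show "l2_inner \<rho> (\<psi> k) (\<lambda>x. \<phi> x - (\<Sum>j=1..n. \<theta> j * \<psi> j x)) = l2_inner \<rho> \<phi> (\<psi> k) - \<theta> k"
      using assms
      by (simp add: l2_inner_commute[of _ "\<psi> k"] l2_inner_diff_left psi_L2 comb_L2 inner_comb_psi)
  qed
  ultimately have "(\<lambda>n::nat. l2_inner \<rho> \<phi> (\<psi> k) - \<theta> k) \<longlonglongrightarrow> 0"
    by (rule Lim_transform_eventually)
  then show ?thesis by (simp add: LIMSEQ_const_iff)
qed

text \<open>Pythagoras: expanding the squared distance for \<open>c\<close> and for
  \<open>\<theta>\<close> and comparing leaves a completed square. Later this splits the loss into
  coefficient errors and truncation bias.\<close>

lemma norm_diff_comb:
  assumes "\<phi> \<in> L2 \<rho>" "l2_expansion \<rho> \<psi> \<theta> \<phi>"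
  shows "(l2_norm \<rho> (\<lambda>x. \<phi> x - (\<Sum>k=1..n. c k * \<psi> k x)))\<^sup>2 =
    (\<Sum>k=1..n. (c k - \<theta> k)\<^sup>2) + (l2_norm \<rho> (\<lambda>x. \<phi> x - (\<Sum>k=1..n. \<theta> k * \<psi> k x)))\<^sup>2"
proof -
  have *: "(l2_norm \<rho> (\<lambda>x. \<phi> x - (\<Sum>k=1..n. c k * \<psi> k x)))\<^sup>2 =
    l2_inner \<rho> \<phi> \<phi> - 2 * (\<Sum>k=1..n. c k * \<theta> k) + (\<Sum>k=1..n. (c k)\<^sup>2)" for c
  proof -
    let ?s = "\<lambda>x. \<Sum>k=1..n. c k * \<psi> k x"
    have "l2_inner \<rho> ?s \<phi> = (\<Sum>k=1..n. c k * l2_inner \<rho> (\<psi> k) \<phi>)"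
      by (rule l2_inner_sum_left) (auto simp: psi_L2 assms)
    also have "\<dots> = (\<Sum>k=1..n. c k * \<theta> k)"
      using assms by (intro sum.cong) (auto simp: l2_inner_commute[of _ "\<psi> _"] expansion_coeff)
    finally have s: "l2_inner \<rho> ?s \<phi> = (\<Sum>k=1..n. c k * \<theta> k)" .
    have "(l2_norm \<rho> (\<lambda>x. \<phi> x - ?s x))\<^sup>2 =
        (l2_inner \<rho> \<phi> \<phi> - l2_inner \<rho> \<phi> ?s) - (l2_inner \<rho> ?s \<phi> - l2_inner \<rho> ?s ?s)"
      unfolding l2_norm_power2
      using comb_L2[of c n] assms(1) L2_diff[OF assms(1) comb_L2[of c n]]
      by (simp add: l2_inner_diff_left l2_inner_diff_right)
    also have "\<dots> = l2_inner \<rho> \<phi> \<phi> - 2 * (\<Sum>k=1..n. c k * \<theta> k) + (\<Sum>k=1..n. (c k)\<^sup>2)"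
      using s by (simp add: l2_inner_commute[of _ \<phi> ?s] inner_comb_self)
    finally show ?thesis .
  qed
  have "(\<Sum>k=1..n. (c k - \<theta> k)\<^sup>2) =
      (\<Sum>k=1..n. (c k)\<^sup>2 + ((\<theta> k)\<^sup>2 - 2 * (c k * \<theta> k)))"
    by (intro sum.cong) (auto simp: power2_eq_square algebra_simps)
  also have "\<dots> = (\<Sum>k=1..n. (c k)\<^sup>2) + ((\<Sum>k=1..n. (\<theta> k)\<^sup>2) - 2 * (\<Sum>k=1..n. c k * \<theta> k))"
    by (simp add: sum.distrib sum_subtractf sum_distrib_left)
  finally show ?thesis
    using *[of c] *[of \<theta>] by (simp add: power2_eq_square)
qed

lemma tail_norm:
  assumes "\<phi> \<in> L2 \<rho>" "l2_expansion \<rho> \<psi> \<theta> \<phi>" "n \<le> m"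
  shows "(l2_norm \<rho> (\<lambda>x. \<phi> x - (\<Sum>k=1..n. \<theta> k * \<psi> k x)))\<^sup>2 =
    (\<Sum>k=Suc n..m. (\<theta> k)\<^sup>2) + (l2_norm \<rho> (\<lambda>x. \<phi> x - (\<Sum>k=1..m. \<theta> k * \<psi> k x)))\<^sup>2"
proof -
  \<comment> \<open>The combination of length \<open>n\<close> is read as one of length
    \<open>m\<close> padded with zeros, so that \<open>norm_diff_comb\<close> applies at
    \<open>m\<close>.\<close>
  define c where "c k = (if k \<le> n then \<theta> k else 0)" for k
  have split: "{1..m} = {1..n} \<union> {Suc n..m}" using assms(3) by auto
  have "(\<Sum>k=1..m. c k * \<psi> k x) = (\<Sum>k=1..n. \<theta> k * \<psi> k x)" for x
    unfolding split by (subst sum.union_disjoint) (auto simp: c_def)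
  moreover have "(\<Sum>k=1..m. (c k - \<theta> k)\<^sup>2) = (\<Sum>k=Suc n..m. (\<theta> k)\<^sup>2)"
    unfolding split by (subst sum.union_disjoint) (auto simp: c_def)
  ultimately show ?thesis
    using norm_diff_comb[OF assms(1,2), where n=m and c=c] by simp
qed

end

section \<open>Membership in spectral Sobolev balls and spaces\<close>

lemma sobolev_ballE:
  assumes "\<phi> \<in> sobolev_ball \<rho> lam \<psi> \<beta> L"
  obtains \<theta> where "\<phi> \<in> L2 \<rho>" "l2_expansion \<rho> \<psi> \<theta> \<phi>"
    "\<And>A. finite A \<Longrightarrow> A \<subseteq> {1..} \<Longrightarrow> (\<Sum>k\<in>A. lam k powr (- \<beta>) * (\<theta> k)\<^sup>2) \<le> L\<^sup>2"
proof -
  obtain \<theta> where *: "\<phi> \<in> L2 \<rho>" "l2_expansion \<rho> \<psi> \<theta> \<phi>"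
    "(\<lambda>k. lam k powr (- \<beta>) * (\<theta> k)\<^sup>2) summable_on {1..}"
    "(\<Sum>\<^sub>\<infinity>k\<in>{1..}. lam k powr (- \<beta>) * (\<theta> k)\<^sup>2) \<le> L\<^sup>2"
    using assms by (auto simp: sobolev_ball_def)
  have "(\<Sum>k\<in>A. lam k powr (- \<beta>) * (\<theta> k)\<^sup>2) \<le> L\<^sup>2" if "finite A" "A \<subseteq> {1..}" for A
    by (rule order_trans[OF finite_sum_le_infsum[OF *(3) that] *(4)]) auto
  with * show ?thesis by (intro that)
qed

lemma sobolev_ball_subset_space: "sobolev_ball \<rho> lam \<psi> \<beta> L \<subseteq> sobolev_space \<rho> lam \<psi> \<beta>"
  by (auto simp: sobolev_ball_def sobolev_space_def)

lemma sobolev_spaceI: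
  assumes "\<phi> \<in> L2 \<rho>" "l2_expansion \<rho> \<psi> \<theta> \<phi>"
    "(\<lambda>k. lam k powr (- \<beta>) * (\<theta> k)\<^sup>2) summable_on {1..}"
  shows "\<phi> \<in> sobolev_space \<rho> lam \<psi> \<beta>"
  using assms by (auto simp: sobolev_space_def)

text \<open>The fourth-moment condition is assumed on the Sobolev space only, so the residuals and
  the eigenfunctions to which it will be applied must be shown to lie there.\<close>

lemma sobolev_space_diff_comb:
  assumes "\<And>k. 1 \<le> k \<Longrightarrow> \<psi> k \<in> L2 \<rho>" "\<phi> \<in> sobolev_space \<rho> lam \<psi> \<beta>"
  shows "(\<lambda>x. \<phi> x - (\<Sum>k=1..n. c k * \<psi> k x)) \<in> sobolev_space \<rho> lam \<psi> \<beta>"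
proof -
  obtain \<theta> where *: "\<phi> \<in> L2 \<rho>" "l2_expansion \<rho> \<psi> \<theta> \<phi>"
    "(\<lambda>k. lam k powr (- \<beta>) * (\<theta> k)\<^sup>2) summable_on {1..}"
    using assms(2) by (auto simp: sobolev_space_def)
  define d where "d k = \<theta> k - (if k \<le> n then c k else 0)" for k
  show ?thesis
  proof (rule sobolev_spaceI[of _ _ _ d])
    show "(\<lambda>x. \<phi> x - (\<Sum>k=1..n. c k * \<psi> k x)) \<in> L2 \<rho>"
      using * assms(1) by (intro L2_diff L2_sum) auto
    have "(\<Sum>k=1..m. d k * \<psi> k x) = (\<Sum>k=1..m. \<theta> k * \<psi> k x) - (\<Sum>k=1..n. c k * \<psi> k x)"
      if "n \<le> m" for m x
    proof -
      have "(\<Sum>k=1..m. (if k \<le> n then c k else 0) * \<psi> k x) = (\<Sum>k=1..n. c k * \<psi> k x)"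
        using that by (intro sum.mono_neutral_cong_right) auto
      then show ?thesis by (simp add: d_def left_diff_distrib sum_subtractf)
    qed
    then have "\<forall>\<^sub>F m in sequentially. l2_norm \<rho> (\<lambda>x. \<phi> x - (\<Sum>k=1..m. \<theta> k * \<psi> k x)) =
      l2_norm \<rho> (\<lambda>x. \<phi> x - (\<Sum>k=1..n. c k * \<psi> k x) - (\<Sum>k=1..m. d k * \<psi> k x))"
      by (intro eventually_sequentiallyI[of n]) simp
    with *(2) show "l2_expansion \<rho> \<psi> d (\<lambda>x. \<phi> x - (\<Sum>k=1..n. c k * \<psi> k x))"
      unfolding l2_expansion_def by (rule Lim_transform_eventually)
    \<comment> \<open>Beyond \<open>n\<close> the coefficients \<open>d\<close> and
      \<open>\<theta>\<close> coincide; the finitely many others do not affect summability.\<close>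
    have "(\<lambda>k. lam k powr (- \<beta>) * (\<theta> k)\<^sup>2) summable_on {n<..}"
      using *(3) by (rule summable_on_subset_banach) auto
    then have "(\<lambda>k. lam k powr (- \<beta>) * (d k)\<^sup>2) summable_on {n<..}"
      by (rule summable_on_cong[THEN iffD1, rotated]) (auto simp: d_def)
    then have "(\<lambda>k. lam k powr (- \<beta>) * (d k)\<^sup>2) summable_on ({1..n} \<union> {n<..})"
      by (intro summable_on_Un_disjoint) auto
    then show "(\<lambda>k. lam k powr (- \<beta>) * (d k)\<^sup>2) summable_on {1..}"
      by (rule summable_on_subset_banach) auto
  qed
qed

lemma zero_in_sobolev_space: "(\<lambda>x. 0) \<in> sobolev_space \<rho> lam \<psi> \<beta>"
  by (rule sobolev_spaceI[of _ _ _ "\<lambda>_. 0"])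
    (auto simp: L2_zero l2_expansion_def l2_norm_def l2_inner_def)

lemma psi_in_sobolev_space:
  assumes "\<And>k. 1 \<le> k \<Longrightarrow> \<psi> k \<in> L2 \<rho>" "1 \<le> k"
  shows "\<psi> k \<in> sobolev_space \<rho> lam \<psi> \<beta>"
proof -
  \<comment> \<open>Removing \<open>- \<psi> k\<close> from the zero function leaves
    \<open>\<psi> k\<close>.\<close>
  have "(\<lambda>x. 0 - (\<Sum>j=1..k. (if j = k then - 1 else 0) * \<psi> j x)) \<in> sobolev_space \<rho> lam \<psi> \<beta>"
    by (rule sobolev_space_diff_comb[OF assms(1) zero_in_sobolev_space])
  moreover have "(\<Sum>j=1..k. (if j = k then - 1 else 0) * \<psi> j x) = (\<Sum>j=1..k. if j = k then - \<psi> k x else 0)" for x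
    by (intro sum.cong) auto
  ultimately show ?thesis using assms(2) by simp
qed

section \<open>Tails in the eigenbasis of the normal operator\<close>

locale normal_eigensystem = orthonormal_system \<rho> \<psi>
  for \<rho> :: "'s measure" and \<psi> +
  fixes N :: "('s \<Rightarrow> real) \<Rightarrow> 's \<Rightarrow> real" and lam :: "nat \<Rightarrow> real"
  assumes N_L2: "\<phi> \<in> L2 \<rho> \<Longrightarrow> N \<phi> \<in> L2 \<rho>"
    and N_self_adjoint: "self_adjoint_op \<rho> N"
    and N_psi: "1 \<le> k \<Longrightarrow> AE x in \<rho>. N (\<psi> k) x = lam k * \<psi> k x"
    and lam_pos: "1 \<le> k \<Longrightarrow> 0 < lam k"
    and lam_Suc_le: "1 \<le> k \<Longrightarrow> lam (Suc k) \<le> lam k"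
begin

lemma lam_antimono: "1 \<le> j \<Longrightarrow> j \<le> k \<Longrightarrow> lam k \<le> lam j"
  by (rule nat_induct_at_least[of j k "\<lambda>k. lam k \<le> lam j"])
    (auto intro: order_trans[OF lam_Suc_le])

lemma inner_N_psi:
  assumes "\<phi> \<in> L2 \<rho>" "1 \<le> k"
  shows "l2_inner \<rho> (N \<phi>) (\<psi> k) = lam k * l2_inner \<rho> \<phi> (\<psi> k)"
proof -
  have "l2_inner \<rho> (N \<phi>) (\<psi> k) = l2_inner \<rho> \<phi> (N (\<psi> k))"
    using N_self_adjoint assms psi_L2 by (auto simp: self_adjoint_op_def)
  also have "\<dots> = (LINT x|\<rho>. lam k * (\<phi> x * \<psi> k x))"
    unfolding l2_inner_def
    by (rule integral_cong_AE)
      (use N_psi[OF assms(2)] L2_measurable[OF assms(1)] L2_measurable[OF psi_L2[OF assms(2)]]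
        L2_measurable[OF N_L2[OF psi_L2[OF assms(2)]]] in auto)
  finally show ?thesis by (simp add: l2_inner_def)
qed

text \<open>Beyond \<open>n\<close> the eigenvalues are at most \<open>lam (Suc n)\<close>, so each
  squared coefficient is at most \<open>lam (Suc n) powr \<beta>\<close> times its Sobolev weight.
  The finite block \<open>Suc n..m\<close> is bounded this way, and the remainder past
  \<open>m\<close> vanishes in the limit.\<close>

lemma tail_norm_le:
  assumes "\<phi> \<in> L2 \<rho>" "l2_expansion \<rho> \<psi> \<theta> \<phi>" "0 < \<beta>"
    and "\<And>A. finite A \<Longrightarrow> A \<subseteq> {1..} \<Longrightarrow> (\<Sum>k\<in>A. lam k powr (- \<beta>) * (\<theta> k)\<^sup>2) \<le> L\<^sup>2"
  shows "(l2_norm \<rho> (\<lambda>x. \<phi> x - (\<Sum>k=1..n. \<theta> k * \<psi> k x)))\<^sup>2 \<le> lam (Suc n) powr \<beta> * L\<^sup>2"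
proof (rule LIMSEQ_le_const)
  let ?t = "\<lambda>m x. \<phi> x - (\<Sum>k=1..m. \<theta> k * \<psi> k x)"
  have "(\<lambda>m. lam (Suc n) powr \<beta> * L\<^sup>2 + (l2_norm \<rho> (?t m))\<^sup>2) \<longlonglongrightarrow> lam (Suc n) powr \<beta> * L\<^sup>2 + 0\<^sup>2"
    using assms(2) unfolding l2_expansion_def by (intro tendsto_intros)
  then show "(\<lambda>m. lam (Suc n) powr \<beta> * L\<^sup>2 + (l2_norm \<rho> (?t m))\<^sup>2) \<longlonglongrightarrow> lam (Suc n) powr \<beta> * L\<^sup>2"
    by simp
  have "(l2_norm \<rho> (?t n))\<^sup>2 \<le> lam (Suc n) powr \<beta> * L\<^sup>2 + (l2_norm \<rho> (?t m))\<^sup>2" if "n \<le> m" for m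
  proof -
    have "(\<Sum>k=Suc n..m. (\<theta> k)\<^sup>2) \<le> (\<Sum>k=Suc n..m. lam (Suc n) powr \<beta> * (lam k powr (- \<beta>) * (\<theta> k)\<^sup>2))"
    proof (rule sum_mono)
      fix k assume k: "k \<in> {Suc n..m}"
      have "1 = lam k powr \<beta> * lam k powr (- \<beta>)"
        using lam_pos[of k] k by (simp add: powr_add[symmetric])
      also have "\<dots> \<le> lam (Suc n) powr \<beta> * lam k powr (- \<beta>)"
        using lam_pos[of k] lam_antimono[of "Suc n" k] k assms(3)
        by (intro mult_right_mono powr_mono2) auto
      finally have "1 * (\<theta> k)\<^sup>2 \<le> (lam (Suc n) powr \<beta> * lam k powr (- \<beta>)) * (\<theta> k)\<^sup>2"
        by (rule mult_right_mono) simp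
      then show "(\<theta> k)\<^sup>2 \<le> lam (Suc n) powr \<beta> * (lam k powr (- \<beta>) * (\<theta> k)\<^sup>2)"
        by (simp add: mult.assoc)
    qed
    also have "\<dots> = lam (Suc n) powr \<beta> * (\<Sum>k=Suc n..m. lam k powr (- \<beta>) * (\<theta> k)\<^sup>2)"
      by (simp add: sum_distrib_left)
    also have "\<dots> \<le> lam (Suc n) powr \<beta> * L\<^sup>2"
      by (intro mult_left_mono assms(4)) auto
    finally show ?thesis using tail_norm[OF assms(1,2) that] by simp
  qed
  then show "\<exists>M. \<forall>m\<ge>M. (l2_norm \<rho> (?t n))\<^sup>2 \<le> lam (Suc n) powr \<beta> * L\<^sup>2 + (l2_norm \<rho> (?t m))\<^sup>2"
    by blast
qed

text \<open>On the tail, \<open>N\<close> acts with eigenvalues at most \<open>lam (Suc n)\<close>.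
  The limit is taken in the second argument of the inner product, with \<open>N (t n)\<close> fixed:
  \<open>t n - t m\<close> is a finite combination, for which \<open>inner_N_psi\<close> gives every
  term, and \<open>t m\<close> tends to zero.\<close>

lemma tail_N_le:
  assumes "\<phi> \<in> L2 \<rho>" "l2_expansion \<rho> \<psi> \<theta> \<phi>"
  defines "t \<equiv> \<lambda>n x. \<phi> x - (\<Sum>k=1..n. \<theta> k * \<psi> k x)"
  shows "l2_inner \<rho> (N (t n)) (t n) \<le> lam (Suc n) * (l2_norm \<rho> (t n))\<^sup>2"
proof (rule LIMSEQ_le_const)
  have tL2: "t m \<in> L2 \<rho>" for m
    unfolding t_def using assms(1) comb_L2 by (intro L2_diff)
  have lim: "(\<lambda>m. l2_norm \<rho> (t m)) \<longlonglongrightarrow> 0"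
    using assms(2) by (simp add: l2_expansion_def t_def)
  have "(\<lambda>m. l2_inner \<rho> (N (t n)) (t m)) \<longlonglongrightarrow> 0"
    by (intro l2_inner_tendsto_right N_L2 tL2 lim)
  then have "(\<lambda>m. lam (Suc n) * (l2_norm \<rho> (t n))\<^sup>2 + l2_inner \<rho> (N (t n)) (t m))
      \<longlonglongrightarrow> lam (Suc n) * (l2_norm \<rho> (t n))\<^sup>2 + 0"
    by (intro tendsto_intros)
  then show "(\<lambda>m. lam (Suc n) * (l2_norm \<rho> (t n))\<^sup>2 + l2_inner \<rho> (N (t n)) (t m))
      \<longlonglongrightarrow> lam (Suc n) * (l2_norm \<rho> (t n))\<^sup>2" by simp
  have "l2_inner \<rho> (N (t n)) (t n) \<le> lam (Suc n) * (l2_norm \<rho> (t n))\<^sup>2 + l2_inner \<rho> (N (t n)) (t m)"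
    if "n \<le> m" for m
  proof -
    have split: "{1..m} = {1..n} \<union> {Suc n..m}" using that by auto
    have "(\<Sum>k=1..m. \<theta> k * \<psi> k x) = (\<Sum>k=1..n. \<theta> k * \<psi> k x) + (\<Sum>k=Suc n..m. \<theta> k * \<psi> k x)" for x
      unfolding split by (subst sum.union_disjoint) auto
    then have eq: "t m = (\<lambda>x. t n x - (\<Sum>k=Suc n..m. \<theta> k * \<psi> k x))"
      by (simp add: t_def fun_eq_iff)
    have mid: "(\<lambda>x. \<Sum>k=Suc n..m. \<theta> k * \<psi> k x) \<in> L2 \<rho>"
      by (rule L2_sum) (auto simp: psi_L2)
    have coef: "l2_inner \<rho> (t n) (\<psi> k) = \<theta> k" if "k \<in> {Suc n..m}" for k
      using that unfolding t_def
      by (simp add: l2_inner_diff_left assms(1) comb_L2 psi_L2 inner_comb_psi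
          expansion_coeff[OF assms(1,2)])
    have "l2_inner \<rho> (N (t n)) (t n) - l2_inner \<rho> (N (t n)) (t m)
        = l2_inner \<rho> (\<lambda>x. \<Sum>k=Suc n..m. \<theta> k * \<psi> k x) (N (t n))"
      unfolding eq by (subst l2_inner_diff_right) (auto simp: tL2 mid N_L2 l2_inner_commute)
    also have "\<dots> = (\<Sum>k=Suc n..m. \<theta> k * l2_inner \<rho> (\<psi> k) (N (t n)))"
      by (rule l2_inner_sum_left) (auto simp: psi_L2 tL2 N_L2)
    also have "\<dots> = (\<Sum>k=Suc n..m. lam k * (\<theta> k)\<^sup>2)"
      by (intro sum.cong)
        (auto simp: l2_inner_commute[of _ "\<psi> _"] inner_N_psi tL2 coef power2_eq_square)
    also have "\<dots> \<le> (\<Sum>k=Suc n..m. lam (Suc n) * (\<theta> k)\<^sup>2)"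
      by (intro sum_mono mult_right_mono lam_antimono) auto
    also have "\<dots> = lam (Suc n) * (\<Sum>k=Suc n..m. (\<theta> k)\<^sup>2)"
      by (simp add: sum_distrib_left)
    also have "\<dots> \<le> lam (Suc n) * (l2_norm \<rho> (t n))\<^sup>2"
      using tail_norm[OF assms(1,2) that] lam_pos[of "Suc n"]
      by (intro mult_left_mono) (auto simp: t_def)
    finally show ?thesis by simp
  qed
  then show "\<exists>M. \<forall>m\<ge>M. l2_inner \<rho> (N (t n)) (t n) \<le>
      lam (Suc n) * (l2_norm \<rho> (t n))\<^sup>2 + l2_inner \<rho> (N (t n)) (t m)" by blast
qed

end

section \<open>Projections onto the first basis vectors\<close>

definition coord_proj :: "(nat \<Rightarrow> 'y::real_inner) \<Rightarrow> nat set \<Rightarrow> 'y \<Rightarrow> 'y" where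
  "coord_proj y A v = (\<Sum>i\<in>A. inner v (y i) *\<^sub>R y i)"

definition orthonormal_on :: "(nat \<Rightarrow> 'y::real_inner) \<Rightarrow> nat set \<Rightarrow> bool" where
  "orthonormal_on y A \<longleftrightarrow> (\<forall>i\<in>A. \<forall>j\<in>A. inner (y i) (y j) = (if i = j then 1 else 0))"

lemma orthonormal_on_subset: "orthonormal_on y B \<Longrightarrow> A \<subseteq> B \<Longrightarrow> orthonormal_on y A"
  unfolding orthonormal_on_def by blast

lemma onb_orthonormal_on: "onb I y \<Longrightarrow> orthonormal_on y I"
  by (simp add: onb_def orthonormal_on_def)

lemma orthonormal_norm_sum:
  assumes "finite A" "orthonormal_on y A"
  shows "(norm (\<Sum>i\<in>A. c i *\<^sub>R y i))\<^sup>2 = (\<Sum>i\<in>A. (c i)\<^sup>2)"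
proof -
  have "(norm (\<Sum>i\<in>A. c i *\<^sub>R y i))\<^sup>2 = (\<Sum>i\<in>A. \<Sum>j\<in>A. c i * (c j * inner (y i) (y j)))"
    by (simp add: power2_norm_eq_inner inner_sum_left inner_sum_right sum_distrib_left)
      (simp add: inner_commute mult_ac)
  also have "\<dots> = (\<Sum>i\<in>A. \<Sum>j\<in>A. if i = j then (c i)\<^sup>2 else 0)"
    using assms(2) by (intro sum.cong) (auto simp: orthonormal_on_def power2_eq_square)
  also have "\<dots> = (\<Sum>i\<in>A. (c i)\<^sup>2)" using assms(1) by simp
  finally show ?thesis .
qed

lemma orthonormal_norm_diff:
  assumes "finite A" "orthonormal_on y A"
  shows "(norm (v - (\<Sum>i\<in>A. c i *\<^sub>R y i)))\<^sup>2 =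
    (norm v)\<^sup>2 - 2 * (\<Sum>i\<in>A. c i * inner v (y i)) + (\<Sum>i\<in>A. (c i)\<^sup>2)"
proof -
  let ?s = "\<Sum>i\<in>A. c i *\<^sub>R y i"
  have "(norm (v - ?s))\<^sup>2 = (norm v)\<^sup>2 - 2 * inner v ?s + (norm ?s)\<^sup>2"
    by (simp add: power2_norm_eq_inner inner_diff_left inner_diff_right inner_commute)
  then show ?thesis
    by (simp only: orthonormal_norm_sum[OF assms]) (simp add: inner_sum_right)
qed

lemma norm_diff_coord_proj:
  assumes "finite A" "orthonormal_on y A"
  shows "(norm (v - coord_proj y A v))\<^sup>2 = (norm v)\<^sup>2 - (\<Sum>i\<in>A. (inner v (y i))\<^sup>2)"
  unfolding coord_proj_def orthonormal_norm_diff[OF assms] by (simp add: power2_eq_square)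

lemma Bessel_coord:
  assumes "finite A" "orthonormal_on y A"
  shows "(\<Sum>i\<in>A. (inner v (y i))\<^sup>2) \<le> (norm v)\<^sup>2"
  using norm_diff_coord_proj[OF assms, of v] zero_le_power2[of "norm (v - coord_proj y A v)"] by linarith

lemma norm_coord_proj_le:
  assumes "finite A" "orthonormal_on y A"
  shows "norm (coord_proj y A v) \<le> norm v"
  using Bessel_coord[OF assms, of v] unfolding coord_proj_def orthonormal_norm_sum[OF assms, symmetric]
  by (simp add: power2_le_iff_abs_le)

lemma norm_diff_coord_proj_le_norm:
  assumes "finite A" "orthonormal_on y A"
  shows "(norm (v - coord_proj y A v))\<^sup>2 \<le> (norm v)\<^sup>2"
  unfolding norm_diff_coord_proj[OF assms] by (simp add: sum_nonneg)

lemma inner_coord_proj: "inner v (coord_proj y A w) = (\<Sum>i\<in>A. inner w (y i) * inner v (y i))"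
  by (simp add: coord_proj_def inner_sum_right)

text \<open>The two squared distances differ by the sum of the squares of
  \<open>c (y i) - inner v (y i)\<close>.\<close>

lemma coord_proj_best:
  assumes "finite A" "orthonormal_on y A" "w \<in> span (y ` A)"
  shows "(norm (v - coord_proj y A v))\<^sup>2 \<le> (norm (v - w))\<^sup>2"
proof -
  have inj: "inj_on y A"
  proof (rule inj_onI)
    fix i j assume "i \<in> A" "j \<in> A" "y i = y j"
    then have "inner (y i) (y j) = 1" using assms(2) by (auto simp: orthonormal_on_def)
    then show "i = j" using \<open>i \<in> A\<close> \<open>j \<in> A\<close> assms(2)
      by (metis orthonormal_on_def zero_neq_one)
  qed
  \<comment> \<open>The span is parametrized by vectors; injectivity of \<open>y\<close> turns this
    into coefficients indexed by \<open>A\<close>.\<close>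
  from assms(3) obtain c where "w = (\<Sum>a\<in>y ` A. c a *\<^sub>R a)"
    by (auto simp: span_finite assms(1))
  then have w: "w = (\<Sum>i\<in>A. c (y i) *\<^sub>R y i)" by (simp add: sum.reindex[OF inj])
  have "(norm (v - w))\<^sup>2 - (norm (v - coord_proj y A v))\<^sup>2 =
      (\<Sum>i\<in>A. (c (y i))\<^sup>2 - 2 * (c (y i) * inner v (y i)) + (inner v (y i))\<^sup>2)"
    unfolding norm_diff_coord_proj[OF assms(1,2)] w orthonormal_norm_diff[OF assms(1,2)]
    by (simp add: sum.distrib sum_subtractf sum_distrib_left)
  also have "\<dots> = (\<Sum>i\<in>A. (c (y i) - inner v (y i))\<^sup>2)"
    by (intro sum.cong) (auto simp: power2_diff)
  also have "\<dots> \<ge> 0" by (simp add: sum_nonneg)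
  finally show ?thesis by simp
qed

text \<open>Density of the span yields an approximant using finitely many basis vectors. Once
  \<open>J\<close> covers their indices, the projection is at least as close. Intersecting with
  \<open>I\<close> handles finite and infinite dimension together.\<close>

lemma onb_coord_proj_tendsto:
  assumes "onb I y"
  shows "(\<lambda>J. (norm (v - coord_proj y (I \<inter> {1..J}) v))\<^sup>2) \<longlonglongrightarrow> 0"
proof (rule LIMSEQ_I)
  fix e :: real assume e: "0 < e"
  have ortho: "orthonormal_on y (I \<inter> {1..J})" for J
    using onb_orthonormal_on[OF assms] by (rule orthonormal_on_subset) auto
  have "v \<in> closure (span (y ` I))" using assms by (simp add: onb_def)
  then obtain w where w: "w \<in> span (y ` I)" "dist w v < sqrt e"
    using e unfolding closure_approachable by (meson real_sqrt_gt_zero)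
  from w(1) obtain t r where t: "finite t" "t \<subseteq> y ` I" "w = (\<Sum>a\<in>t. r a *\<^sub>R a)"
    by (auto simp: span_explicit)
  obtain C where C: "C \<subseteq> I" "finite C" "t = y ` C"
    using finite_subset_image[OF t(1,2)] by blast
  have I: "I \<subseteq> {1..}" using assms by (auto simp: onb_def)
  \<comment> \<open>Inserting \<open>0\<close> keeps \<open>Max\<close> meaningful when
    \<open>C\<close> is empty.\<close>
  have "norm ((norm (v - coord_proj y (I \<inter> {1..J}) v))\<^sup>2 - 0) < e" if "Max (insert 0 C) \<le> J" for J
  proof -
    have "C \<subseteq> I \<inter> {1..J}" using C I that by auto
    then have "t \<subseteq> y ` (I \<inter> {1..J})" using C(3) by auto
    then have "w \<in> span (y ` (I \<inter> {1..J}))"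
      unfolding t(3) by (intro span_sum span_scale span_base) auto
    then have "(norm (v - coord_proj y (I \<inter> {1..J}) v))\<^sup>2 \<le> (norm (v - w))\<^sup>2"
      by (intro coord_proj_best ortho) auto
    also have "\<dots> < (sqrt e)\<^sup>2"
      using w(2) by (intro power_strict_mono) (auto simp: dist_norm norm_minus_commute)
    finally show ?thesis using e by simp
  qed
  then show "\<exists>no. \<forall>J\<ge>no. norm ((norm (v - coord_proj y (I \<inter> {1..J}) v))\<^sup>2 - 0) < e" by blast
qed

section \<open>Pairings of the noise with functions of the input\<close>

text \<open>Second countability of the output space is what makes differences and inner products of
  measurable maps measurable.\<close>

locale regression_noise = prob_space P
  for P :: "'w measure" +
  fixes u :: "'w \<Rightarrow> 'x::topological_space"
    and \<epsilon> :: "'y::{real_inner, second_countable_topology} \<Rightarrow> 'w \<Rightarrow> real"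
    and \<sigma> :: real
  assumes u_measurable: "u \<in> borel_measurable P"
    and noise_linear: "linear_noise P \<epsilon>"
    and noise_indep: "noise_independent P u \<epsilon>"
    and noise_moments: "noise_B1 P \<epsilon> \<sigma>"
begin

lemma eps_L2: "\<epsilon> z \<in> L2 P"
  using noise_linear by (simp add: linear_noise_def)

lemma eps_measurable: "(\<lambda>\<omega> z. \<epsilon> z \<omega>) \<in> measurable P (\<Pi>\<^sub>M z\<in>UNIV. borel)"
  by (rule measurable_PiM_single') (auto simp: L2_measurable eps_L2)

lemma eps_integrable: "integrable P (\<epsilon> z)"
  using eps_L2[of z] by (auto simp: L2_def intro: square_integrable_imp_integrable)

lemma eps_mean: "expectation (\<epsilon> z) = 0"
  using noise_moments by (simp add: noise_B1_def)

lemma eps_sum: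
  assumes "finite A"
  shows "AE \<omega> in P. \<epsilon> (\<Sum>i\<in>A. c i *\<^sub>R z i) \<omega> = (\<Sum>i\<in>A. c i * \<epsilon> (z i) \<omega>)"
  using assms
proof (induction A rule: finite_induct)
  case empty
  \<comment> \<open>Almost sure linearity with both scalars zero shows that the pairing with the
    zero vector vanishes almost surely.\<close>
  have "AE \<omega> in P. \<epsilon> (0 *\<^sub>R 0 + 0 *\<^sub>R 0) \<omega> = 0 * \<epsilon> 0 \<omega> + 0 * \<epsilon> 0 \<omega>"
    using noise_linear unfolding linear_noise_def by blast
  then show ?case by simp
next
  case (insert a A)
  have "AE \<omega> in P. \<epsilon> (c a *\<^sub>R z a + 1 *\<^sub>R (\<Sum>i\<in>A. c i *\<^sub>R z i)) \<omega>
      = c a * \<epsilon> (z a) \<omega> + 1 * \<epsilon> (\<Sum>i\<in>A. c i *\<^sub>R z i) \<omega>"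
    using noise_linear unfolding linear_noise_def by blast
  with insert.IH show ?case
    by eventually_elim (use insert.hyps in simp)
qed

text \<open>(B1) for the vector with coordinates \<open>c\<close>, read as a bound on the noise
  covariance as a quadratic form. The deterministic \<open>c\<close> will later be replaced
  pointwise by functions of \<open>u\<close>.\<close>

lemma eps_comb_moment:
  assumes "finite A" "orthonormal_on y A"
  shows "(\<Sum>i\<in>A. \<Sum>j\<in>A. c i * c j * expectation (\<lambda>\<omega>. \<epsilon> (y i) \<omega> * \<epsilon> (y j) \<omega>)) \<le> \<sigma>\<^sup>2 * (\<Sum>i\<in>A. (c i)\<^sup>2)"
proof -
  have "(\<Sum>i\<in>A. \<Sum>j\<in>A. c i * c j * expectation (\<lambda>\<omega>. \<epsilon> (y i) \<omega> * \<epsilon> (y j) \<omega>))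
      = expectation (\<lambda>\<omega>. \<Sum>i\<in>A. \<Sum>j\<in>A. c i * c j * (\<epsilon> (y i) \<omega> * \<epsilon> (y j) \<omega>))"
    by (simp add: Bochner_Integration.integral_sum L2_mult_integrable eps_L2)
  also have "\<dots> = expectation (\<lambda>\<omega>. (\<Sum>i\<in>A. c i * \<epsilon> (y i) \<omega>)\<^sup>2)"
    by (simp add: power2_eq_square sum_product mult_ac)
  also have "\<dots> = expectation (\<lambda>\<omega>. (\<epsilon> (\<Sum>i\<in>A. c i *\<^sub>R y i) \<omega>)\<^sup>2)"
    using eps_sum[OF assms(1), of c y] L2_measurable[OF eps_L2]
    by (intro integral_cong_AE borel_measurable_power borel_measurable_sum borel_measurable_times) auto
  also have "\<dots> \<le> \<sigma>\<^sup>2 * (norm (\<Sum>i\<in>A. c i *\<^sub>R y i))\<^sup>2"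
    using noise_moments by (simp add: noise_B1_def)
  finally show ?thesis by (simp only: orthonormal_norm_sum[OF assms])
qed

text \<open>Real-valued functions of \<open>u\<close> and of the noise family have a common range
  type, so the product rules for \<open>indep_var\<close> become available.\<close>

lemma indep_u_eps:
  fixes f :: "'x \<Rightarrow> real" and g :: "('y \<Rightarrow> real) \<Rightarrow> real"
  assumes f: "f \<in> borel_measurable borel" and g: "g \<in> borel_measurable (\<Pi>\<^sub>M z\<in>UNIV. borel)"
  shows "indep_var borel (\<lambda>\<omega>. f (u \<omega>)) borel (\<lambda>\<omega>. g (\<lambda>z. \<epsilon> z \<omega>))"
  unfolding indep_var_eq
proof (intro conjI)
  show "random_variable borel (\<lambda>\<omega>. f (u \<omega>))"
    using measurable_compose[OF u_measurable f] .
  show "random_variable borel (\<lambda>\<omega>. g (\<lambda>z. \<epsilon> z \<omega>))"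
    using measurable_compose[OF eps_measurable g] .
  have sub: "indep_set {(\<lambda>\<omega>. f (u \<omega>)) -` A \<inter> space P |A. A \<in> sets borel}
      {(\<lambda>\<omega>. g (\<lambda>z. \<epsilon> z \<omega>)) -` B \<inter> space P |B. B \<in> sets borel}"
    unfolding indep_set_def
  proof (rule indep_sets_mono_sets[OF noise_indep[unfolded noise_independent_def indep_set_def]])
    fix b :: bool
    have "\<exists>C. (\<lambda>\<omega>. f (u \<omega>)) -` A \<inter> space P = u -` C \<inter> space P \<and> C \<in> sets borel" if "A \<in> sets borel" for A
      using measurable_sets[OF f that] by (intro exI[of _ "f -` A"]) auto
    moreover have "\<exists>C. (\<lambda>\<omega>. g (\<lambda>z. \<epsilon> z \<omega>)) -` A \<inter> space P = (\<lambda>\<omega> z. \<epsilon> z \<omega>) -` C \<inter> space P \<and>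
        C \<in> sets (\<Pi>\<^sub>M z\<in>UNIV. borel)" if "A \<in> sets borel" for A
      using measurable_sets[OF g that] by (intro exI[of _ "g -` A"]) (auto simp: space_PiM)
    ultimately show "case_bool {(\<lambda>\<omega>. f (u \<omega>)) -` A \<inter> space P |A. A \<in> sets borel}
        {(\<lambda>\<omega>. g (\<lambda>z. \<epsilon> z \<omega>)) -` B \<inter> space P |B. B \<in> sets borel} b
      \<subseteq> case_bool {u -` A \<inter> space P |A. A \<in> sets borel}
        {(\<lambda>\<omega> z. \<epsilon> z \<omega>) -` B \<inter> space P |B. B \<in> sets (\<Pi>\<^sub>M z\<in>UNIV. borel)} b"
      by (cases b) auto
  qed
  \<comment> \<open>\<open>indep_var_eq\<close> asks for independence of the generated
    sigma-algebras; stability under intersection carries it over from the preimages.\<close>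
  have stable: "Int_stable {h -` A \<inter> space P |A. A \<in> sets borel}" for h :: "'w \<Rightarrow> real"
  proof (rule Int_stableI)
    fix a b assume "a \<in> {h -` A \<inter> space P |A. A \<in> sets borel}" "b \<in> {h -` A \<inter> space P |A. A \<in> sets borel}"
    then obtain A B where "a = h -` A \<inter> space P" "b = h -` B \<inter> space P" "A \<in> sets borel" "B \<in> sets borel"
      by blast
    then show "a \<inter> b \<in> {h -` A \<inter> space P |A. A \<in> sets borel}"
      by (intro CollectI exI[of _ "A \<inter> B"]) auto
  qed
  show "indep_set
      (sigma_sets (space P) {(\<lambda>\<omega>. f (u \<omega>)) -` A \<inter> space P |A. A \<in> sets borel})
      (sigma_sets (space P) {(\<lambda>\<omega>. g (\<lambda>z. \<epsilon> z \<omega>)) -` B \<inter> space P |B. B \<in> sets borel})"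
    by (rule indep_set_sigma_sets[OF sub stable stable])
qed

text \<open>After expanding the square, independence factors each expectation. The noise covariances
  become constants that are moved back under the expectation over \<open>u\<close>, where
  \<open>eps_comb_moment\<close> applies pointwise. The factor \<open>\<sigma>\<^sup>2\<close> does
  not grow with \<open>A\<close>, so the truncation level may grow freely.\<close>

lemma noise_pairing:
  assumes A: "finite A" "orthonormal_on y A"
    and w: "\<And>i. i \<in> A \<Longrightarrow> w i \<in> borel_measurable borel" "\<And>i. i \<in> A \<Longrightarrow> (\<lambda>\<omega>. w i (u \<omega>)) \<in> L2 P"
  defines "Z \<equiv> \<lambda>\<omega>. \<Sum>i\<in>A. w i (u \<omega>) * \<epsilon> (y i) \<omega>"
  shows noise_pairing_L2: "Z \<in> L2 P"
    and noise_pairing_mean: "expectation Z = 0"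
    and noise_pairing_second_moment:
      "l2_inner P Z Z \<le> \<sigma>\<^sup>2 * expectation (\<lambda>\<omega>. \<Sum>i\<in>A. (w i (u \<omega>))\<^sup>2)"
proof -
  have coord: "(\<lambda>e. e z) \<in> borel_measurable (Pi\<^sub>M UNIV (\<lambda>_::'y. borel :: real measure))" for z
    by (rule measurable_component_singleton) auto
  have prod1: "integrable P (\<lambda>\<omega>. w i (u \<omega>) * \<epsilon> (y i) \<omega>)"
      "expectation (\<lambda>\<omega>. w i (u \<omega>) * \<epsilon> (y i) \<omega>) = 0" if "i \<in> A" for i
  proof -
    have ind: "indep_var borel (\<lambda>\<omega>. w i (u \<omega>)) borel (\<lambda>\<omega>. \<epsilon> (y i) \<omega>)"
      using indep_u_eps[OF w(1)[OF that] coord[of "y i"]] .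
    have int: "integrable P (\<lambda>\<omega>. w i (u \<omega>))"
      using w(2)[OF that] by (auto simp: L2_def intro: square_integrable_imp_integrable)
    show "integrable P (\<lambda>\<omega>. w i (u \<omega>) * \<epsilon> (y i) \<omega>)"
      by (rule indep_var_integrable[OF ind int eps_integrable])
    show "expectation (\<lambda>\<omega>. w i (u \<omega>) * \<epsilon> (y i) \<omega>) = 0"
      using indep_var_lebesgue_integral[OF ind int eps_integrable] by (simp add: eps_mean)
  qed
  have prod2: "integrable P (\<lambda>\<omega>. (w i (u \<omega>) * w j (u \<omega>)) * (\<epsilon> (y i) \<omega> * \<epsilon> (y j) \<omega>))"
      "expectation (\<lambda>\<omega>. (w i (u \<omega>) * w j (u \<omega>)) * (\<epsilon> (y i) \<omega> * \<epsilon> (y j) \<omega>)) =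
        expectation (\<lambda>\<omega>. w i (u \<omega>) * w j (u \<omega>)) * expectation (\<lambda>\<omega>. \<epsilon> (y i) \<omega> * \<epsilon> (y j) \<omega>)"
      if "i \<in> A" "j \<in> A" for i j
  proof -
    have ind: "indep_var borel (\<lambda>\<omega>. w i (u \<omega>) * w j (u \<omega>)) borel (\<lambda>\<omega>. \<epsilon> (y i) \<omega> * \<epsilon> (y j) \<omega>)"
      using indep_u_eps[OF borel_measurable_times[OF w(1)[OF that(1)] w(1)[OF that(2)]]
        borel_measurable_times[OF coord[of "y i"] coord[of "y j"]]] .
    note int = L2_mult_integrable[OF w(2)[OF that(1)] w(2)[OF that(2)]]
      L2_mult_integrable[OF eps_L2[of "y i"] eps_L2[of "y j"]]
    show "integrable P (\<lambda>\<omega>. (w i (u \<omega>) * w j (u \<omega>)) * (\<epsilon> (y i) \<omega> * \<epsilon> (y j) \<omega>))"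
      by (rule indep_var_integrable[OF ind int])
    show "expectation (\<lambda>\<omega>. (w i (u \<omega>) * w j (u \<omega>)) * (\<epsilon> (y i) \<omega> * \<epsilon> (y j) \<omega>)) =
        expectation (\<lambda>\<omega>. w i (u \<omega>) * w j (u \<omega>)) * expectation (\<lambda>\<omega>. \<epsilon> (y i) \<omega> * \<epsilon> (y j) \<omega>)"
      by (rule indep_var_lebesgue_integral[OF ind int])
  qed
  have sq: "(Z \<omega>)\<^sup>2 = (\<Sum>i\<in>A. \<Sum>j\<in>A. (w i (u \<omega>) * w j (u \<omega>)) * (\<epsilon> (y i) \<omega> * \<epsilon> (y j) \<omega>))" for \<omega>
    by (simp add: Z_def power2_eq_square sum_product mult_ac)
  have "integrable P (\<lambda>\<omega>. (Z \<omega>)\<^sup>2)"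
    unfolding sq using prod2(1) by (intro Bochner_Integration.integrable_sum)
  moreover have "Z \<in> borel_measurable P"
    unfolding Z_def using prod1(1) by (intro borel_measurable_sum) auto
  ultimately show "Z \<in> L2 P" by (simp add: L2_def)
  show "expectation Z = 0"
    unfolding Z_def using prod1 by (subst Bochner_Integration.integral_sum) auto
  have "l2_inner P Z Z = (\<Sum>i\<in>A. \<Sum>j\<in>A.
      expectation (\<lambda>\<omega>. (w i (u \<omega>) * w j (u \<omega>)) * (\<epsilon> (y i) \<omega> * \<epsilon> (y j) \<omega>)))"
    unfolding l2_inner_self sq using prod2(1)
    by (simp add: Bochner_Integration.integral_sum)
  also have "\<dots> = (\<Sum>i\<in>A. \<Sum>j\<in>A. expectation (\<lambda>\<omega>. w i (u \<omega>) * w j (u \<omega>) *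
      expectation (\<lambda>\<omega>. \<epsilon> (y i) \<omega> * \<epsilon> (y j) \<omega>)))"
    by (intro sum.cong refl) (simp add: prod2(2))
  also have "\<dots> = expectation (\<lambda>\<omega>. \<Sum>i\<in>A. \<Sum>j\<in>A. w i (u \<omega>) * w j (u \<omega>) *
      expectation (\<lambda>\<omega>. \<epsilon> (y i) \<omega> * \<epsilon> (y j) \<omega>))"
    using L2_mult_integrable[OF w(2) w(2)] by (simp add: Bochner_Integration.integral_sum)
  also have "\<dots> \<le> expectation (\<lambda>\<omega>. \<sigma>\<^sup>2 * (\<Sum>i\<in>A. (w i (u \<omega>))\<^sup>2))"
    using L2_mult_integrable[OF w(2) w(2)] w(2)
    by (intro integral_mono eps_comb_moment[OF A]) (auto simp: L2_def)
  finally show "l2_inner P Z Z \<le> \<sigma>\<^sup>2 * expectation (\<lambda>\<omega>. \<Sum>i\<in>A. (w i (u \<omega>))\<^sup>2)" by simp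
qed

text \<open>With \<open>c = 1\<close> this is the truncated pairing of an observation \<open>g(u) + \<epsilon>\<close> with \<open>h(u)\<close>, with \<open>c = 0\<close> its
  noiseless version.\<close>

definition pairing :: "(nat \<Rightarrow> 'y) \<Rightarrow> nat set \<Rightarrow> real \<Rightarrow> ('x \<Rightarrow> 'y) \<Rightarrow> ('x \<Rightarrow> 'y) \<Rightarrow> 'x \<times> ('y \<Rightarrow> real) \<Rightarrow> real"
  where "pairing y A c g h p =
    (\<Sum>i\<in>A. inner (h (fst p)) (y i) * (c * snd p (y i) + inner (g (fst p)) (y i)))"

definition kurtosis_le :: "real \<Rightarrow> ('x \<Rightarrow> 'y) \<Rightarrow> bool" where
  "kurtosis_le \<kappa> g \<longleftrightarrow> g \<in> borel_measurable borel \<and> integrable P (\<lambda>\<omega>. norm (g (u \<omega>)) ^ 4) \<and>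
     expectation (\<lambda>\<omega>. norm (g (u \<omega>)) ^ 4) \<le> \<kappa> * (expectation (\<lambda>\<omega>. (norm (g (u \<omega>)))\<^sup>2))\<^sup>2"

text \<open>For \<open>g = R \<phi>\<close> this is the quadratic form of the normal operator, by
  \<open>energy_R\<close>.\<close>

definition energy :: "('x \<Rightarrow> 'y) \<Rightarrow> real" where
  "energy g = expectation (\<lambda>\<omega>. (norm (g (u \<omega>)))\<^sup>2)"

lemma energy_nonneg: "0 \<le> energy g"
  by (simp add: energy_def)

lemma kurtosis_le_L2:
  assumes "kurtosis_le \<kappa> g"
  shows "(\<lambda>\<omega>. (norm (g (u \<omega>)))\<^sup>2) \<in> L2 P" "(\<lambda>\<omega>. norm (g (u \<omega>))) \<in> L2 P"
proof -
  have meas: "(\<lambda>\<omega>. g (u \<omega>)) \<in> borel_measurable P"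
    using assms measurable_compose[OF u_measurable] by (auto simp: kurtosis_le_def)
  show *: "(\<lambda>\<omega>. (norm (g (u \<omega>)))\<^sup>2) \<in> L2 P"
    using assms meas by (simp add: L2_def kurtosis_le_def power_mult[symmetric])
  show "(\<lambda>\<omega>. norm (g (u \<omega>))) \<in> L2 P"
    using * meas by (auto simp: L2_def intro: square_integrable_imp_integrable)
qed

text \<open>Cauchy-Schwarz reduces the mixed fourth moment to two pure ones, each at most
  \<open>\<kappa>\<close> times a squared energy; the two factors \<open>\<kappa>\<close> merge on
  taking the root.\<close>

lemma energy_product:
  assumes "kurtosis_le \<kappa> g" "kurtosis_le \<kappa> h" "0 \<le> \<kappa>"
  shows "l2_inner P (\<lambda>\<omega>. (norm (g (u \<omega>)))\<^sup>2) (\<lambda>\<omega>. (norm (h (u \<omega>)))\<^sup>2) \<le> \<kappa> * energy g * energy h"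
proof (rule power2_le_imp_le)
  have "l2_inner P (\<lambda>\<omega>. (norm (k (u \<omega>)))\<^sup>2) (\<lambda>\<omega>. (norm (k (u \<omega>)))\<^sup>2) \<le> \<kappa> * (energy k)\<^sup>2"
    if "kurtosis_le \<kappa> k" for k
    using that by (simp add: kurtosis_le_def energy_def l2_inner_self power_mult[symmetric])
  then have "l2_inner P (\<lambda>\<omega>. (norm (g (u \<omega>)))\<^sup>2) (\<lambda>\<omega>. (norm (g (u \<omega>)))\<^sup>2) *
      l2_inner P (\<lambda>\<omega>. (norm (h (u \<omega>)))\<^sup>2) (\<lambda>\<omega>. (norm (h (u \<omega>)))\<^sup>2)
     \<le> (\<kappa> * (energy g)\<^sup>2) * (\<kappa> * (energy h)\<^sup>2)"
    using assms by (intro mult_mono) (auto simp: l2_inner_self_nonneg)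
  then show "(l2_inner P (\<lambda>\<omega>. (norm (g (u \<omega>)))\<^sup>2) (\<lambda>\<omega>. (norm (h (u \<omega>)))\<^sup>2))\<^sup>2
      \<le> (\<kappa> * energy g * energy h)\<^sup>2"
    using l2_Cauchy_Schwarz[OF kurtosis_le_L2(1)[OF assms(1)] kurtosis_le_L2(1)[OF assms(2)]]
    by (simp add: power_mult_distrib power2_eq_square mult_ac)
  show "0 \<le> \<kappa> * energy g * energy h" using assms(3) by (simp add: energy_nonneg)
qed

text \<open>The pairing splits as \<open>c * Z + V\<close>, where \<open>Z\<close> is the centred
  noise part and \<open>V\<close> pairs \<open>g\<close> with the projection of \<open>h\<close>.
  \<open>Z\<close> is controlled by \<open>noise_pairing\<close> and Bessel, \<open>V\<close> by
  \<open>energy_product\<close>. The bias stems from projecting \<open>h\<close> alone and is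
  bounded by Cauchy-Schwarz.\<close>

lemma one_sample:
  fixes c :: real
  assumes A: "finite A" "orthonormal_on y A"
    and g: "kurtosis_le \<kappa> g" and h: "kurtosis_le \<kappa> h" and "0 \<le> \<kappa>"
  defines "Y \<equiv> \<lambda>\<omega>. pairing y A c g h (u \<omega>, \<lambda>z. \<epsilon> z \<omega>)"
  shows one_sample_L2: "Y \<in> L2 P"
    and one_sample_second_moment:
      "l2_inner P Y Y \<le> 6/5 * (c\<^sup>2 * \<sigma>\<^sup>2 * energy h) + 6 * (\<kappa> * energy g * energy h)"
    and one_sample_bias:
      "(expectation Y - expectation (\<lambda>\<omega>. inner (g (u \<omega>)) (h (u \<omega>))))\<^sup>2
        \<le> energy g * energy (\<lambda>x. h x - coord_proj y A (h x))"
proof -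
  note [measurable] = u_measurable
  have [measurable]: "g \<in> borel_measurable borel" "h \<in> borel_measurable borel"
    using g h by (auto simp: kurtosis_le_def)
  define Z where "Z = (\<lambda>\<omega>. \<Sum>i\<in>A. inner (h (u \<omega>)) (y i) * \<epsilon> (y i) \<omega>)"
  define V where "V = (\<lambda>\<omega>. inner (g (u \<omega>)) (coord_proj y A (h (u \<omega>))))"
  have Y: "Y = (\<lambda>\<omega>. c * Z \<omega> + V \<omega>)"
    by (simp add: Y_def Z_def V_def pairing_def inner_coord_proj sum_distrib_left
        distrib_left sum.distrib mult_ac fun_eq_iff)
  have "\<bar>inner v (y i)\<bar> \<le> \<bar>norm v\<bar>" if "i \<in> A" for v i
  proof -
    have "inner (y i) (y i) = 1" using A(2) that by (auto simp: orthonormal_on_def)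
    then have "norm (y i) = 1" by (simp add: norm_eq_sqrt_inner)
    then show ?thesis using Cauchy_Schwarz_ineq2[of v "y i"] by simp
  qed
  then have "(\<lambda>\<omega>. inner (h (u \<omega>)) (y i)) \<in> L2 P" if "i \<in> A" for i
    using that by (intro L2_bound[OF kurtosis_le_L2(2)[OF h]]) measurable
  moreover have "(\<lambda>x. inner (h x) (y i)) \<in> borel_measurable borel" for i
    by measurable
  ultimately have w: "\<And>i. i \<in> A \<Longrightarrow> (\<lambda>x. inner (h x) (y i)) \<in> borel_measurable borel"
      "\<And>i. i \<in> A \<Longrightarrow> (\<lambda>\<omega>. inner (h (u \<omega>)) (y i)) \<in> L2 P"
    by blast+
  note Z = noise_pairing[where w="\<lambda>i x. inner (h x) (y i)", OF A w, folded Z_def]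
  have Z2: "l2_inner P Z Z \<le> \<sigma>\<^sup>2 * energy h"
  proof -
    have "expectation (\<lambda>\<omega>. \<Sum>i\<in>A. (inner (h (u \<omega>)) (y i))\<^sup>2) \<le> energy h"
      unfolding energy_def using w kurtosis_le_L2(2)[OF h]
      by (intro integral_mono Bessel_coord[OF A]) (auto simp: L2_def)
    then show ?thesis using Z(3) by (meson mult_left_mono order_trans zero_le_power2)
  qed
  have Vmeas[measurable]: "V \<in> borel_measurable P"
    unfolding V_def coord_proj_def by measurable
  have Vle: "\<bar>V \<omega>\<bar> \<le> norm (g (u \<omega>)) * norm (h (u \<omega>))" for \<omega>
    unfolding V_def using Cauchy_Schwarz_ineq2[of "g (u \<omega>)" "coord_proj y A (h (u \<omega>))"]
      norm_coord_proj_le[OF A, of "h (u \<omega>)"]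
    by (meson mult_left_mono norm_ge_zero order_trans)
  have Vsq: "(V \<omega>)\<^sup>2 \<le> (norm (g (u \<omega>)))\<^sup>2 * (norm (h (u \<omega>)))\<^sup>2" for \<omega>
    using power_mono[OF Vle[of \<omega>], of 2] by (simp add: power_mult_distrib)
  note prodint = L2_mult_integrable[OF kurtosis_le_L2(1)[OF g] kurtosis_le_L2(1)[OF h]]
  have V_L2: "V \<in> L2 P"
    unfolding L2_def using prodint
    by (auto intro!: Bochner_Integration.integrable_bound[OF prodint] simp: Vsq)
  have V2: "l2_inner P V V \<le> \<kappa> * energy g * energy h"
  proof -
    have "l2_inner P V V \<le> l2_inner P (\<lambda>\<omega>. (norm (g (u \<omega>)))\<^sup>2) (\<lambda>\<omega>. (norm (h (u \<omega>)))\<^sup>2)"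
      unfolding l2_inner_self unfolding l2_inner_def using V_L2 prodint
      by (intro integral_mono Vsq) (auto simp: L2_def)
    also note energy_product[OF g h \<open>0 \<le> \<kappa>\<close>]
    finally show ?thesis .
  qed
  show YL2: "Y \<in> L2 P" unfolding Y by (intro L2_add L2_scale Z V_L2)
  \<comment> \<open>The weights are \<open>1 + d\<close> and \<open>1 + 1/d\<close> with
    \<open>d = 1/5\<close>. The noise term decides the final constant and so gets the weight near
    one; the design term, with the large weight, is later made small.\<close>
  have young: "(s + t)\<^sup>2 \<le> 6/5 * s\<^sup>2 + 6 * t\<^sup>2" for s t :: real
  proof -
    have "0 \<le> (s - 5 * t)\<^sup>2 / 5" by simp
    then show ?thesis by (simp add: power2_eq_square algebra_simps)
  qed
  have "l2_inner P Y Y \<le> expectation (\<lambda>\<omega>. 6/5 * (c * Z \<omega>)\<^sup>2 + 6 * (V \<omega>)\<^sup>2)"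
    unfolding l2_inner_self Y using V_L2 L2_scale[OF Z(1), of c] YL2
    by (intro integral_mono young) (auto simp: L2_def Y)
  also have "\<dots> = 6/5 * (c\<^sup>2 * l2_inner P Z Z) + 6 * l2_inner P V V"
    using V_L2 Z(1) by (simp add: l2_inner_self L2_def power_mult_distrib)
  also have "\<dots> \<le> 6/5 * (c\<^sup>2 * (\<sigma>\<^sup>2 * energy h)) + 6 * (\<kappa> * energy g * energy h)"
    by (intro add_mono mult_left_mono Z2 V2) auto
  finally show "l2_inner P Y Y \<le> 6/5 * (c\<^sup>2 * \<sigma>\<^sup>2 * energy h) + 6 * (\<kappa> * energy g * energy h)"
    by (simp add: mult.assoc)
  define D where "D = (\<lambda>\<omega>. h (u \<omega>) - coord_proj y A (h (u \<omega>)))"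
  have Dmeas[measurable]: "D \<in> borel_measurable P"
    unfolding D_def coord_proj_def by measurable
  have "norm (D \<omega>) \<le> norm (h (u \<omega>))" for \<omega>
    using norm_diff_coord_proj_le_norm[OF A, of "h (u \<omega>)"] by (simp add: D_def power2_le_iff_abs_le)
  then have D_L2: "(\<lambda>\<omega>. norm (D \<omega>)) \<in> L2 P"
    by (intro L2_bound[OF kurtosis_le_L2(2)[OF h]]) auto
  have inner_int: "integrable P (\<lambda>\<omega>. inner (g (u \<omega>)) (h (u \<omega>)))"
  proof (rule Bochner_Integration.integrable_bound)
    show "integrable P (\<lambda>\<omega>. norm (g (u \<omega>)) * norm (h (u \<omega>)))"
      by (rule L2_mult_integrable[OF kurtosis_le_L2(2)[OF g] kurtosis_le_L2(2)[OF h]])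
    show "(\<lambda>\<omega>. inner (g (u \<omega>)) (h (u \<omega>))) \<in> borel_measurable P" by measurable
    show "AE \<omega> in P. norm (inner (g (u \<omega>)) (h (u \<omega>))) \<le> norm (norm (g (u \<omega>)) * norm (h (u \<omega>)))"
      using Cauchy_Schwarz_ineq2 by (intro AE_I2) (simp add: abs_mult)
  qed
  have V_int: "integrable P V" and Z_int: "integrable P Z"
    using V_L2 Z(1) by (auto simp: L2_def intro: square_integrable_imp_integrable)
  have "expectation Y = c * expectation Z + expectation V"
    unfolding Y using V_int Z_int by simp
  then have "expectation Y = expectation V" using Z(2) by simp
  then have "\<bar>expectation Y - expectation (\<lambda>\<omega>. inner (g (u \<omega>)) (h (u \<omega>)))\<bar>
      = \<bar>expectation (\<lambda>\<omega>. inner (g (u \<omega>)) (h (u \<omega>)) - V \<omega>)\<bar>"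
    using inner_int V_int by simp
  also have "\<dots> \<le> expectation (\<lambda>\<omega>. \<bar>inner (g (u \<omega>)) (h (u \<omega>)) - V \<omega>\<bar>)"
    by (rule integral_abs_bound)
  also have "\<dots> \<le> l2_inner P (\<lambda>\<omega>. norm (g (u \<omega>))) (\<lambda>\<omega>. norm (D \<omega>))"
    unfolding l2_inner_def
  proof (rule integral_mono)
    show "integrable P (\<lambda>\<omega>. \<bar>inner (g (u \<omega>)) (h (u \<omega>)) - V \<omega>\<bar>)"
      using inner_int V_int by simp
    show "integrable P (\<lambda>\<omega>. norm (g (u \<omega>)) * norm (D \<omega>))"
      by (rule L2_mult_integrable[OF kurtosis_le_L2(2)[OF g] D_L2])
    show "\<bar>inner (g (u \<omega>)) (h (u \<omega>)) - V \<omega>\<bar> \<le> norm (g (u \<omega>)) * norm (D \<omega>)" for \<omega>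
      unfolding V_def D_def inner_diff_right[symmetric] by (rule Cauchy_Schwarz_ineq2)
  qed
  finally have "(expectation Y - expectation (\<lambda>\<omega>. inner (g (u \<omega>)) (h (u \<omega>))))\<^sup>2
      \<le> (l2_inner P (\<lambda>\<omega>. norm (g (u \<omega>))) (\<lambda>\<omega>. norm (D \<omega>)))\<^sup>2"
    by (metis abs_ge_zero power2_abs power_mono)
  also have "\<dots> \<le> energy g * energy (\<lambda>x. h x - coord_proj y A (h x))"
    using l2_Cauchy_Schwarz[OF kurtosis_le_L2(2)[OF g] D_L2]
    by (simp add: l2_inner_self energy_def D_def)
  finally show "(expectation Y - expectation (\<lambda>\<omega>. inner (g (u \<omega>)) (h (u \<omega>))))\<^sup>2
        \<le> energy g * energy (\<lambda>x. h x - coord_proj y A (h x))" .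
qed

lemma pairing_measurable:
  assumes "finite A" "g \<in> borel_measurable borel" "h \<in> borel_measurable borel"
  shows "pairing y A c g h \<in> borel_measurable sample_space"
proof -
  note [measurable] = assms(2,3)
  have [measurable]: "(\<lambda>e. e z) \<in> borel_measurable (Pi\<^sub>M UNIV (\<lambda>_::'y. borel :: real measure))" for z
    by (rule measurable_component_singleton) auto
  show ?thesis unfolding pairing_def by measurable
qed

text \<open>Dominated convergence with the squared norm of \<open>h\<close> as majorant. The limit
  is taken for one \<open>h\<close> at a time, so a common \<open>J\<close> will be chosen for
  finitely many eigenfunctions only.\<close>

lemma energy_residual_tendsto:
  assumes "onb I y" "kurtosis_le \<kappa> h"
  shows "(\<lambda>J. energy (\<lambda>x. h x - coord_proj y (I \<inter> {1..J}) (h x))) \<longlonglongrightarrow> 0"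
proof -
  note [measurable] = u_measurable
  have [measurable]: "h \<in> borel_measurable borel"
    using assms by (auto simp: kurtosis_le_def)
  have ortho: "orthonormal_on y (I \<inter> {1..J})" for J
    using onb_orthonormal_on[OF assms(1)] by (rule orthonormal_on_subset) auto
  have "(\<lambda>J. energy (\<lambda>x. h x - coord_proj y (I \<inter> {1..J}) (h x))) \<longlonglongrightarrow> expectation (\<lambda>\<omega>. 0)"
    unfolding energy_def
  proof (rule integral_dominated_convergence[where w="\<lambda>\<omega>. (norm (h (u \<omega>)))\<^sup>2"])
    show "integrable P (\<lambda>\<omega>. (norm (h (u \<omega>)))\<^sup>2)"
      using kurtosis_le_L2(2)[OF assms(2)] by (simp add: L2_def)
    show "AE \<omega> in P. (\<lambda>J. (norm (h (u \<omega>) - coord_proj y (I \<inter> {1..J}) (h (u \<omega>))))\<^sup>2) \<longlonglongrightarrow> 0"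
      using onb_coord_proj_tendsto[OF assms(1)] by simp
    show "AE \<omega> in P. norm ((norm (h (u \<omega>) - coord_proj y (I \<inter> {1..J}) (h (u \<omega>))))\<^sup>2)
        \<le> (norm (h (u \<omega>)))\<^sup>2" for J
      using norm_diff_coord_proj_le_norm[OF _ ortho] by simp
  qed (simp_all add: coord_proj_def)
  then show ?thesis by simp
qed

end

section \<open>Averages of independent samples\<close>

text \<open>Bias-variance decomposition: the centred summands are pairwise orthogonal and each
  variance is at most the raw second moment \<open>v\<close>. The target \<open>a\<close> may differ
  from the mean, which leaves the squared bias.\<close>

lemma (in prob_space) independent_average:
  fixes Z :: "nat \<Rightarrow> 'a \<Rightarrow> real" and a :: real
  assumes T: "finite T" "T \<noteq> {}" and ind: "indep_vars (\<lambda>_. borel) Z T"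
    and Z: "\<And>m. m \<in> T \<Longrightarrow> Z m \<in> L2 M" "\<And>m. m \<in> T \<Longrightarrow> expectation (Z m) = \<mu>"
      "\<And>m. m \<in> T \<Longrightarrow> l2_inner M (Z m) (Z m) \<le> v"
  defines "D \<equiv> \<lambda>\<omega>. (\<Sum>m\<in>T. Z m \<omega>) / card T - a"
  shows independent_average_L2: "D \<in> L2 M"
    and independent_average_le: "l2_inner M D D \<le> v / card T + (\<mu> - a)\<^sup>2"
proof -
  define E where "E m = (\<lambda>\<omega>. Z m \<omega> - \<mu>)" for m
  have const_L2: "(\<lambda>_. s) \<in> L2 M" for s by (simp add: L2_def)
  have E_L2: "E m \<in> L2 M" if "m \<in> T" for m
    unfolding E_def by (intro L2_diff Z that const_L2)
  have L2_int: "f \<in> L2 M \<Longrightarrow> integrable M f" for f :: "'a \<Rightarrow> real"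
    by (auto simp: L2_def intro: square_integrable_imp_integrable)
  have E_mean: "expectation (E m) = 0" if "m \<in> T" for m
    using that Z L2_int[OF Z(1)] by (simp add: E_def prob_space)
  have E_diag: "l2_inner M (E m) (E m) \<le> v" if "m \<in> T" for m
  proof -
    have "l2_inner M (E m) (E m) = expectation (\<lambda>\<omega>. (Z m \<omega>)\<^sup>2 - 2 * \<mu> * Z m \<omega> + \<mu>\<^sup>2)"
      unfolding l2_inner_self E_def by (simp add: power2_diff algebra_simps)
    also have "\<dots> = l2_inner M (Z m) (Z m) - \<mu>\<^sup>2"
      using Z(1,2)[OF that] L2_int[OF Z(1)[OF that]]
      by (simp add: l2_inner_self L2_def prob_space power2_eq_square)
    also have "\<dots> \<le> v" using Z(3)[OF that] zero_le_power2[of \<mu>] by linarith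
    finally show ?thesis .
  qed
  have E_off: "l2_inner M (E i) (E j) = 0" if "i \<in> T" "j \<in> T" "i \<noteq> j" for i j
  proof -
    have "indep_vars (\<lambda>_. borel) E {i, j}"
      unfolding E_def using that
      by (intro indep_vars_compose2[OF indep_vars_subset[OF ind, of "{i, j}"],
        where Y="\<lambda>_ x. x - \<mu>" and N="\<lambda>_. borel"]) auto
    then have "expectation (\<lambda>\<omega>. \<Prod>k\<in>{i, j}. E k \<omega>) = (\<Prod>k\<in>{i, j}. expectation (E k))"
      using that L2_int[OF E_L2] by (intro indep_vars_lebesgue_integral) auto
    then show ?thesis using that E_mean by (simp add: l2_inner_def)
  qed
  \<comment> \<open>The factor \<open>1\<close> matches the shape of \<open>L2_sum\<close> and
    \<open>l2_inner_sum_left\<close>.\<close>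
  define S where "S = (\<lambda>\<omega>. \<Sum>m\<in>T. 1 * E m \<omega>)"
  have S_L2: "S \<in> L2 M" unfolding S_def using T(1) E_L2 by (rule L2_sum)
  have "l2_inner M S S = (\<Sum>m\<in>T. 1 * l2_inner M (E m) S)"
    unfolding S_def using T(1) E_L2 S_L2[unfolded S_def] by (rule l2_inner_sum_left)
  also have "\<dots> = (\<Sum>m\<in>T. \<Sum>k\<in>T. l2_inner M (E k) (E m))"
  proof (rule sum.cong[OF refl])
    fix m assume "m \<in> T"
    then have "l2_inner M S (E m) = (\<Sum>k\<in>T. 1 * l2_inner M (E k) (E m))"
      unfolding S_def by (intro l2_inner_sum_left T E_L2)
    then show "1 * l2_inner M (E m) S = (\<Sum>k\<in>T. l2_inner M (E k) (E m))"
      by (simp add: l2_inner_commute[of M "E m" S])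
  qed
  also have "\<dots> = (\<Sum>m\<in>T. \<Sum>k\<in>T. if k = m then l2_inner M (E m) (E m) else 0)"
    using E_off by (intro sum.cong) auto
  also have "\<dots> = (\<Sum>m\<in>T. l2_inner M (E m) (E m))" using T(1) by simp
  also have "\<dots> \<le> card T * v"
    using sum_bounded_above[of T "\<lambda>m. l2_inner M (E m) (E m)" v] E_diag by simp
  finally have S2: "l2_inner M S S \<le> card T * v" .
  have n: "real (card T) > 0" using T by (simp add: card_gt_0_iff)
  have S_mean: "expectation S = 0"
    unfolding S_def using T(1) L2_int[OF E_L2] E_mean by (simp add: Bochner_Integration.integral_sum)
  have D: "D \<omega> = S \<omega> / card T + (\<mu> - a)" for \<omega>
    using n by (simp add: D_def S_def E_def sum_subtractf field_simps)
  show "D \<in> L2 M"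
    using L2_add[OF L2_scale[OF S_L2, of "1 / card T"] const_L2[of "\<mu> - a"]]
    by (simp add: D[abs_def])
  have "(D \<omega>)\<^sup>2 = (S \<omega>)\<^sup>2 / (card T)\<^sup>2 + (2 * (\<mu> - a) / card T) * S \<omega> + (\<mu> - a)\<^sup>2" for \<omega>
    unfolding D power2_sum by (simp add: power_divide)
  then have "l2_inner M D D = expectation (\<lambda>\<omega>. (S \<omega>)\<^sup>2 / (card T)\<^sup>2 + (2 * (\<mu> - a) / card T) * S \<omega> + (\<mu> - a)\<^sup>2)"
    by (simp add: l2_inner_self)
  also have "\<dots> = l2_inner M S S / (card T)\<^sup>2 + (\<mu> - a)\<^sup>2"
    using S_L2 L2_int[OF S_L2] S_mean by (simp add: l2_inner_self L2_def prob_space)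
  also have "\<dots> \<le> card T * v / (card T)\<^sup>2 + (\<mu> - a)\<^sup>2"
    using S2 by (intro add_right_mono divide_right_mono) auto
  also have "card T * v / (card T)\<^sup>2 = v / card T"
    using n by (simp add: power2_eq_square)
  finally show "l2_inner M D D \<le> v / card T + (\<mu> - a)\<^sup>2" .
qed

section \<open>Deviations of empirical pairings\<close>

text \<open>Of the decay assumptions only convergence of \<open>lam\<close> to zero is kept, so that
  one risk bound serves both rates. \<open>\<kappa>\<close> is fixed for the whole Sobolev space,
  which makes the bounds uniform over the ball.\<close>

locale kernel_regression =
  regression_noise P u \<epsilon> \<sigma> + normal_eigensystem \<rho> \<psi> N lam + Q: prob_space Q
  for P :: "'w measure" and u :: "'w \<Rightarrow> 'x::banach"
    and \<epsilon> :: "'y::{real_inner, second_countable_topology} \<Rightarrow> 'w \<Rightarrow> real" and \<sigma>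
    and \<rho> :: "'s measure" and \<psi> N lam and Q :: "'v measure" +
  fixes R :: "('s \<Rightarrow> real) \<Rightarrow> 'x \<Rightarrow> 'y" and I :: "nat set" and y :: "nat \<Rightarrow> 'y"
    and us :: "nat \<Rightarrow> 'v \<Rightarrow> 'x" and es :: "nat \<Rightarrow> 'y \<Rightarrow> 'v \<Rightarrow> real" and \<beta> \<kappa> :: real
  assumes R_forward: "forward_map \<rho> R"
    and R_normal: "normal_operator \<rho> R P u N"
    and R_kurtosis: "\<phi> \<in> sobolev_space \<rho> lam \<psi> \<beta> \<Longrightarrow> kurtosis_le \<kappa> (R \<phi>)"
    and kappa: "1 \<le> \<kappa>" and beta: "0 < \<beta>"
    and y_onb: "onb I y"
    and copies: "iid_copies P u \<epsilon> Q us es"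
    and lam_tendsto: "lam \<longlonglongrightarrow> 0"
begin

definition X :: "nat \<Rightarrow> 'v \<Rightarrow> 'x \<times> ('y \<Rightarrow> real)" where
  "X m \<omega> = (us m \<omega>, \<lambda>z. es m z \<omega>)"

lemma X_indep: "Q.indep_vars (\<lambda>_. sample_space) X {1..}"
  using copies unfolding iid_copies_def X_def[abs_def] by simp

lemma X_measurable: "1 \<le> m \<Longrightarrow> X m \<in> measurable Q sample_space"
  using X_indep by (auto simp: Q.indep_vars_def)

lemma input_noise_measurable: "(\<lambda>\<omega>. (u \<omega>, \<lambda>z. \<epsilon> z \<omega>)) \<in> measurable P sample_space"
  using u_measurable eps_measurable by (intro measurable_Pair) auto

lemma X_distr: "1 \<le> m \<Longrightarrow> distr Q sample_space (X m) = distr P sample_space (\<lambda>\<omega>. (u \<omega>, \<lambda>z. \<epsilon> z \<omega>))"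
  using copies unfolding iid_copies_def X_def[abs_def] by simp

lemma X_transfer:
  fixes F :: "'x \<times> ('y \<Rightarrow> real) \<Rightarrow> real"
  assumes "1 \<le> m" "F \<in> borel_measurable sample_space"
  shows "integrable Q (\<lambda>\<omega>. F (X m \<omega>)) \<longleftrightarrow> integrable P (\<lambda>\<omega>. F (u \<omega>, \<lambda>z. \<epsilon> z \<omega>))"
    and "Q.expectation (\<lambda>\<omega>. F (X m \<omega>)) = expectation (\<lambda>\<omega>. F (u \<omega>, \<lambda>z. \<epsilon> z \<omega>))"
  using integrable_distr_eq[OF X_measurable[OF assms(1)] assms(2)]
    integrable_distr_eq[OF input_noise_measurable assms(2)]
    integral_distr[OF X_measurable[OF assms(1)] assms(2)]
    integral_distr[OF input_noise_measurable assms(2)]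
  by (simp_all add: X_distr[OF assms(1)])

text \<open>Centring is at the untruncated expectation, so that the truncation to \<open>A\<close>
  appears as a bias inside \<open>dev\<close>.\<close>

definition dev :: "nat set \<Rightarrow> real \<Rightarrow> ('x \<Rightarrow> 'y) \<Rightarrow> ('x \<Rightarrow> 'y) \<Rightarrow> nat set \<Rightarrow> 'v \<Rightarrow> real" where
  "dev A c g h T \<omega> = (\<Sum>m\<in>T. pairing y A c g h (X m \<omega>)) / card T
     - expectation (\<lambda>\<omega>. inner (g (u \<omega>)) (h (u \<omega>)))"

lemma kurtosis_le_measurable: "kurtosis_le \<kappa> g \<Longrightarrow> g \<in> borel_measurable borel"
  by (simp add: kurtosis_le_def)

text \<open>The variance falls with the sample size while the truncation bias does not; the latter
  is made small through the choice of \<open>A\<close>.\<close>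

lemma dev_moments:
  assumes A: "finite A" "orthonormal_on y A"
    and g: "kurtosis_le \<kappa> g" and h: "kurtosis_le \<kappa> h"
    and T: "finite T" "T \<noteq> {}" "T \<subseteq> {1..}"
  shows dev_L2: "dev A c g h T \<in> L2 Q"
    and dev_second_moment: "l2_inner Q (dev A c g h T) (dev A c g h T) \<le>
      (6/5 * (c\<^sup>2 * \<sigma>\<^sup>2 * energy h) + 6 * (\<kappa> * energy g * energy h)) / card T
      + energy g * energy (\<lambda>x. h x - coord_proj y A (h x))"
proof -
  have k0: "0 \<le> \<kappa>" using kappa by simp
  note one = one_sample[where c=c, OF A g h k0]
  note meas = pairing_measurable[OF A(1) kurtosis_le_measurable[OF g] kurtosis_le_measurable[OF h], of y c]
  define Z where "Z m = (\<lambda>\<omega>. pairing y A c g h (X m \<omega>))" for m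
  define \<mu> where "\<mu> = expectation (\<lambda>\<omega>. pairing y A c g h (u \<omega>, \<lambda>z. \<epsilon> z \<omega>))"
  have ind: "Q.indep_vars (\<lambda>_. borel) Z T"
    unfolding Z_def
    by (rule Q.indep_vars_compose2[OF Q.indep_vars_subset[OF X_indep T(3)],
        where Y="\<lambda>_. pairing y A c g h" and N="\<lambda>_. borel"]) (rule meas)
  have meas2: "(\<lambda>p. (pairing y A c g h p)\<^sup>2) \<in> borel_measurable sample_space"
    using meas by simp
  have Z_L2: "Z m \<in> L2 Q" and Z_mean: "Q.expectation (Z m) = \<mu>"
    and Z_second: "l2_inner Q (Z m) (Z m) \<le>
      6/5 * (c\<^sup>2 * \<sigma>\<^sup>2 * energy h) + 6 * (\<kappa> * energy g * energy h)" if "m \<in> T" for m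
  proof -
    have m: "1 \<le> m" using that T(3) by auto
    show "Z m \<in> L2 Q"
      using one(1) X_transfer(1)[OF m meas2] measurable_compose[OF X_measurable[OF m] meas]
      by (simp add: L2_def Z_def)
    show "Q.expectation (Z m) = \<mu>"
      unfolding Z_def \<mu>_def by (rule X_transfer(2)[OF m meas])
    show "l2_inner Q (Z m) (Z m) \<le>
      6/5 * (c\<^sup>2 * \<sigma>\<^sup>2 * energy h) + 6 * (\<kappa> * energy g * energy h)"
      using one(2) X_transfer(2)[OF m meas2] by (simp add: l2_inner_self Z_def)
  qed
  have eq: "dev A c g h T = (\<lambda>\<omega>. (\<Sum>m\<in>T. Z m \<omega>) / card T
      - expectation (\<lambda>\<omega>. inner (g (u \<omega>)) (h (u \<omega>))))"
    by (simp add: dev_def Z_def fun_eq_iff)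
  show "dev A c g h T \<in> L2 Q"
    unfolding eq by (rule Q.independent_average_L2[OF T(1,2) ind Z_L2 Z_mean Z_second])
  show "l2_inner Q (dev A c g h T) (dev A c g h T) \<le>
      (6/5 * (c\<^sup>2 * \<sigma>\<^sup>2 * energy h) + 6 * (\<kappa> * energy g * energy h)) / card T
      + energy g * energy (\<lambda>x. h x - coord_proj y A (h x))"
    unfolding eq
    by (rule order_trans[OF Q.independent_average_le[OF T(1,2) ind Z_L2 Z_mean Z_second]])
      (use one(3) in \<open>simp_all add: \<mu>_def\<close>)
qed

lemma dev_indep:
  assumes A: "finite A"
    and gh: "kurtosis_le \<kappa> g" "kurtosis_le \<kappa> h" "kurtosis_le \<kappa> g'" "kurtosis_le \<kappa> h'"
    and T: "T \<subseteq> {1..}" "T' \<subseteq> {1..}" "T \<inter> T' = {}"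
  shows "Q.indep_var borel (\<lambda>\<omega>. (dev A c g h T \<omega>)\<^sup>2) borel (\<lambda>\<omega>. (dev A c' g' h' T' \<omega>)\<^sup>2)"
proof -
  define G where "G S c g h f = ((\<Sum>m\<in>S. pairing y A c g h (f m)) / card S
     - expectation (\<lambda>\<omega>. inner (g (u \<omega>)) (h (u \<omega>))))\<^sup>2"
    for S c g h and f :: "nat \<Rightarrow> 'x \<times> ('y \<Rightarrow> real)"
  have meas: "G S c g h \<in> borel_measurable (PiM S (\<lambda>_. sample_space))"
    if "kurtosis_le \<kappa> g" "kurtosis_le \<kappa> h" for S c g h
  proof -
    have "(\<lambda>f. pairing y A c g h (f m)) \<in> borel_measurable (PiM S (\<lambda>_. sample_space))" if "m \<in> S" for m
      using \<open>kurtosis_le \<kappa> g\<close> \<open>kurtosis_le \<kappa> h\<close>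
      by (intro measurable_compose[OF measurable_component_singleton[OF that]]
        pairing_measurable A kurtosis_le_measurable)
    then have "(\<lambda>f. \<Sum>m\<in>S. pairing y A c g h (f m)) \<in> borel_measurable (PiM S (\<lambda>_. sample_space))"
      by (rule borel_measurable_sum)
    then show ?thesis
      unfolding G_def by (intro borel_measurable_power borel_measurable_diff borel_measurable_divide) auto
  qed
  have eq: "(\<lambda>\<omega>. (dev A c g h S \<omega>)\<^sup>2) = G S c g h \<circ> (\<lambda>\<omega>. restrict (\<lambda>m. X m \<omega>) S)" for c g h S
    by (simp add: G_def dev_def fun_eq_iff cong: sum.cong)
  show ?thesis
    unfolding eq
    by (rule Q.indep_var_compose[OF Q.indep_var_restrict[OF X_indep T(3,1,2)]]) (intro meas gh)+
qed

text \<open>This is the gain from splitting the sample: deviations over disjoint blocks are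
  independent, so the second moment of a product factors and second moments of the noise
  suffice.\<close>

lemma dev_prod:
  assumes A: "finite A" "orthonormal_on y A"
    and gh: "kurtosis_le \<kappa> g" "kurtosis_le \<kappa> h" "kurtosis_le \<kappa> g'" "kurtosis_le \<kappa> h'"
    and T: "finite T" "T \<noteq> {}" "T \<subseteq> {1..}" "finite T'" "T' \<noteq> {}" "T' \<subseteq> {1..}" "T \<inter> T' = {}"
  shows dev_prod_L2: "(\<lambda>\<omega>. dev A c g h T \<omega> * dev A c' g' h' T' \<omega>) \<in> L2 Q"
    and dev_prod_moment: "Q.expectation (\<lambda>\<omega>. (dev A c g h T \<omega> * dev A c' g' h' T' \<omega>)\<^sup>2) =
      l2_inner Q (dev A c g h T) (dev A c g h T) * l2_inner Q (dev A c' g' h' T') (dev A c' g' h' T')"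
proof -
  note ind = dev_indep[OF A(1) gh T(3,6,7), of c c']
  have L2: "dev A c g h T \<in> L2 Q" "dev A c' g' h' T' \<in> L2 Q"
    using A gh T by (auto intro: dev_L2)
  then have int: "integrable Q (\<lambda>\<omega>. (dev A c g h T \<omega>)\<^sup>2)" "integrable Q (\<lambda>\<omega>. (dev A c' g' h' T' \<omega>)\<^sup>2)"
    by (auto simp: L2_def)
  show "(\<lambda>\<omega>. dev A c g h T \<omega> * dev A c' g' h' T' \<omega>) \<in> L2 Q"
    using Q.indep_var_integrable[OF ind int] L2 by (auto simp: L2_def power_mult_distrib)
  show "Q.expectation (\<lambda>\<omega>. (dev A c g h T \<omega> * dev A c' g' h' T' \<omega>)\<^sup>2) =
      l2_inner Q (dev A c g h T) (dev A c g h T) * l2_inner Q (dev A c' g' h' T') (dev A c' g' h' T')"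
    using Q.indep_var_lebesgue_integral[OF ind int] by (simp add: power_mult_distrib l2_inner_self)
qed

section \<open>Energies of kernels\<close>

lemma energy_R: "\<phi> \<in> L2 \<rho> \<Longrightarrow> energy (R \<phi>) = l2_inner \<rho> (N \<phi>) \<phi>"
  using R_normal by (auto simp: normal_operator_def energy_def power2_norm_eq_inner)

lemma inner_R_psi:
  assumes "\<phi> \<in> L2 \<rho>" "1 \<le> k"
  shows "expectation (\<lambda>\<omega>. inner (R \<phi> (u \<omega>)) (R (\<psi> k) (u \<omega>))) = lam k * l2_inner \<rho> \<phi> (\<psi> k)"
  using R_normal assms psi_L2[OF assms(2)] inner_N_psi[OF assms] by (auto simp: normal_operator_def)

lemma energy_R_psi: "1 \<le> k \<Longrightarrow> energy (R (\<psi> k)) = lam k"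
  by (simp add: energy_R psi_L2 inner_N_psi psi_ortho)

lemma kurtosis_R_psi: "1 \<le> k \<Longrightarrow> kurtosis_le \<kappa> (R (\<psi> k))"
  by (intro R_kurtosis psi_in_sobolev_space psi_L2)

text \<open>Induction on \<open>n\<close>, since \<open>forward_map\<close> states linearity for
  combinations of two functions.\<close>

lemma R_diff_comb:
  assumes "\<phi> \<in> L2 \<rho>"
  shows "R \<phi> x = R (\<lambda>s. \<phi> s - (\<Sum>k=1..n. c k * \<psi> k s)) x + (\<Sum>k=1..n. c k *\<^sub>R R (\<psi> k) x)"
proof (induction n)
  case 0
  then show ?case by simp
next
  case (Suc n)
  let ?t = "\<lambda>n s. \<phi> s - (\<Sum>k=1..n. c k * \<psi> k s)"
  have L2: "?t (Suc n) \<in> L2 \<rho>" by (intro L2_diff assms comb_L2)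
  have "?t n = (\<lambda>s. 1 * ?t (Suc n) s + c (Suc n) * \<psi> (Suc n) s)"
    by (simp add: fun_eq_iff)
  then have "R (?t n) x = R (\<lambda>s. 1 * ?t (Suc n) s + c (Suc n) * \<psi> (Suc n) s) x" by (rule arg_cong)
  also have "\<dots> = 1 *\<^sub>R R (?t (Suc n)) x + c (Suc n) *\<^sub>R R (\<psi> (Suc n)) x"
    by (rule R_forward[unfolded forward_map_def, THEN conjunct2, THEN conjunct2, rule_format, OF L2 psi_L2]) simp
  finally show ?case using Suc by simp
qed

text \<open>Both bounds depend on \<open>\<phi>\<close> only through \<open>L\<close>, so later
  thresholds are uniform over the ball. In the first, \<open>lam (Suc n) powr \<beta>\<close> is
  relaxed to \<open>lam 1 powr \<beta>\<close>: the remaining factor \<open>lam (Suc n)\<close>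
  already makes it tend to zero.\<close>

lemma ball_energy:
  assumes "\<phi> \<in> sobolev_ball \<rho> lam \<psi> \<beta> L" "l2_expansion \<rho> \<psi> \<theta> \<phi>"
  shows "energy (R (\<lambda>x. \<phi> x - (\<Sum>k=1..n. \<theta> k * \<psi> k x))) \<le> lam (Suc n) * (lam 1 powr \<beta> * L\<^sup>2)"
    and "(l2_norm \<rho> (\<lambda>x. \<phi> x - (\<Sum>k=1..n. \<theta> k * \<psi> k x)))\<^sup>2 \<le> lam (Suc n) powr \<beta> * L\<^sup>2"
proof -
  obtain \<theta>' where *: "\<phi> \<in> L2 \<rho>" "l2_expansion \<rho> \<psi> \<theta>' \<phi>"
    "\<And>A. finite A \<Longrightarrow> A \<subseteq> {1..} \<Longrightarrow> (\<Sum>k\<in>A. lam k powr (- \<beta>) * (\<theta>' k)\<^sup>2) \<le> L\<^sup>2"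
    using sobolev_ballE[OF assms(1)] by blast
  \<comment> \<open>The ball supplies coefficients of its own; uniqueness identifies them with the
    given ones.\<close>
  have "\<theta>' k = \<theta> k" if "1 \<le> k" for k
    using expansion_coeff[OF *(1,2) that] expansion_coeff[OF *(1) assms(2) that] by simp
  then have "(\<Sum>k\<in>A. lam k powr (- \<beta>) * (\<theta> k)\<^sup>2) \<le> L\<^sup>2" if "finite A" "A \<subseteq> {1..}" for A
    using *(3)[OF that] that(2) by (auto cong: sum.cong simp: subset_eq)
  from tail_norm_le[OF *(1) assms(2) beta this]
  show norm_le: "(l2_norm \<rho> (\<lambda>x. \<phi> x - (\<Sum>k=1..n. \<theta> k * \<psi> k x)))\<^sup>2 \<le> lam (Suc n) powr \<beta> * L\<^sup>2" .
  have "energy (R (\<lambda>x. \<phi> x - (\<Sum>k=1..n. \<theta> k * \<psi> k x))) \<le>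
      lam (Suc n) * (l2_norm \<rho> (\<lambda>x. \<phi> x - (\<Sum>k=1..n. \<theta> k * \<psi> k x)))\<^sup>2"
    using tail_N_le[OF *(1) assms(2)] *(1) comb_L2 by (simp add: energy_R L2_diff)
  also have "\<dots> \<le> lam (Suc n) * (lam (Suc n) powr \<beta> * L\<^sup>2)"
    using norm_le lam_pos[of "Suc n"] by (intro mult_left_mono) auto
  also have "\<dots> \<le> lam (Suc n) * (lam 1 powr \<beta> * L\<^sup>2)"
    using lam_pos[of "Suc n"] lam_antimono[of 1 "Suc n"] beta
    by (intro mult_left_mono mult_right_mono powr_mono2) auto
  finally show "energy (R (\<lambda>x. \<phi> x - (\<Sum>k=1..n. \<theta> k * \<psi> k x))) \<le> lam (Suc n) * (lam 1 powr \<beta> * L\<^sup>2)" .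
qed

section \<open>The two-stage estimator\<close>

text \<open>The set \<open>A\<close> collects the retained basis vectors of the output space; stage one uses the samples
  \<open>1..m\<close>, stage two the samples \<open>m+1..2m\<close>.\<close>

definition response :: "nat set \<Rightarrow> nat \<Rightarrow> (nat \<Rightarrow> 'x \<times> (nat \<Rightarrow> real)) \<Rightarrow> nat \<Rightarrow> real" where
  "response A k d i = (\<Sum>l\<in>A. inner (R (\<psi> k) (fst (d i))) (y l) * snd (d i) l)"

text \<open>Up to truncation, a one-sample version of the matrix of \<open>N\<close> in the
  eigenbasis, whose population value is \<open>lam k\<close> on the diagonal and zero
  elsewhere.\<close>

definition gram :: "nat set \<Rightarrow> nat \<Rightarrow> nat \<Rightarrow> (nat \<Rightarrow> 'x \<times> (nat \<Rightarrow> real)) \<Rightarrow> nat \<Rightarrow> real" where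
  "gram A j k d i = (\<Sum>l\<in>A. inner (R (\<psi> k) (fst (d i))) (y l) * inner (R (\<psi> j) (fst (d i))) (y l))"

definition pilot :: "nat set \<Rightarrow> nat \<Rightarrow> nat \<Rightarrow> (nat \<Rightarrow> 'x \<times> (nat \<Rightarrow> real)) \<Rightarrow> real" where
  "pilot A m j d = (\<Sum>i=1..m. response A j d i) / real m / lam j"

text \<open>The pilot fit is subtracted from the second-half observations, the residual is regressed
  on \<open>\<psi> k\<close>, and the pilot coefficient is added back. Division by the known
  \<open>lam k\<close> inverts the normal operator in its eigenbasis.\<close>

definition refined :: "nat set \<Rightarrow> nat \<Rightarrow> nat \<Rightarrow> nat \<Rightarrow> (nat \<Rightarrow> 'x \<times> (nat \<Rightarrow> real)) \<Rightarrow> real" where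
  "refined A m n' k d = (if k \<le> n' then pilot A m k d else 0) +
    (\<Sum>i=Suc m..2*m. response A k d i - (\<Sum>j=1..n'. pilot A m j d * gram A j k d i)) / real m / lam k"

section \<open>Measurability of the estimator\<close>

lemma response_measurable:
  assumes "A \<subseteq> I" "1 \<le> k" "i \<in> {1..M}"
  shows "(\<lambda>d. response A k d i) \<in> borel_measurable (data_space I M)"
proof -
  have di: "(\<lambda>d. d i) \<in> measurable (data_space I M) (borel \<Otimes>\<^sub>M (\<Pi>\<^sub>M i\<in>I. borel))"
    unfolding data_space_def by (rule measurable_component_singleton[OF assms(3)])
  note [measurable] = measurable_compose[OF di measurable_fst]
    kurtosis_le_measurable[OF kurtosis_R_psi[OF assms(2)]]
  have [measurable]: "(\<lambda>d. snd (d i) l) \<in> borel_measurable (data_space I M)" if "l \<in> A" for l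
    using that assms(1)
    by (intro measurable_compose[OF measurable_compose[OF di measurable_snd]] measurable_component_singleton) auto
  show ?thesis unfolding response_def by measurable
qed

lemma gram_measurable:
  assumes "1 \<le> j" "1 \<le> k" "i \<in> {1..M}"
  shows "(\<lambda>d. gram A j k d i) \<in> borel_measurable (data_space I M)"
proof -
  have di: "(\<lambda>d. d i) \<in> measurable (data_space I M) (borel \<Otimes>\<^sub>M (\<Pi>\<^sub>M i\<in>I. borel))"
    unfolding data_space_def by (rule measurable_component_singleton[OF assms(3)])
  note [measurable] = measurable_compose[OF di measurable_fst]
    kurtosis_le_measurable[OF kurtosis_R_psi[OF assms(1)]]
    kurtosis_le_measurable[OF kurtosis_R_psi[OF assms(2)]]
  show ?thesis unfolding gram_def by measurable
qed

lemma pilot_measurable: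
  assumes "A \<subseteq> I" "1 \<le> j" "m \<le> M"
  shows "pilot A m j \<in> borel_measurable (data_space I M)"
  unfolding pilot_def using assms
  by (intro borel_measurable_divide borel_measurable_sum response_measurable) auto

lemma refined_measurable:
  assumes "A \<subseteq> I" "1 \<le> k" "2 * m \<le> M"
  shows "refined A m n' k \<in> borel_measurable (data_space I M)"
proof -
  have "(\<lambda>d. if k \<le> n' then pilot A m k d else 0) \<in> borel_measurable (data_space I M)"
    using assms pilot_measurable[of A k m M] by (cases "k \<le> n'") auto
  then show ?thesis
    unfolding refined_def using assms
    by (intro borel_measurable_add borel_measurable_divide borel_measurable_sum borel_measurable_diff
        borel_measurable_times response_measurable gram_measurable pilot_measurable) auto
qed

text \<open>By orthonormality the map from coefficients to combinations is continuous, so an open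
  set of functions has an open preimage \<open>W\<close> among real sequences. There measurability
  can be checked coordinatewise.\<close>

lemma comb_measurable_l2_borel:
  assumes "\<And>k. 1 \<le> k \<Longrightarrow> c k \<in> borel_measurable B"
  shows "(\<lambda>d x. \<Sum>k=1..n. c k d * \<psi> k x) \<in> measurable B (l2_borel \<rho>)"
  unfolding l2_borel_def
proof (rule measurable_measure_of)
  show "{A. l2_open \<rho> A} \<subseteq> Pow (L2 \<rho>)" by (auto simp: l2_open_def)
  show "(\<lambda>d x. \<Sum>k=1..n. c k d * \<psi> k x) \<in> space B \<rightarrow> L2 \<rho>" by (auto intro: comb_L2)
  fix V assume "V \<in> {A. l2_open \<rho> A}"
  then have V: "l2_open \<rho> V" by simp
  define W where "W = {a :: nat \<Rightarrow> real. (\<lambda>x. \<Sum>k=1..n. a k * \<psi> k x) \<in> V}"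
  have "open W"
  proof (subst open_subopen, rule ballI)
    fix a assume "a \<in> W"
    then obtain e where e: "e > 0" "\<And>\<phi>. \<phi> \<in> L2 \<rho> \<Longrightarrow>
        l2_norm \<rho> (\<lambda>x. \<phi> x - (\<Sum>k=1..n. a k * \<psi> k x)) < e \<Longrightarrow> \<phi> \<in> V"
      using V by (auto simp: W_def l2_open_def)
    define T where "T = {b :: nat \<Rightarrow> real. (\<Sum>k=1..n. (b k - a k)\<^sup>2) < e\<^sup>2}"
    have "open T" unfolding T_def by (intro open_Collect_less continuous_intros continuous_on_product_coordinates)
    moreover have "a \<in> T" using e(1) by (simp add: T_def)
    moreover have "T \<subseteq> W"
    proof
      fix b assume b: "b \<in> T"
      have "(\<lambda>x. (\<Sum>k=1..n. b k * \<psi> k x) - (\<Sum>k=1..n. a k * \<psi> k x))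
          = (\<lambda>x. \<Sum>k=1..n. (b k - a k) * \<psi> k x)"
        by (simp add: left_diff_distrib sum_subtractf)
      then have "l2_norm \<rho> (\<lambda>x. (\<Sum>k=1..n. b k * \<psi> k x) - (\<Sum>k=1..n. a k * \<psi> k x))
          = sqrt (\<Sum>k=1..n. (b k - a k)\<^sup>2)"
        using inner_comb_self[of "\<lambda>k. b k - a k" n] by (simp add: l2_norm_def)
      also have "\<dots> < e" using b e(1) by (auto simp: T_def intro: real_less_lsqrt)
      finally show "b \<in> W" unfolding W_def using e(2) comb_L2 by blast
    qed
    ultimately show "\<exists>T. open T \<and> a \<in> T \<and> T \<subseteq> W" by blast
  qed
  \<comment> \<open>Index \<open>0\<close> gets a harmless default, as \<open>c\<close> is known to
    be measurable only from \<open>1\<close> on.\<close>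
  moreover have "(\<lambda>d k. if 1 \<le> k then c k d else 0) \<in> borel_measurable B"
  proof (rule measurable_coordinatewise_then_product)
    show "(\<lambda>d. if 1 \<le> k then c k d else 0) \<in> borel_measurable B" for k
      using assms[of k] by (cases "1 \<le> k") simp_all
  qed
  ultimately have "(\<lambda>d k. if 1 \<le> k then c k d else 0) -` W \<inter> space B \<in> sets B"
    by (intro measurable_sets) auto
  moreover have "(\<lambda>d k. if 1 \<le> k then c k d else 0) -` W \<inter> space B =
      (\<lambda>d x. \<Sum>k=1..n. c k d * \<psi> k x) -` V \<inter> space B"
  proof -
    have "(\<Sum>k=1..n. (if 1 \<le> k then c k d else 0) * \<psi> k x) = (\<Sum>k=1..n. c k d * \<psi> k x)" for d x
      by (intro sum.cong) auto
    then show ?thesis by (simp add: W_def vimage_def)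
  qed
  ultimately show "(\<lambda>d x. \<Sum>k=1..n. c k d * \<psi> k x) -` V \<inter> space B \<in> sets B" by simp
qed

section \<open>Exact error formulas for both stages\<close>

abbreviation residual :: "('s \<Rightarrow> real) \<Rightarrow> (nat \<Rightarrow> real) \<Rightarrow> nat \<Rightarrow> 's \<Rightarrow> real" where
  "residual \<phi> \<theta> n \<equiv> \<lambda>x. \<phi> x - (\<Sum>k=1..n. \<theta> k * \<psi> k x)"

abbreviation "obs \<equiv> data R I y us es"

context
  fixes \<phi> :: "'s \<Rightarrow> real" and \<theta> :: "nat \<Rightarrow> real" and A :: "nat set" and m n' M :: nat
  assumes phi: "\<phi> \<in> sobolev_space \<rho> lam \<psi> \<beta>" "l2_expansion \<rho> \<psi> \<theta> \<phi>"
    and A: "finite A" "A \<subseteq> I" and m: "1 \<le> m" "2 * m \<le> M"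
begin

lemma phi_L2: "\<phi> \<in> L2 \<rho>"
  using phi(1) by (simp add: sobolev_space_def)

lemma t_coeff: "1 \<le> k \<Longrightarrow> l2_inner \<rho> (residual \<phi> \<theta> n') (\<psi> k) = (if k \<le> n' then 0 else \<theta> k)"
  by (simp add: l2_inner_diff_left phi_L2 comb_L2 psi_L2 inner_comb_psi expansion_coeff[OF phi_L2 phi(2)])

lemma response_obs:
  assumes "i \<in> {1..M}"
  shows "response A k (obs \<phi> M \<omega>) i = pairing y A 1 (R \<phi>) (R (\<psi> k)) (X i \<omega>)"
  unfolding response_def pairing_def using assms A(2)
  by (intro sum.cong) (auto simp: data_def X_def)

lemma gram_obs:
  assumes "i \<in> {1..M}"
  shows "gram A j k (obs \<phi> M \<omega>) i = pairing y A 0 (R (\<psi> j)) (R (\<psi> k)) (X i \<omega>)"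
  unfolding gram_def pairing_def using assms by (simp add: data_def X_def)

text \<open>Linearity of \<open>R\<close> in the kernel. The noise stays with the residual
  (\<open>c = 1\<close>); the terms of the pilot space are noiseless (\<open>c = 0\<close>) and
  hence computable Gram entries.\<close>

lemma pairing_split:
  "pairing y A 1 (R \<phi>) h p = pairing y A 1 (R (residual \<phi> \<theta> n')) h p + (\<Sum>j=1..n'. \<theta> j * pairing y A 0 (R (\<psi> j)) h p)"
proof -
  have "pairing y A 1 (R \<phi>) h p = (\<Sum>i\<in>A. inner (h (fst p)) (y i) * (1 * snd p (y i) + inner (R (residual \<phi> \<theta> n') (fst p)) (y i))
      + (\<Sum>j=1..n'. \<theta> j * (inner (h (fst p)) (y i) * (0 * snd p (y i) + inner (R (\<psi> j) (fst p)) (y i)))))"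
    unfolding pairing_def R_diff_comb[OF phi_L2, where n=n' and c=\<theta>]
    by (intro sum.cong refl) (simp add: inner_add_left inner_sum_left sum_distrib_left algebra_simps)
  also have "\<dots> = pairing y A 1 (R (residual \<phi> \<theta> n')) h p + (\<Sum>i\<in>A. \<Sum>j=1..n'.
      \<theta> j * (inner (h (fst p)) (y i) * (0 * snd p (y i) + inner (R (\<psi> j) (fst p)) (y i))))"
    by (simp only: sum.distrib pairing_def)
  also have "\<dots> = pairing y A 1 (R (residual \<phi> \<theta> n')) h p + (\<Sum>j=1..n'. \<theta> j * pairing y A 0 (R (\<psi> j)) h p)"
    by (subst sum.swap) (simp only: pairing_def sum_distrib_left)
  finally show ?thesis .
qed

lemma pilot_error:
  assumes "1 \<le> j"
  shows "pilot A m j (obs \<phi> M \<omega>) - \<theta> j = dev A 1 (R \<phi>) (R (\<psi> j)) {1..m} \<omega> / lam j"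
proof -
  have "(\<Sum>i=1..m. response A j (obs \<phi> M \<omega>) i) = (\<Sum>i=1..m. pairing y A 1 (R \<phi>) (R (\<psi> j)) (X i \<omega>))"
    using m by (intro sum.cong response_obs) auto
  then show ?thesis
    using lam_pos[OF assms]
    by (simp add: pilot_def dev_def inner_R_psi[OF phi_L2 assms] expansion_coeff[OF phi_L2 phi(2) assms] diff_divide_distrib)
qed

lemma refined_error:
  assumes k: "1 \<le> k"
  shows "refined A m n' k (obs \<phi> M \<omega>) - \<theta> k =
    (dev A 1 (R (residual \<phi> \<theta> n')) (R (\<psi> k)) {Suc m..2*m} \<omega> -
      (\<Sum>j=1..n'. dev A 1 (R \<phi>) (R (\<psi> j)) {1..m} \<omega> / lam j *
        dev A 0 (R (\<psi> j)) (R (\<psi> k)) {Suc m..2*m} \<omega>)) / lam k"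
proof -
  define p where "p j = pilot A m j (obs \<phi> M \<omega>)" for j
  define a where "a = (\<Sum>i=Suc m..2*m. pairing y A 1 (R (residual \<phi> \<theta> n')) (R (\<psi> k)) (X i \<omega>)) / real m"
  define b where "b j = (\<Sum>i=Suc m..2*m. pairing y A 0 (R (\<psi> j)) (R (\<psi> k)) (X i \<omega>)) / real m" for j
  have tL2: "residual \<phi> \<theta> n' \<in> L2 \<rho>" by (intro L2_diff phi_L2 comb_L2)
  \<comment> \<open>The residual has no component along the first \<open>n'\<close> eigenfunctions;
    for larger \<open>k\<close> the whole coefficient is estimated here.\<close>
  have a: "a = dev A 1 (R (residual \<phi> \<theta> n')) (R (\<psi> k)) {Suc m..2*m} \<omega> + lam k * (if k \<le> n' then 0 else \<theta> k)"
    by (simp add: a_def dev_def inner_R_psi[OF tL2 k] t_coeff[OF k])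
  have b: "b j = dev A 0 (R (\<psi> j)) (R (\<psi> k)) {Suc m..2*m} \<omega> + (if j = k then lam k else 0)" if "1 \<le> j" for j
    using that by (simp add: b_def dev_def inner_R_psi[OF psi_L2 k] psi_ortho k)
  have "(\<Sum>i=Suc m..2*m. response A k (obs \<phi> M \<omega>) i - (\<Sum>j=1..n'. p j * gram A j k (obs \<phi> M \<omega>) i)) / real m
      = (\<Sum>i=Suc m..2*m. pairing y A 1 (R (residual \<phi> \<theta> n')) (R (\<psi> k)) (X i \<omega>)
        + (\<Sum>j=1..n'. (\<theta> j - p j) * pairing y A 0 (R (\<psi> j)) (R (\<psi> k)) (X i \<omega>))) / real m"
  proof (intro arg_cong2[where f="(/)"] sum.cong refl)
    fix i assume "i \<in> {Suc m..2*m}"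
    then have i: "i \<in> {1..M}" using m by auto
    show "response A k (obs \<phi> M \<omega>) i - (\<Sum>j=1..n'. p j * gram A j k (obs \<phi> M \<omega>) i) =
      pairing y A 1 (R (residual \<phi> \<theta> n')) (R (\<psi> k)) (X i \<omega>)
        + (\<Sum>j=1..n'. (\<theta> j - p j) * pairing y A 0 (R (\<psi> j)) (R (\<psi> k)) (X i \<omega>))"
      unfolding response_obs[OF i] gram_obs[OF i] pairing_split[of "R (\<psi> k)"]
      by (simp only: left_diff_distrib sum_subtractf)
  qed
  also have "\<dots> = a + (\<Sum>j=1..n'. (\<theta> j - p j) * b j)"
  proof -
    have "(\<Sum>i\<in>S. \<Sum>j\<in>B. d j * q i j) / s = (\<Sum>j\<in>B. d j * ((\<Sum>i\<in>S. q i j) / s))"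
      for S B :: "nat set" and d q and s :: real
      by (subst sum.swap) (simp add: sum_distrib_left sum_divide_distrib)
    then show ?thesis
      unfolding a_def b_def sum.distrib add_divide_distrib by simp
  qed
  also have "(\<Sum>j=1..n'. (\<theta> j - p j) * b j) =
      (\<Sum>j=1..n'. (\<theta> j - p j) * dev A 0 (R (\<psi> j)) (R (\<psi> k)) {Suc m..2*m} \<omega>
        + (if j = k then (\<theta> k - p k) * lam k else 0))"
    using b by (intro sum.cong) (auto simp: algebra_simps)
  also have "\<dots> = (\<Sum>j=1..n'. (\<theta> j - p j) * dev A 0 (R (\<psi> j)) (R (\<psi> k)) {Suc m..2*m} \<omega>)
      + (if k \<le> n' then (\<theta> k - p k) * lam k else 0)"
    using k by (simp add: sum.distrib)
  also have "(\<Sum>j=1..n'. (\<theta> j - p j) * dev A 0 (R (\<psi> j)) (R (\<psi> k)) {Suc m..2*m} \<omega>) =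
      - (\<Sum>j=1..n'. dev A 1 (R \<phi>) (R (\<psi> j)) {1..m} \<omega> / lam j *
        dev A 0 (R (\<psi> j)) (R (\<psi> k)) {Suc m..2*m} \<omega>)" (is "_ = - ?S")
    unfolding sum_negf[symmetric]
  proof (intro sum.cong refl)
    fix j assume "j \<in> {1..n'}"
    then have "p j - \<theta> j = dev A 1 (R \<phi>) (R (\<psi> j)) {1..m} \<omega> / lam j"
      unfolding p_def by (intro pilot_error) auto
    then have "\<theta> j - p j = - (dev A 1 (R \<phi>) (R (\<psi> j)) {1..m} \<omega> / lam j)" by simp
    then show "(\<theta> j - p j) * dev A 0 (R (\<psi> j)) (R (\<psi> k)) {Suc m..2*m} \<omega> =
      - (dev A 1 (R \<phi>) (R (\<psi> j)) {1..m} \<omega> / lam j * dev A 0 (R (\<psi> j)) (R (\<psi> k)) {Suc m..2*m} \<omega>)"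
      by simp
  qed
  finally have "refined A m n' k (obs \<phi> M \<omega>) = (if k \<le> n' then p k else 0) +
    (a + (- ?S + (if k \<le> n' then (\<theta> k - p k) * lam k else 0))) / lam k"
    by (simp only: refined_def p_def)
  then show ?thesis
    unfolding a using lam_pos[OF k] by (simp add: field_simps)
qed

end

section \<open>Risk of the two-stage estimator\<close>

text \<open>The hypothesis \<open>res\<close> brings the truncation bias down to the order of the
  variance, whence the \<open>1\<close> in \<open>6 * \<kappa> + 1\<close>.\<close>

lemma dev_psi_moment:
  assumes A: "finite A" "orthonormal_on y A" and g: "kurtosis_le \<kappa> g" and k: "1 \<le> k"
    and T: "finite T" "T \<noteq> {}" "T \<subseteq> {1..}"
    and res: "energy (\<lambda>x. R (\<psi> k) x - coord_proj y A (R (\<psi> k) x)) \<le> lam k / card T"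
  shows "l2_inner Q (dev A c g (R (\<psi> k)) T) (dev A c g (R (\<psi> k)) T) \<le>
    lam k / card T * (6/5 * (c\<^sup>2 * \<sigma>\<^sup>2) + (6 * \<kappa> + 1) * energy g)"
proof -
  have "l2_inner Q (dev A c g (R (\<psi> k)) T) (dev A c g (R (\<psi> k)) T) \<le>
      (6/5 * (c\<^sup>2 * \<sigma>\<^sup>2 * lam k) + 6 * (\<kappa> * energy g * lam k)) / card T + energy g * (lam k / card T)"
    using dev_second_moment[OF A g kurtosis_R_psi[OF k] T, of c] mult_left_mono[OF res energy_nonneg[of g]]
    by (simp add: energy_R_psi[OF k])
  also have "\<dots> = lam k / card T * (6/5 * (c\<^sup>2 * \<sigma>\<^sup>2) + (6 * \<kappa> + 1) * energy g)"
    by (simp add: add_divide_distrib algebra_simps)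
  finally show ?thesis .
qed

text \<open>\<open>Z\<close> carries the second-half noise and the tail. Each \<open>G j\<close> is
  a product of two independent deviations, so its second moment is of order \<open>1 / m^2\<close>,
  one factor \<open>1 / m\<close> better than that of \<open>Z\<close>.\<close>

lemma refined_risk:
  assumes phi: "\<phi> \<in> sobolev_space \<rho> lam \<psi> \<beta>" "l2_expansion \<rho> \<psi> \<theta> \<phi>"
    and A: "finite A" "A \<subseteq> I" and m: "1 \<le> m" "2 * m \<le> M" and k: "1 \<le> k"
    and res: "\<And>j. j \<in> insert k {1..n'} \<Longrightarrow>
      energy (\<lambda>x. R (\<psi> j) x - coord_proj y A (R (\<psi> j) x)) \<le> lam j / real m"
  defines "K \<equiv> 6 * \<kappa> + 1" and "D \<equiv> \<lambda>\<omega>. refined A m n' k (obs \<phi> M \<omega>) - \<theta> k"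
  shows refined_risk_L2: "D \<in> L2 Q"
    and refined_risk_le: "l2_inner Q D D \<le> 1 / (lam k * real m) *
      (6/5 * (6/5 * \<sigma>\<^sup>2 + K * energy (R (residual \<phi> \<theta> n')))
       + 6 * (real n')\<^sup>2 * K * (6/5 * \<sigma>\<^sup>2 + K * energy (R \<phi>)) / real m)"
proof -
  have ortho: "orthonormal_on y A"
    using onb_orthonormal_on[OF y_onb] A(2) by (rule orthonormal_on_subset)
  define T1 where "T1 = {1..m}"
  define T2 where "T2 = {Suc m..2*m}"
  have T1: "finite T1" "T1 \<noteq> {}" "T1 \<subseteq> {1..}" "card T1 = m"
    and T2: "finite T2" "T2 \<noteq> {}" "T2 \<subseteq> {1..}" "card T2 = m" and T12: "T1 \<inter> T2 = {}"
    using m by (auto simp: T1_def T2_def)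
  define Z where "Z = dev A 1 (R (residual \<phi> \<theta> n')) (R (\<psi> k)) T2"
  define G where "G j = (\<lambda>\<omega>. dev A 1 (R \<phi>) (R (\<psi> j)) T1 \<omega> * dev A 0 (R (\<psi> j)) (R (\<psi> k)) T2 \<omega>)" for j
  have K: "0 \<le> K" using kappa by (simp add: K_def)
  have kur: "kurtosis_le \<kappa> (R (residual \<phi> \<theta> n'))" "kurtosis_le \<kappa> (R \<phi>)" "kurtosis_le \<kappa> (R (\<psi> k))"
    using phi k by (auto intro!: R_kurtosis sobolev_space_diff_comb psi_in_sobolev_space psi_L2)
  have D: "D \<omega> = (1 / lam k) * (Z \<omega> - (\<Sum>j=1..n'. (1 / lam j) * G j \<omega>))" for \<omega>
    unfolding D_def refined_error[OF phi A m k] by (simp add: Z_def G_def T1_def T2_def)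
  have Z_L2: "Z \<in> L2 Q" unfolding Z_def by (rule dev_L2[OF A(1) ortho kur(1,3) T2(1-3)])
  have G_L2: "G j \<in> L2 Q" if "1 \<le> j" for j
    unfolding G_def
    by (rule dev_prod_L2[OF A(1) ortho kur(2) kurtosis_R_psi[OF that] kurtosis_R_psi[OF that] kur(3)
      T1(1-3) T2(1-3) T12])
  have GG_L2: "(\<lambda>\<omega>. \<Sum>j=1..n'. (1 / lam j) * G j \<omega>) \<in> L2 Q"
    by (rule L2_sum) (auto intro: G_L2)
  show D_L2: "D \<in> L2 Q"
    unfolding D[abs_def] by (intro L2_scale L2_diff Z_L2 GG_L2)
  have Z_le: "l2_inner Q Z Z \<le> lam k / real m * (6/5 * \<sigma>\<^sup>2 + K * energy (R (residual \<phi> \<theta> n')))"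
    using dev_psi_moment[OF A(1) ortho kur(1) k T2(1-3), of 1] res[of k]
    by (simp add: Z_def T2(4) K_def)
  \<comment> \<open>The factor \<open>(lam j)\<^sup>2\<close> is isolated because it cancels the
    squared divisor coming from the pilot.\<close>
  have G_le: "l2_inner Q (G j) (G j) \<le> (lam j)\<^sup>2 * (lam k * K * (6/5 * \<sigma>\<^sup>2 + K * energy (R \<phi>)) / (real m)\<^sup>2)"
    if j: "j \<in> {1..n'}" for j
  proof -
    have j1: "1 \<le> j" using j by simp
    have "l2_inner Q (G j) (G j) =
        l2_inner Q (dev A 1 (R \<phi>) (R (\<psi> j)) T1) (dev A 1 (R \<phi>) (R (\<psi> j)) T1) *
        l2_inner Q (dev A 0 (R (\<psi> j)) (R (\<psi> k)) T2) (dev A 0 (R (\<psi> j)) (R (\<psi> k)) T2)"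
      unfolding l2_inner_self[of Q "G j"] unfolding G_def
      by (rule dev_prod_moment[OF A(1) ortho kur(2) kurtosis_R_psi[OF j1] kurtosis_R_psi[OF j1] kur(3)
        T1(1-3) T2(1-3) T12])
    also have "\<dots> \<le> (lam j / real m * (6/5 * \<sigma>\<^sup>2 + K * energy (R \<phi>))) * (lam k / real m * (K * lam j))"
    proof (rule mult_mono)
      show "l2_inner Q (dev A 1 (R \<phi>) (R (\<psi> j)) T1) (dev A 1 (R \<phi>) (R (\<psi> j)) T1)
          \<le> lam j / real m * (6/5 * \<sigma>\<^sup>2 + K * energy (R \<phi>))"
        using dev_psi_moment[OF A(1) ortho kur(2) j1 T1(1-3), of 1] res[of j] j
        by (simp add: T1(4) K_def)
      \<comment> \<open>With \<open>c = 0\<close> there is no noise term, and the energy of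
        \<open>R (\<psi> j)\<close> is \<open>lam j\<close>.\<close>
      show "l2_inner Q (dev A 0 (R (\<psi> j)) (R (\<psi> k)) T2) (dev A 0 (R (\<psi> j)) (R (\<psi> k)) T2)
          \<le> lam k / real m * (K * lam j)"
        using dev_psi_moment[OF A(1) ortho kurtosis_R_psi[OF j1] k T2(1-3), of 0] res[of k]
        by (simp add: T2(4) K_def energy_R_psi[OF j1])
      show "0 \<le> lam j / real m * (6/5 * \<sigma>\<^sup>2 + K * energy (R \<phi>))"
        using lam_pos[OF j1] K energy_nonneg[of "R \<phi>"] by simp
    qed (rule l2_inner_self_nonneg)
    also have "\<dots> = (lam j)\<^sup>2 * (lam k * K * (6/5 * \<sigma>\<^sup>2 + K * energy (R \<phi>)) / (real m)\<^sup>2)"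
      by (simp add: power2_eq_square)
    finally show ?thesis .
  qed
  have sq: "(D \<omega>)\<^sup>2 \<le> (1 / (lam k)\<^sup>2) * (6/5 * (Z \<omega>)\<^sup>2 + 6 * (real n' * (\<Sum>j=1..n'. (1 / (lam j)\<^sup>2) * (G j \<omega>)\<^sup>2)))" for \<omega>
  proof -
    have young: "(s - t)\<^sup>2 \<le> 6/5 * s\<^sup>2 + 6 * t\<^sup>2" for s t :: real
    proof -
      have "0 \<le> (s + 5 * t)\<^sup>2 / 5" by simp
      then show ?thesis by (simp add: power2_eq_square algebra_simps)
    qed
    \<comment> \<open>Cauchy-Schwarz costs one factor \<open>n'\<close>; adding up the
      \<open>n'\<close> equal bounds gives the second.\<close>
    have "(\<Sum>j=1..n'. (1 / lam j) * G j \<omega>)\<^sup>2 \<le> (\<Sum>j=1..n'. ((1 / lam j) * G j \<omega>)\<^sup>2) * card {1..n'}"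
      by (rule sum_squared_le_sum_of_squares)
    also have "\<dots> = real n' * (\<Sum>j=1..n'. (1 / (lam j)\<^sup>2) * (G j \<omega>)\<^sup>2)"
      by (simp add: power_mult_distrib power_divide)
    finally have "6/5 * (Z \<omega>)\<^sup>2 + 6 * (\<Sum>j=1..n'. (1 / lam j) * G j \<omega>)\<^sup>2 \<le>
        6/5 * (Z \<omega>)\<^sup>2 + 6 * (real n' * (\<Sum>j=1..n'. (1 / (lam j)\<^sup>2) * (G j \<omega>)\<^sup>2))" by simp
    with young[of "Z \<omega>" "\<Sum>j=1..n'. (1 / lam j) * G j \<omega>"]
    have "(Z \<omega> - (\<Sum>j=1..n'. (1 / lam j) * G j \<omega>))\<^sup>2 \<le>
        6/5 * (Z \<omega>)\<^sup>2 + 6 * (real n' * (\<Sum>j=1..n'. (1 / (lam j)\<^sup>2) * (G j \<omega>)\<^sup>2))" by linarith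
    then show ?thesis
      unfolding D power_mult_distrib power_one_over by (intro mult_left_mono) auto
  qed
  have int: "integrable Q (\<lambda>\<omega>. (Z \<omega>)\<^sup>2)" "\<And>j. j \<in> {1..n'} \<Longrightarrow> integrable Q (\<lambda>\<omega>. (G j \<omega>)\<^sup>2)"
    using Z_L2 G_L2 by (auto simp: L2_def)
  define S where "S = (\<lambda>\<omega>. \<Sum>j=1..n'. (1 / (lam j)\<^sup>2) * (G j \<omega>)\<^sup>2)"
  have S: "integrable Q S" "Q.expectation S = (\<Sum>j=1..n'. (1 / (lam j)\<^sup>2) * l2_inner Q (G j) (G j))"
  proof -
    have *: "integrable Q (\<lambda>\<omega>. (1 / (lam j)\<^sup>2) * (G j \<omega>)\<^sup>2)" if "j \<in> {1..n'}" for j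
      by (intro integrable_mult_right int that)
    then show "integrable Q S" unfolding S_def by (rule Bochner_Integration.integrable_sum)
    show "Q.expectation S = (\<Sum>j=1..n'. (1 / (lam j)\<^sup>2) * l2_inner Q (G j) (G j))"
      unfolding S_def by (rule trans[OF Bochner_Integration.integral_sum[OF *]]) (simp_all add: l2_inner_self)
  qed
  have "l2_inner Q D D \<le> Q.expectation (\<lambda>\<omega>. (1 / (lam k)\<^sup>2) * (6/5 * (Z \<omega>)\<^sup>2 + 6 * (real n' * S \<omega>)))"
    unfolding l2_inner_self
  proof (rule integral_mono)
    show "integrable Q (\<lambda>\<omega>. (D \<omega>)\<^sup>2)" using D_L2 by (simp add: L2_def)
    show "integrable Q (\<lambda>\<omega>. (1 / (lam k)\<^sup>2) * (6/5 * (Z \<omega>)\<^sup>2 + 6 * (real n' * S \<omega>)))"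
      by (intro integrable_mult_right Bochner_Integration.integrable_add int S)
  qed (use sq in \<open>simp add: S_def\<close>)
  also have "\<dots> = (1 / (lam k)\<^sup>2) * (6/5 * l2_inner Q Z Z + 6 * (real n' * Q.expectation S))"
    using int(1) S(1) by (simp add: l2_inner_self)
  also have "\<dots> = (1 / (lam k)\<^sup>2) * (6/5 * l2_inner Q Z Z +
      6 * (real n' * (\<Sum>j=1..n'. (1 / (lam j)\<^sup>2) * l2_inner Q (G j) (G j))))"
    by (simp only: S(2))
  also have "\<dots> \<le> (1 / (lam k)\<^sup>2) *
      (6/5 * (lam k / real m * (6/5 * \<sigma>\<^sup>2 + K * energy (R (residual \<phi> \<theta> n')))) +
      6 * (real n' * (\<Sum>j=1..n'. lam k * K * (6/5 * \<sigma>\<^sup>2 + K * energy (R \<phi>)) / (real m)\<^sup>2)))"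
  proof (intro mult_left_mono add_mono sum_mono Z_le)
    fix j assume j: "j \<in> {1..n'}"
    then have "0 < lam j" using lam_pos[of j] by simp
    then show "1 / (lam j)\<^sup>2 * l2_inner Q (G j) (G j) \<le>
        lam k * K * (6/5 * \<sigma>\<^sup>2 + K * energy (R \<phi>)) / (real m)\<^sup>2"
      using G_le[OF j] by (simp add: divide_le_eq mult.commute)
  qed auto
  also have "\<dots> = 1 / (lam k * real m) *
      (6/5 * (6/5 * \<sigma>\<^sup>2 + K * energy (R (residual \<phi> \<theta> n')))
       + 6 * (real n')\<^sup>2 * K * (6/5 * \<sigma>\<^sup>2 + K * energy (R \<phi>)) / real m)"
  proof -
    have "(1 / s\<^sup>2) * (6/5 * (s / t * v) + 6 * (w * (w * (s * K * z / t\<^sup>2)))) =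
        1 / (s * t) * (6/5 * v + 6 * w\<^sup>2 * K * z / t)" if "s \<noteq> 0" "t \<noteq> 0" for s t v w z :: real
      using that by (simp add: field_simps power2_eq_square)
    from this[of "lam k" "real m"] show ?thesis using lam_pos[OF k] m(1) by simp
  qed
  finally show "l2_inner Q D D \<le> 1 / (lam k * real m) *
      (6/5 * (6/5 * \<sigma>\<^sup>2 + K * energy (R (residual \<phi> \<theta> n')))
       + 6 * (real n')\<^sup>2 * K * (6/5 * \<sigma>\<^sup>2 + K * energy (R \<phi>)) / real m)" .
qed

text \<open>The constant \<open>3/2\<close> is \<open>(6/5)\<^sup>2 + 3/100 + 3/100\<close>: two uses of \<open>(s + t)\<^sup>2 \<le> 6/5 s\<^sup>2 + 6 t\<^sup>2\<close>, then the
  tail beyond the pilot dimension, then the pilot error.\<close>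

lemma estimator_risk:
  assumes phi: "\<phi> \<in> sobolev_ball \<rho> lam \<psi> \<beta> L"
    and A: "finite A" "A \<subseteq> I" and m: "1 \<le> m" "2 * m \<le> M"
    and res: "\<And>j. 1 \<le> j \<Longrightarrow> j \<le> max n n' \<Longrightarrow>
      energy (\<lambda>x. R (\<psi> j) x - coord_proj y A (R (\<psi> j) x)) \<le> lam j / real m"
    and pilot_dim: "6/5 * (6 * \<kappa> + 1) * (lam (Suc n') * (lam 1 powr \<beta> * L\<^sup>2)) \<le> 3/100 * \<sigma>\<^sup>2"
    and sample_size: "6 * (real n')\<^sup>2 * (6 * \<kappa> + 1) *
      (6/5 * \<sigma>\<^sup>2 + (6 * \<kappa> + 1) * (lam 1 * (lam 1 powr \<beta> * L\<^sup>2))) / real m \<le> 3/100 * \<sigma>\<^sup>2"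
    and c: "0 \<le> c"
  shows "(\<integral>\<^sup>+\<omega>. ennreal (c * (l2_norm \<rho> (\<lambda>x. (\<Sum>k=1..n. refined A m n' k (obs \<phi> M \<omega>) * \<psi> k x) - \<phi> x))\<^sup>2) \<partial>Q)
    \<le> ennreal (c * (3/2 * \<sigma>\<^sup>2 / real m * (\<Sum>k=1..n. 1 / lam k) + lam (Suc n) powr \<beta> * L\<^sup>2))"
proof -
  obtain \<theta> where \<theta>: "\<phi> \<in> L2 \<rho>" "l2_expansion \<rho> \<psi> \<theta> \<phi>"
    using sobolev_ballE[OF phi] by metis
  have space: "\<phi> \<in> sobolev_space \<rho> lam \<psi> \<beta>" using phi sobolev_ball_subset_space by blast
  define K where "K = 6 * \<kappa> + 1"
  have K: "0 \<le> K" using kappa by (simp add: K_def)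
  define D where "D k = (\<lambda>\<omega>. refined A m n' k (obs \<phi> M \<omega>) - \<theta> k)" for k
  have D_L2: "D k \<in> L2 Q" and D_le: "l2_inner Q (D k) (D k) \<le> 3/2 * \<sigma>\<^sup>2 / real m * (1 / lam k)"
    if k: "k \<in> {1..n}" for k
  proof -
    have k1: "1 \<le> k" using k by simp
    have res': "energy (\<lambda>x. R (\<psi> j) x - coord_proj y A (R (\<psi> j) x)) \<le> lam j / real m"
      if "j \<in> insert k {1..n'}" for j
      using that k by (intro res) auto
    show "D k \<in> L2 Q" unfolding D_def by (rule refined_risk_L2[OF space \<theta>(2) A m k1 res'])
    have "l2_inner Q (D k) (D k) \<le> 1 / (lam k * real m) *
      (6/5 * (6/5 * \<sigma>\<^sup>2 + K * energy (R (residual \<phi> \<theta> n')))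
       + 6 * (real n')\<^sup>2 * K * (6/5 * \<sigma>\<^sup>2 + K * energy (R \<phi>)) / real m)"
      unfolding D_def K_def by (rule refined_risk_le[OF space \<theta>(2) A m k1 res'])
    also have "\<dots> \<le> 1 / (lam k * real m) * (3/2 * \<sigma>\<^sup>2)"
    proof (rule mult_left_mono)
      have "6/5 * (K * energy (R (residual \<phi> \<theta> n'))) \<le> 6/5 * (K * (lam (Suc n') * (lam 1 powr \<beta> * L\<^sup>2)))"
        by (intro mult_left_mono ball_energy[OF phi \<theta>(2)] K) auto
      also have "\<dots> \<le> 3/100 * \<sigma>\<^sup>2" using pilot_dim by (simp only: K_def mult.assoc)
      finally have 1: "6/5 * (K * energy (R (residual \<phi> \<theta> n'))) \<le> 3/100 * \<sigma>\<^sup>2" .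
      \<comment> \<open>The residual at \<open>n = 0\<close> is \<open>\<phi>\<close>
        itself.\<close>
      have "energy (R \<phi>) \<le> lam 1 * (lam 1 powr \<beta> * L\<^sup>2)"
        using ball_energy(1)[OF phi \<theta>(2), of 0] by (simp add: One_nat_def)
      then have "6 * (real n')\<^sup>2 * K * (6/5 * \<sigma>\<^sup>2 + K * energy (R \<phi>)) / real m \<le>
          6 * (real n')\<^sup>2 * K * (6/5 * \<sigma>\<^sup>2 + K * (lam 1 * (lam 1 powr \<beta> * L\<^sup>2))) / real m"
        using K by (intro divide_right_mono mult_left_mono add_left_mono) auto
      also have "\<dots> \<le> 3/100 * \<sigma>\<^sup>2" using sample_size by (simp add: K_def)
      finally show "6/5 * (6/5 * \<sigma>\<^sup>2 + K * energy (R (residual \<phi> \<theta> n')))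
         + 6 * (real n')\<^sup>2 * K * (6/5 * \<sigma>\<^sup>2 + K * energy (R \<phi>)) / real m \<le> 3/2 * \<sigma>\<^sup>2"
        using 1 unfolding distrib_left by linarith
      show "0 \<le> 1 / (lam k * real m)" using lam_pos[OF k1] by simp
    qed
    finally show "l2_inner Q (D k) (D k) \<le> 3/2 * \<sigma>\<^sup>2 / real m * (1 / lam k)"
      by (simp add: mult_ac)
  qed
  define t where "t = (l2_norm \<rho> (residual \<phi> \<theta> n))\<^sup>2"
  have loss: "(l2_norm \<rho> (\<lambda>x. (\<Sum>k=1..n. refined A m n' k (obs \<phi> M \<omega>) * \<psi> k x) - \<phi> x))\<^sup>2
      = (\<Sum>k=1..n. (D k \<omega>)\<^sup>2) + t" for \<omega>
  proof -
    have "(l2_norm \<rho> (\<lambda>x. (\<Sum>k=1..n. refined A m n' k (obs \<phi> M \<omega>) * \<psi> k x) - \<phi> x))\<^sup>2 =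
      (l2_norm \<rho> (\<lambda>x. \<phi> x - (\<Sum>k=1..n. refined A m n' k (obs \<phi> M \<omega>) * \<psi> k x)))\<^sup>2"
      by (simp add: l2_norm_power2 l2_inner_self power2_commute)
    then show ?thesis
      using norm_diff_comb[OF \<theta>, where c="\<lambda>k. refined A m n' k (obs \<phi> M \<omega>)" and n=n]
      by (simp add: D_def t_def)
  qed
  have int: "integrable Q (\<lambda>\<omega>. (D k \<omega>)\<^sup>2)" if "k \<in> {1..n}" for k
    using D_L2[OF that] by (simp add: L2_def)
  have t: "0 \<le> t" "t \<le> lam (Suc n) powr \<beta> * L\<^sup>2"
    using ball_energy(2)[OF phi \<theta>(2)] by (simp_all add: t_def)
  have "(\<integral>\<^sup>+\<omega>. ennreal (c * ((\<Sum>k=1..n. (D k \<omega>)\<^sup>2) + t)) \<partial>Q)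
      = ennreal (Q.expectation (\<lambda>\<omega>. c * ((\<Sum>k=1..n. (D k \<omega>)\<^sup>2) + t)))"
    by (rule nn_integral_eq_integral)
      (use int t c in \<open>auto intro!: Bochner_Integration.integrable_sum mult_nonneg_nonneg add_nonneg_nonneg sum_nonneg\<close>)
  also have "Q.expectation (\<lambda>\<omega>. c * ((\<Sum>k=1..n. (D k \<omega>)\<^sup>2) + t)) =
      c * ((\<Sum>k=1..n. l2_inner Q (D k) (D k)) + t)"
  proof -
    have "integrable Q (\<lambda>\<omega>. \<Sum>k=1..n. (D k \<omega>)\<^sup>2)"
      using int by (rule Bochner_Integration.integrable_sum)
    then have "Q.expectation (\<lambda>\<omega>. c * ((\<Sum>k=1..n. (D k \<omega>)\<^sup>2) + t)) =
        c * (Q.expectation (\<lambda>\<omega>. \<Sum>k=1..n. (D k \<omega>)\<^sup>2) + t)"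
      by (simp add: Q.prob_space)
    also have "Q.expectation (\<lambda>\<omega>. \<Sum>k=1..n. (D k \<omega>)\<^sup>2) = (\<Sum>k=1..n. l2_inner Q (D k) (D k))"
      unfolding l2_inner_self using int by (rule Bochner_Integration.integral_sum)
    finally show ?thesis .
  qed
  also have "ennreal \<dots> \<le> ennreal (c * ((\<Sum>k=1..n. 3/2 * \<sigma>\<^sup>2 / real m * (1 / lam k)) + lam (Suc n) powr \<beta> * L\<^sup>2))"
    by (intro ennreal_leI mult_left_mono add_mono sum_mono D_le t c)
  finally show ?thesis unfolding loss by (simp only: sum_distrib_left)
qed

lemma sigma_pos: "0 < \<sigma>"
  using noise_moments by (simp add: noise_B1_def)

text \<open>The order of choices matters: first \<open>n'\<close> from the decay of
  \<open>lam\<close>, then \<open>M0\<close> to absorb the pilot error, and only then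
  \<open>J\<close>, which depends on \<open>M\<close> and \<open>n\<close>. So \<open>M0\<close> is
  independent of \<open>n\<close> and \<open>\<gamma>\<close>.\<close>

lemma minimax_bound:
  "\<exists>M0>0. \<forall>M\<ge>M0. \<forall>n \<gamma>. scaled_minimax_risk \<rho> R I y Q us es (sobolev_ball \<rho> lam \<psi> \<beta> L) \<gamma> M \<le>
    ennreal (real M powr \<gamma> * (4 * \<sigma>\<^sup>2 / real M * (\<Sum>k=1..n. 1 / lam k) + lam (Suc n) powr \<beta> * L\<^sup>2))"
proof -
  have "(\<lambda>n. 6/5 * (6 * \<kappa> + 1) * (lam (Suc n) * (lam 1 powr \<beta> * L\<^sup>2)))
      \<longlonglongrightarrow> 6/5 * (6 * \<kappa> + 1) * (0 * (lam 1 powr \<beta> * L\<^sup>2))"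
    by (intro tendsto_intros LIMSEQ_Suc lam_tendsto)
  then have "\<forall>\<^sub>F n in sequentially. 6/5 * (6 * \<kappa> + 1) * (lam (Suc n) * (lam 1 powr \<beta> * L\<^sup>2)) < 3/100 * \<sigma>\<^sup>2"
    by (rule order_tendstoD(2)) (use sigma_pos in simp)
  from eventually_happens'[OF sequentially_bot this]
  obtain n' where "6/5 * (6 * \<kappa> + 1) * (lam (Suc n') * (lam 1 powr \<beta> * L\<^sup>2)) < 3/100 * \<sigma>\<^sup>2"
    by blast
  note n' = less_imp_le[OF this]
  define E where "E = 6 * (real n')\<^sup>2 * (6 * \<kappa> + 1) *
      (6/5 * \<sigma>\<^sup>2 + (6 * \<kappa> + 1) * (lam 1 * (lam 1 powr \<beta> * L\<^sup>2)))"
  obtain m0 :: nat where m0: "E / (3/100 * \<sigma>\<^sup>2) \<le> real m0" using real_arch_simple by blast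
  show ?thesis
  \<comment> \<open>This ensures \<open>m0 \<le> m\<close>. The \<open>4\<close> controls rounding:
    for \<open>M\<close> at least \<open>4\<close>, halving gives \<open>3 * M \<le> 8 * m\<close>,
    which turns \<open>3/2\<close> over \<open>m\<close> into \<open>4\<close> over
    \<open>M\<close>.\<close>
  proof (intro exI[of _ "2 * m0 + 4"] conjI allI impI)
    fix M n \<gamma> assume M: "2 * m0 + 4 \<le> M"
    define m where "m = M div 2"
    have m: "1 \<le> m" "2 * m \<le> M" "m0 \<le> m" "3 * M \<le> 8 * m" using M by (auto simp: m_def)
    have "E / (3/100 * \<sigma>\<^sup>2) \<le> real m" using m0 m(3) by linarith
    then have sample_size: "E / real m \<le> 3/100 * \<sigma>\<^sup>2"
      using sigma_pos m(1) by (simp add: field_simps)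
    have "\<forall>\<^sub>F J in sequentially. energy (\<lambda>x. R (\<psi> j) x - coord_proj y (I \<inter> {1..J}) (R (\<psi> j) x)) < lam j / real m"
      if "1 \<le> j" for j
      using energy_residual_tendsto[OF y_onb kurtosis_R_psi[OF that]]
      by (rule order_tendstoD(2)) (use lam_pos[OF that] m(1) in simp)
    \<comment> \<open>Only finitely many eigenfunctions enter, so one \<open>J\<close> serves them
      all.\<close>
    then have "\<forall>\<^sub>F J in sequentially. \<forall>j\<in>{1..max n n'}.
        energy (\<lambda>x. R (\<psi> j) x - coord_proj y (I \<inter> {1..J}) (R (\<psi> j) x)) < lam j / real m"
      by (intro eventually_ball_finite ballI) auto
    from eventually_happens'[OF sequentially_bot this]
    obtain J where "\<forall>j\<in>{1..max n n'}.
        energy (\<lambda>x. R (\<psi> j) x - coord_proj y (I \<inter> {1..J}) (R (\<psi> j) x)) < lam j / real m"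
      by blast
    then have J: "energy (\<lambda>x. R (\<psi> j) x - coord_proj y (I \<inter> {1..J}) (R (\<psi> j) x)) \<le> lam j / real m"
      if "1 \<le> j" "j \<le> max n n'" for j
      using that by (intro less_imp_le) simp
    define A where "A = I \<inter> {1..J}"
    have A: "finite A" "A \<subseteq> I" by (auto simp: A_def)
    define est where "est = (\<lambda>d x. \<Sum>k=1..n. refined A m n' k d * \<psi> k x)"
    have est: "est \<in> estimators \<rho> I M"
      unfolding est_def estimators_def
      by (intro comb_measurable_l2_borel refined_measurable A m(2))
    have "3/2 * \<sigma>\<^sup>2 / real m \<le> 4 * \<sigma>\<^sup>2 / real M"
    proof -
      have "3 * real M \<le> 8 * real m" using m(4) by linarith
      then have "\<sigma>\<^sup>2 * (3 * real M) \<le> \<sigma>\<^sup>2 * (8 * real m)" by (intro mult_left_mono) auto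
      then show ?thesis using m(1) M by (simp add: field_simps)
    qed
    moreover have "0 \<le> (\<Sum>k=1..n. 1 / lam k)"
      using lam_pos by (intro sum_nonneg) (auto intro: less_imp_le)
    ultimately have le: "real M powr \<gamma> * (3/2 * \<sigma>\<^sup>2 / real m * (\<Sum>k=1..n. 1 / lam k) + lam (Suc n) powr \<beta> * L\<^sup>2)
      \<le> real M powr \<gamma> * (4 * \<sigma>\<^sup>2 / real M * (\<Sum>k=1..n. 1 / lam k) + lam (Suc n) powr \<beta> * L\<^sup>2)"
      by (intro mult_left_mono add_right_mono mult_right_mono) auto
    show "scaled_minimax_risk \<rho> R I y Q us es (sobolev_ball \<rho> lam \<psi> \<beta> L) \<gamma> M \<le>
      ennreal (real M powr \<gamma> * (4 * \<sigma>\<^sup>2 / real M * (\<Sum>k=1..n. 1 / lam k) + lam (Suc n) powr \<beta> * L\<^sup>2))"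
      unfolding scaled_minimax_risk_def
    proof (rule INF_lower2[OF est], rule SUP_least)
      fix \<phi> assume phi: "\<phi> \<in> sobolev_ball \<rho> lam \<psi> \<beta> L"
      show "(\<integral>\<^sup>+\<omega>. ennreal (real M powr \<gamma> * (l2_norm \<rho> (\<lambda>x. est (data R I y us es \<phi> M \<omega>) x - \<phi> x))\<^sup>2) \<partial>Q)
        \<le> ennreal (real M powr \<gamma> * (4 * \<sigma>\<^sup>2 / real M * (\<Sum>k=1..n. 1 / lam k) + lam (Suc n) powr \<beta> * L\<^sup>2))"
        unfolding est_def
        by (rule order_trans[OF estimator_risk[OF phi A m(1,2) J[folded A_def] n' sample_size[unfolded E_def]]
          ennreal_leI[OF le]]) auto
    qed
  qed auto
qed

section \<open>Rates\<close>

text \<open>\<open>n\<close> may vary with \<open>M\<close>, since the threshold of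
  \<open>minimax_bound\<close> does not depend on it.\<close>

lemma limsup_minimax_le:
  assumes "\<And>M. 0 < M \<Longrightarrow> \<exists>n. real M powr \<gamma> *
    (4 * \<sigma>\<^sup>2 / real M * (\<Sum>k=1..n. 1 / lam k) + lam (Suc n) powr \<beta> * L\<^sup>2) \<le> C"
  shows "limsup (scaled_minimax_risk \<rho> R I y Q us es (sobolev_ball \<rho> lam \<psi> \<beta> L) \<gamma>) \<le> ennreal C"
proof -
  obtain M0 where M0: "M0 > 0" "\<And>M n \<gamma>. M0 \<le> M \<Longrightarrow>
    scaled_minimax_risk \<rho> R I y Q us es (sobolev_ball \<rho> lam \<psi> \<beta> L) \<gamma> M \<le>
    ennreal (real M powr \<gamma> * (4 * \<sigma>\<^sup>2 / real M * (\<Sum>k=1..n. 1 / lam k) + lam (Suc n) powr \<beta> * L\<^sup>2))"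
    using minimax_bound by metis
  show ?thesis
  proof (rule Limsup_bounded, rule eventually_sequentiallyI[of M0])
    fix M assume M: "M0 \<le> M"
    with M0(1) have "0 < M" by simp
    from assms[OF this] obtain n where n: "real M powr \<gamma> *
      (4 * \<sigma>\<^sup>2 / real M * (\<Sum>k=1..n. 1 / lam k) + lam (Suc n) powr \<beta> * L\<^sup>2) \<le> C" by blast
    show "scaled_minimax_risk \<rho> R I y Q us es (sobolev_ball \<rho> lam \<psi> \<beta> L) \<gamma> M \<le> ennreal C"
      by (rule order_trans[OF M0(2)[OF M] ennreal_leI[OF n]])
  qed
qed

end

text \<open>\<open>X\<close> is the solution of \<open>X powr (p + s) = M * B / c0\<close>, where a
  variance growing like \<open>X powr s\<close> meets a squared bias falling like
  \<open>X powr (- p)\<close>. Rescaled by the rate, the common value is free of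
  \<open>M\<close>.\<close>

lemma balance:
  fixes M B c0 p s :: real
  assumes "0 < M" "0 < B" "0 < c0" "0 < p" "0 < s"
  defines "X \<equiv> (M * B / c0) powr (1 / (p + s))"
  shows "c0 / M * X powr s = B * X powr (- p)"
    and "M powr (p / (p + s)) * (B * X powr (- p)) = c0 powr (p / (p + s)) * B powr (s / (p + s))"
proof -
  have pos: "0 < M * B / c0" using assms by simp
  then have X: "0 < X" unfolding X_def by (metis powr_gt_zero less_irrefl)
  have "1 / (p + s) * (p + s) = 1" using assms(4,5) by simp
  then have "X powr (p + s) = M * B / c0"
    using pos by (simp only: X_def powr_powr powr_one less_imp_le)
  have "X powr s = X powr (p + s) * X powr (- p)"
    by (simp add: powr_add[symmetric])
  then have "c0 / M * X powr s = c0 / M * (X powr (p + s) * X powr (- p))"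
    by (rule arg_cong)
  also have "\<dots> = B * X powr (- p)"
    unfolding \<open>X powr (p + s) = M * B / c0\<close> using assms by simp
  finally show "c0 / M * X powr s = B * X powr (- p)" .
  have e: "1 - p / (p + s) = s / (p + s)" using assms by (simp add: field_simps)
  have "X powr (- p) = (M * B / c0) powr (- (p / (p + s)))"
    by (simp add: X_def powr_powr)
  also have "\<dots> = M powr (- (p / (p + s))) * B powr (- (p / (p + s))) / c0 powr (- (p / (p + s)))"
    using assms by (simp add: powr_divide powr_mult)
  finally have Xp: "X powr (- p) = M powr (- (p / (p + s))) * B powr (- (p / (p + s))) * c0 powr (p / (p + s))"
    by (simp add: powr_minus field_simps)
  have "M powr (p / (p + s)) * (B * X powr (- p)) =
      (M powr (p / (p + s)) * M powr (- (p / (p + s)))) * (B powr 1 * B powr (- (p / (p + s)))) * c0 powr (p / (p + s))"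
    unfolding Xp using assms by simp
  also have "\<dots> = B powr (s / (p + s)) * c0 powr (p / (p + s))"
    using assms unfolding powr_add[symmetric] by (simp add: e)
  finally show "M powr (p / (p + s)) * (B * X powr (- p)) = c0 powr (p / (p + s)) * B powr (s / (p + s))"
    by (simp add: mult.commute)
qed

text \<open>Each of the \<open>n\<close> reciprocals is at most \<open>X powr (2 * r) / a\<close>,
  so the variance grows like \<open>X powr (2 * r + 1)\<close>; hence \<open>s = 2 * r + 1\<close>,
  while the bias gives \<open>p = 2 * \<beta> * r\<close>.\<close>

lemma polynomial_tradeoff:
  fixes lam :: "nat \<Rightarrow> real"
  assumes decay: "polynomial_decay lam a b r" and "0 < \<beta>" "0 < L" "0 < \<sigma>" and M: "0 < M"
    and pos: "\<And>k. 1 \<le> k \<Longrightarrow> 0 < lam k"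
  shows "\<exists>n. real M powr (2 * \<beta> * r / (2 * \<beta> * r + 2 * r + 1)) *
    (4 * \<sigma>\<^sup>2 / real M * (\<Sum>k=1..n. 1 / lam k) + lam (Suc n) powr \<beta> * L\<^sup>2)
    \<le> 3 * (2 * \<sigma>\<^sup>2 / a) powr (2 * \<beta> * r / (2 * \<beta> * r + 2 * r + 1))
          * (b powr \<beta> * L\<^sup>2) powr ((2 * r + 1) / (2 * \<beta> * r + 2 * r + 1))"
proof -
  have r: "0 < r" and a: "0 < a" and b: "0 < b"
    and lower: "\<And>k. 1 \<le> k \<Longrightarrow> a * real k powr (- 2 * r) \<le> lam k"
    and upper: "\<And>k. 1 \<le> k \<Longrightarrow> lam k \<le> b * real k powr (- 2 * r)"
    using decay by (auto simp: polynomial_decay_def)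
  define p where "p = 2 * \<beta> * r"
  define s where "s = 2 * r + 1"
  define B where "B = b powr \<beta> * L\<^sup>2"
  \<comment> \<open>Half the variance coefficient \<open>4 * \<sigma>\<^sup>2 / a\<close>: the
    variance is then at most twice the balanced value, and the bias adds one more, for the constant
    \<open>3\<close>.\<close>
  define c0 where "c0 = 2 * \<sigma>\<^sup>2 / a"
  have [simp]: "0 < real M" "0 < B" "0 < c0" "0 < p" "0 < s"
    using assms r a b by (auto simp: p_def s_def B_def c0_def)
  define X where "X = (real M * B / c0) powr (1 / (p + s))"
  note bal = balance[of "real M" B c0 p s, folded X_def]
  have "0 < real M * B / c0" using M by simp
  then have X: "0 < X" unfolding X_def by (metis powr_gt_zero less_irrefl)
  \<comment> \<open>Rounding down serves both sides: \<open>n \<le> X\<close> bounds the variance,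
    \<open>X \<le> Suc n\<close> the bias.\<close>
  define n where "n = nat \<lfloor>X\<rfloor>"
  have n: "real n \<le> X" "X \<le> real (Suc n)" using X by (auto simp: n_def) linarith+
  have "lam (Suc n) powr \<beta> * L\<^sup>2 \<le> (b * X powr (- 2 * r)) powr \<beta> * L\<^sup>2"
  proof (intro mult_right_mono powr_mono2)
    have "lam (Suc n) \<le> b * real (Suc n) powr (- 2 * r)" by (rule upper) simp
    also have "\<dots> \<le> b * X powr (- 2 * r)"
      using n(2) X r b by (intro mult_left_mono powr_mono2') auto
    finally show "lam (Suc n) \<le> b * X powr (- 2 * r)" .
  qed (use assms less_imp_le[OF pos[of "Suc n"]] in auto)
  also have "\<dots> = B * X powr (- p)"
    using b by (simp add: powr_mult powr_powr B_def p_def mult_ac)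
  finally have bias: "lam (Suc n) powr \<beta> * L\<^sup>2 \<le> B * X powr (- p)" .
  have "(\<Sum>k=1..n. 1 / lam k) \<le> (\<Sum>k=1..n. X powr (2 * r) / a)"
  proof (rule sum_mono)
    fix k assume k: "k \<in> {1..n}"
    have "1 / lam k \<le> 1 / (a * real k powr (- 2 * r))"
      using lower[of k] a k by (intro divide_left_mono mult_pos_pos pos) auto
    also have "\<dots> = real k powr (2 * r) / a" by (simp add: powr_minus field_simps)
    also have "\<dots> \<le> X powr (2 * r) / a"
      using k n(1) r a by (intro divide_right_mono powr_mono2) auto
    finally show "1 / lam k \<le> X powr (2 * r) / a" .
  qed
  also have "\<dots> = real n * X powr (2 * r) / a" by simp
  also have "\<dots> \<le> X * X powr (2 * r) / a"
    using n(1) a by (intro divide_right_mono mult_right_mono) auto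
  also have "\<dots> = X powr s / a" using X by (simp add: s_def powr_add)
  finally have "4 * \<sigma>\<^sup>2 / real M * (\<Sum>k=1..n. 1 / lam k) \<le> 4 * \<sigma>\<^sup>2 / real M * (X powr s / a)"
    by (intro mult_left_mono) auto
  also have "\<dots> = 2 * (c0 / real M * X powr s)" by (simp add: c0_def field_simps)
  also have "\<dots> = 2 * (B * X powr (- p))" using bal(1) M by simp
  finally have "4 * \<sigma>\<^sup>2 / real M * (\<Sum>k=1..n. 1 / lam k) + lam (Suc n) powr \<beta> * L\<^sup>2 \<le> 3 * (B * X powr (- p))"
    using bias by linarith
  then have "real M powr (p / (p + s)) *
      (4 * \<sigma>\<^sup>2 / real M * (\<Sum>k=1..n. 1 / lam k) + lam (Suc n) powr \<beta> * L\<^sup>2)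
    \<le> real M powr (p / (p + s)) * (3 * (B * X powr (- p)))"
    by (intro mult_left_mono) auto
  also have "\<dots> = 3 * c0 powr (p / (p + s)) * B powr (s / (p + s))" using bal(2) M by simp
  finally show ?thesis
    unfolding p_def s_def B_def c0_def by (auto simp: add.assoc)
qed

lemma sum_exp:
  fixes r :: real
  assumes "0 < r"
  shows "(\<Sum>k=1..n. exp (r * real k)) = exp r / (exp r - 1) * (exp (r * real n) - 1)"
proof (induction n)
  case 0
  then show ?case by simp
next
  case (Suc n)
  have "exp r - 1 \<noteq> 0" using assms by simp
  moreover have "exp (r * real (Suc n)) = exp r * exp (r * real n)"
    by (simp add: exp_add[symmetric] algebra_simps)
  ultimately show ?case using Suc by (simp add: field_simps)
qed

text \<open>The reciprocals form a geometric sum comparable to its last term, at most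
  \<open>exp r / (exp r - 1) * X / a\<close> with \<open>X = exp (r * x)\<close> at the real cutoff
  \<open>x\<close>. So the variance is linear in \<open>X\<close>, balanced with
  \<open>s = 1\<close> and \<open>p = \<beta>\<close>; variance and bias each contribute one
  balanced value, for the constant \<open>2\<close>.\<close>

lemma exponential_tradeoff:
  fixes lam :: "nat \<Rightarrow> real"
  assumes decay: "exponential_decay lam a b r" and "0 < \<beta>" "0 < L" "0 < \<sigma>" and M: "0 < M"
    and pos: "\<And>k. 1 \<le> k \<Longrightarrow> 0 < lam k"
  shows "\<exists>n. real M powr (\<beta> / (\<beta> + 1)) *
    (4 * \<sigma>\<^sup>2 / real M * (\<Sum>k=1..n. 1 / lam k) + lam (Suc n) powr \<beta> * L\<^sup>2)
    \<le> 2 * (4 * \<sigma>\<^sup>2 * exp r / (a * (exp r - 1))) powr (\<beta> / (\<beta> + 1))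
          * (b powr \<beta> * L\<^sup>2) powr (1 / (\<beta> + 1))"
proof -
  have r: "0 < r" and a: "0 < a" and b: "0 < b"
    and lower: "\<And>k. 1 \<le> k \<Longrightarrow> a * exp (- r * real k) \<le> lam k"
    and upper: "\<And>k. 1 \<le> k \<Longrightarrow> lam k \<le> b * exp (- r * real k)"
    using decay by (auto simp: exponential_decay_def)
  define B where "B = b powr \<beta> * L\<^sup>2"
  define c0 where "c0 = 4 * \<sigma>\<^sup>2 * exp r / (a * (exp r - 1))"
  have [simp]: "0 < real M" "0 < B" "0 < c0" using assms r a b by (auto simp: B_def c0_def)
  define X where "X = (real M * B / c0) powr (1 / (\<beta> + 1))"
  note bal = balance[of "real M" B c0 \<beta> 1, folded X_def]
  have "0 < real M * B / c0" using M by simp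
  then have X: "0 < X" unfolding X_def by (metis powr_gt_zero less_irrefl)
  define x where "x = ln X / r"
  have expx: "exp (r * x) = X" using r X by (simp add: x_def)
  define n where "n = nat \<lfloor>x\<rfloor>"
  \<comment> \<open>If \<open>X < 1\<close> then \<open>x\<close> is negative and \<open>n\<close>
    is \<open>0\<close>, so the lower comparison is guarded; the variance sum is then empty.\<close>
  have n: "n \<noteq> 0 \<Longrightarrow> real n \<le> x" "x \<le> real (Suc n)" unfolding n_def by linarith+
  have "lam (Suc n) powr \<beta> * L\<^sup>2 \<le> (b * exp (- r * x)) powr \<beta> * L\<^sup>2"
  proof (intro mult_right_mono powr_mono2)
    have "lam (Suc n) \<le> b * exp (- r * real (Suc n))" by (rule upper) simp
    also have "\<dots> \<le> b * exp (- r * x)" using n(2) r b by (intro mult_left_mono) auto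
    finally show "lam (Suc n) \<le> b * exp (- r * x)" .
  qed (use assms less_imp_le[OF pos[of "Suc n"]] in auto)
  also have "exp (- r * x) = X powr (- 1)"
    using X expx by (simp add: exp_minus powr_minus)
  also have "(b * X powr (- 1)) powr \<beta> * L\<^sup>2 = B * X powr (- \<beta>)"
    using b X by (simp add: powr_divide powr_minus_divide B_def)
  finally have bias: "lam (Suc n) powr \<beta> * L\<^sup>2 \<le> B * X powr (- \<beta>)" .
  have e: "0 < exp r - 1" using r by simp
  have "(\<Sum>k=1..n. 1 / lam k) \<le> (\<Sum>k=1..n. exp (r * real k) / a)"
  proof (rule sum_mono)
    fix k assume k: "k \<in> {1..n}"
    have "1 / lam k \<le> 1 / (a * exp (- r * real k))"
      using lower[of k] a k by (intro divide_left_mono mult_pos_pos pos) auto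
    also have "\<dots> = exp (r * real k) / a" by (simp add: exp_minus field_simps)
    finally show "1 / lam k \<le> exp (r * real k) / a" .
  qed
  also have "\<dots> = exp r / (exp r - 1) * (exp (r * real n) - 1) / a"
    by (simp only: sum_divide_distrib[symmetric] sum_exp[OF r])
  also have "\<dots> \<le> exp r / (exp r - 1) * X / a"
  proof (intro divide_right_mono mult_left_mono)
    show "exp (r * real n) - 1 \<le> X"
    proof (cases "n = 0")
      case False
      then have "exp (r * real n) \<le> exp (r * x)" using n(1) r by simp
      then show ?thesis by (simp add: expx)
    qed (use X in simp)
  qed (use a e in auto)
  finally have "4 * \<sigma>\<^sup>2 / real M * (\<Sum>k=1..n. 1 / lam k) \<le> 4 * \<sigma>\<^sup>2 / real M * (exp r / (exp r - 1) * X / a)"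
    by (intro mult_left_mono) auto
  also have "\<dots> = c0 / real M * X powr 1" using X by (simp add: c0_def field_simps)
  also have "\<dots> = B * X powr (- \<beta>)" using bal(1) assms by simp
  finally have "4 * \<sigma>\<^sup>2 / real M * (\<Sum>k=1..n. 1 / lam k) + lam (Suc n) powr \<beta> * L\<^sup>2 \<le> 2 * (B * X powr (- \<beta>))"
    using bias by linarith
  then have "real M powr (\<beta> / (\<beta> + 1)) *
      (4 * \<sigma>\<^sup>2 / real M * (\<Sum>k=1..n. 1 / lam k) + lam (Suc n) powr \<beta> * L\<^sup>2)
    \<le> real M powr (\<beta> / (\<beta> + 1)) * (2 * (B * X powr (- \<beta>)))"
    by (intro mult_left_mono) auto
  also have "\<dots> = 2 * c0 powr (\<beta> / (\<beta> + 1)) * B powr (1 / (\<beta> + 1))" using bal(2) assms by simp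
  finally show ?thesis unfolding B_def c0_def by blast
qed

lemma polynomial_decay_tendsto:
  assumes "polynomial_decay lam a b r" "\<And>k. 1 \<le> k \<Longrightarrow> 0 < lam k"
  shows "lam \<longlonglongrightarrow> 0"
proof (rule tendsto_sandwich[OF _ _ tendsto_const])
  have "(\<lambda>k. b * real k powr (- (2 * r))) \<longlonglongrightarrow> b * 0"
    using assms(1) by (intro tendsto_intros tendsto_neg_powr filterlim_real_sequentially)
      (auto simp: polynomial_decay_def)
  then show "(\<lambda>k. b * real k powr (- (2 * r))) \<longlonglongrightarrow> 0" by simp
  show "\<forall>\<^sub>F k in sequentially. lam k \<le> b * real k powr (- (2 * r))"
    using assms(1) by (intro eventually_sequentiallyI[of 1]) (auto simp: polynomial_decay_def)
  show "\<forall>\<^sub>F k in sequentially. 0 \<le> lam k"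
    using assms(2) by (intro eventually_sequentiallyI[of 1]) (auto intro: less_imp_le)
qed

lemma exponential_decay_tendsto:
  assumes "exponential_decay lam a b r" "\<And>k. 1 \<le> k \<Longrightarrow> 0 < lam k"
  shows "lam \<longlonglongrightarrow> 0"
proof (rule tendsto_sandwich[OF _ _ tendsto_const])
  have r: "0 < r" using assms(1) by (simp add: exponential_decay_def)
  have "(\<lambda>k. exp (- r) ^ k) \<longlonglongrightarrow> 0" using r by (intro LIMSEQ_realpow_zero) auto
  then have "(\<lambda>k. b * exp (- r) ^ k) \<longlonglongrightarrow> b * 0" by (rule tendsto_mult_left)
  then show "(\<lambda>k. b * exp (- r * real k)) \<longlonglongrightarrow> 0"
    by (simp add: exp_of_nat_mult[symmetric] mult.commute)
  show "\<forall>\<^sub>F k in sequentially. lam k \<le> b * exp (- r * real k)"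
    using assms(1) by (intro eventually_sequentiallyI[of 1]) (auto simp: exponential_decay_def)
  show "\<forall>\<^sub>F k in sequentially. 0 \<le> lam k"
    using assms(2) by (intro eventually_sequentiallyI[of 1]) (auto intro: less_imp_le)
qed

theorem theorem3p4:
  fixes S :: "(real ^ 'd) set"
    and \<rho> :: "(real ^ 'd) measure"
    and R :: "(real ^ 'd \<Rightarrow> real) \<Rightarrow> 'x::banach \<Rightarrow>
      'y::{real_inner, complete_space, second_countable_topology}"
    and N :: "(real ^ 'd \<Rightarrow> real) \<Rightarrow> (real ^ 'd \<Rightarrow> real)"
    and lam :: "nat \<Rightarrow> real"
    and \<psi> :: "nat \<Rightarrow> real ^ 'd \<Rightarrow> real"
    and P :: "'w measure"
    and u :: "'w \<Rightarrow> 'x"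
    and \<epsilon> :: "'y \<Rightarrow> 'w \<Rightarrow> real"
    and I :: "nat set"
    and y :: "nat \<Rightarrow> 'y"
    and Q :: "'v measure"
    and us :: "nat \<Rightarrow> 'v \<Rightarrow> 'x"
    and es :: "nat \<Rightarrow> 'y \<Rightarrow> 'v \<Rightarrow> real"
    and \<beta> L \<sigma> :: real
  assumes "0 < \<beta>" and "0 < L"
    and "compact S" and "sets \<rho> = sets (restrict_space borel S)"
    and "prob_space P" and "complete_measure P"
    and "u \<in> borel_measurable P"
    and "forward_map \<rho> R"
    and "normal_operator \<rho> R P u N"
    and "nonnegative_op \<rho> N" and "self_adjoint_op \<rho> N" and "compact_op \<rho> N"
    and "eigensystem \<rho> N lam \<psi>"
    and "linear_noise P \<epsilon>"
    and "noise_independent P u \<epsilon>"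
    and "noise_B1 P \<epsilon> \<sigma>"
    and "onb I y" and "noise_B2 P I y \<epsilon>"
    and "fourth_moment_condition P u R (sobolev_space \<rho> lam \<psi> \<beta>)"
    and "prob_space Q" and "iid_copies P u \<epsilon> Q us es"
  shows "(\<forall>a b r. polynomial_decay lam a b r \<longrightarrow>
      limsup (scaled_minimax_risk \<rho> R I y Q us es (sobolev_ball \<rho> lam \<psi> \<beta> L)
        (2 * \<beta> * r / (2 * \<beta> * r + 2 * r + 1)))
      \<le> ennreal (3 * (2 * \<sigma>\<^sup>2 / a) powr (2 * \<beta> * r / (2 * \<beta> * r + 2 * r + 1))
          * (b powr \<beta> * L\<^sup>2) powr ((2 * r + 1) / (2 * \<beta> * r + 2 * r + 1))))
    \<and> (\<forall>a b r. exponential_decay lam a b r \<longrightarrow>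
      limsup (scaled_minimax_risk \<rho> R I y Q us es (sobolev_ball \<rho> lam \<psi> \<beta> L)
        (\<beta> / (\<beta> + 1)))
      \<le> ennreal (2 * (4 * \<sigma>\<^sup>2 * exp r / (a * (exp r - 1))) powr (\<beta> / (\<beta> + 1))
          * (b powr \<beta> * L\<^sup>2) powr (1 / (\<beta> + 1))))"
proof -
  interpret P: prob_space P by fact
  have psi: "\<And>k. 1 \<le> k \<Longrightarrow> \<psi> k \<in> L2 \<rho>" and lam: "\<And>k. 1 \<le> k \<Longrightarrow> 0 < lam k"
    using \<open>eigensystem \<rho> N lam \<psi>\<close> by (auto simp: eigensystem_def)
  have \<sigma>: "0 < \<sigma>" using \<open>noise_B1 P \<epsilon> \<sigma>\<close> by (simp add: noise_B1_def)
  interpret noise: regression_noise P u \<epsilon> \<sigma>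
    by unfold_locales fact+
  obtain \<kappa> where \<kappa>: "1 \<le> \<kappa>" and moments: "\<And>\<phi>. \<phi> \<in> sobolev_space \<rho> lam \<psi> \<beta> \<Longrightarrow>
      integrable P (\<lambda>\<omega>. norm (R \<phi> (u \<omega>)) ^ 4) \<and>
      P.expectation (\<lambda>\<omega>. norm (R \<phi> (u \<omega>)) ^ 4) \<le> \<kappa> * (P.expectation (\<lambda>\<omega>. (norm (R \<phi> (u \<omega>)))\<^sup>2))\<^sup>2"
    using \<open>fourth_moment_condition P u R (sobolev_space \<rho> lam \<psi> \<beta>)\<close>
    unfolding fourth_moment_condition_def by metis
  have kurtosis: "noise.kurtosis_le \<kappa> (R \<phi>)" if "\<phi> \<in> sobolev_space \<rho> lam \<psi> \<beta>" for \<phi>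
    using moments[OF that] that \<open>forward_map \<rho> R\<close>
    by (auto simp: noise.kurtosis_le_def forward_map_def sobolev_space_def)
  \<comment> \<open>The locale is entered conditionally, because convergence of \<open>lam\<close>
    comes only from the decay assumption of each part.\<close>
  have model: "kernel_regression P u \<epsilon> \<sigma> \<rho> \<psi> N lam Q R I y us es \<beta> \<kappa>" if lim: "lam \<longlonglongrightarrow> 0"
  proof -
    interpret Q: prob_space Q by fact
    show ?thesis
    proof unfold_locales
      show "N \<phi> \<in> L2 \<rho>" if "\<phi> \<in> L2 \<rho>" for \<phi>
        using \<open>normal_operator \<rho> R P u N\<close> that by (simp add: normal_operator_def)
    qed (fact | erule kurtosis | use \<open>eigensystem \<rho> N lam \<psi>\<close> in \<open>force simp: eigensystem_def\<close>)+
  qed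
  show ?thesis
  proof (intro conjI allI impI)
    fix a b r assume decay: "polynomial_decay lam a b r"
    show "limsup (scaled_minimax_risk \<rho> R I y Q us es (sobolev_ball \<rho> lam \<psi> \<beta> L)
        (2 * \<beta> * r / (2 * \<beta> * r + 2 * r + 1)))
      \<le> ennreal (3 * (2 * \<sigma>\<^sup>2 / a) powr (2 * \<beta> * r / (2 * \<beta> * r + 2 * r + 1))
          * (b powr \<beta> * L\<^sup>2) powr ((2 * r + 1) / (2 * \<beta> * r + 2 * r + 1)))"
    proof (rule kernel_regression.limsup_minimax_le[OF model])
      show "lam \<longlonglongrightarrow> 0" using decay lam by (rule polynomial_decay_tendsto)
    qed (rule polynomial_tradeoff[OF decay \<open>0 < \<beta>\<close> \<open>0 < L\<close> \<sigma>]; simp add: lam)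
  next
    fix a b r assume decay: "exponential_decay lam a b r"
    show "limsup (scaled_minimax_risk \<rho> R I y Q us es (sobolev_ball \<rho> lam \<psi> \<beta> L) (\<beta> / (\<beta> + 1)))
      \<le> ennreal (2 * (4 * \<sigma>\<^sup>2 * exp r / (a * (exp r - 1))) powr (\<beta> / (\<beta> + 1))
          * (b powr \<beta> * L\<^sup>2) powr (1 / (\<beta> + 1)))"
    proof (rule kernel_regression.limsup_minimax_le[OF model])
      show "lam \<longlonglongrightarrow> 0" using decay lam by (rule exponential_decay_tendsto)
    qed (rule exponential_tradeoff[OF decay \<open>0 < \<beta>\<close> \<open>0 < L\<close> \<sigma>]; simp add: lam)
  qed
qed

end
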